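(* Let $\omega$ be a non-quasianalytic weight function satisfying $\log(1+t)=o(\omega(t))$ as $t\to\infty$. Then the multiplication operator $M\colon\mathcal{O}_{M,\omega}(\mathbb{R}^N)\times\mathcal{O}'_{C,\omega}(\mathbb{R}^N)\to\mathcal{S}'_\omega(\mathbb{R}^N)$, $(f,T)\mapsto fT$, is separately continuous and hence a hypocontinuous bilinear mapping.
   Context: Weights. A non-quasianalytic weight function is a continuous increasing function $\omega:[0,\infty)\to[0,\infty)$ such that: ($\alpha$) there is $K\ge 1$ with $\omega(2t)\le K(1+\omega(t))$ for all $t\ge 0$; ($\beta$) $\int_1^\infty \frac{\omega(t)}{1+t^2}\,dt<\infty$; ($\gamma$) there are $a\in\mathbb{R}$, $b>0$ with $\omega(t)\ge a+b\log(1+t)$ for all $t\ge 0$; ($\delta$) $\varphi_\omega(t)=\omega(e^t)$ is convex. It is assumed (normalization) that $\omega$ vanishes on $[0,1]$. For $x\in\mathbb{R}^N$, $\omega(x):=\omega(|x|)$. The Young conjugate is $\varphi^*_\omega(s):=\sup_{t\ge 0}\{st-\varphi_\omega(t)\}$, $s\ge 0$ (the value $+\infty$ is allowed, with $\exp(-\infty)=0$). Spaces. $\mathcal{S}_\omega(\mathbb{R}^N)$ is the set of all $f\in L^1(\mathbb{R}^N)$ such that $f,\hat f\in C^\infty(\mathbb{R}^N)$ and $\|\exp(\lambda\omega)\partial^\alpha f\|_\infty<\infty$, $\|\exp(\lambda\omega)\partial^\alpha\hat f\|_\infty<\infty$ for all $\lambda>0$, $\alpha\in\mathbb{N}_0^N$;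 it is a Fréchet space with the norms $q_{m,n}(f):=\sup_{\alpha}\|\exp(n\omega)\partial^\alpha f\|_\infty\exp\left(-m\varphi^*_\omega\left(\frac{|\alpha|}{m}\right)\right)$, $m,n\in\mathbb{N}$. For $m,n\in\mathbb{N}$ let $\mathcal{O}^m_{n,\omega}(\mathbb{R}^N)$ be the space of all $f\in C^\infty(\mathbb{R}^N)$ with $r_{m,n}(f):=\sup_{\alpha\in\mathbb{N}_0^N}\sup_{x\in\mathbb{R}^N}|\partial^\alpha f(x)|\exp\left(-n\omega(x)-m\varphi^*_\omega\left(\frac{|\alpha|}{m}\right)\right)<\infty$, with norm $r_{m,n}$. Set $\mathcal{O}_{M,\omega}(\mathbb{R}^N):=\bigcap_{m}\bigcup_{n}\mathcal{O}^m_{n,\omega}(\mathbb{R}^N)$ with the topology of the projective limit over $m$ of the locally convex inductive limits $\mathrm{ind}_{n}\,\mathcal{O}^m_{n,\omega}(\mathbb{R}^N)$, and $\mathcal{O}_{C,\omega}(\mathbb{R}^N):=\bigcup_{n}\bigcap_{m}\mathcal{O}^m_{n,\omega}(\mathbb{R}^N)$ with the topology of the locally convex inductive limit over $n$ of the projective limits $\mathrm{proj}_m\,\mathcal{O}^m_{n,\omega}(\mathbb{R}^N)$. A prime denotes the strong dual. The inclusion $\mathcal{S}_\omega(\mathbb{R}^N)\hookrightarrow\mathcal{O}_{C,\omega}(\mathbb{R}^N)$ is continuous with dense range, so by restriction $\mathcal{O}'_{C,\omega}(\mathbb{R}^N)\subset\mathcal{S}'_\omega(\mathbb{R}^N)$.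 For $f\in\mathcal{O}_{M,\omega}(\mathbb{R}^N)$ one has $fg\in\mathcal{S}_\omega(\mathbb{R}^N)$ for all $g\in\mathcal{S}_\omega(\mathbb{R}^N)$, with $g\mapsto fg$ continuous; for $T\in\mathcal{S}'_\omega(\mathbb{R}^N)$, $fT$ is defined by $\langle fT,g\rangle:=\langle T,fg\rangle$, $g\in\mathcal{S}_\omega(\mathbb{R}^N)$. Hypocontinuity. A bilinear map $b\colon E\times F\to G$ between topological vector spaces is hypocontinuous if for every bounded $A\subset E$ the set $\{b(x,\cdot):x\in A\}$ is equicontinuous in $\mathcal{L}(F,G)$, and for every bounded $B\subset F$ the set $\{b(\cdot,y):y\in B\}$ is equicontinuous in $\mathcal{L}(E,G)$. *)

theory Defs
  imports
    "HOL-Analysis.Analysis"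
    "HOL-Library.Function_Algebras"
    "HOL-Library.Landau_Symbols"
begin

section \<open>Topological vector spaces of complex-valued functions\<close>

text \<open>
  Every vector space below is a set of functions into the complex numbers with the pointwise
  operations: functions on \<open>real^'n\<close>, or functionals on a space of such functions.
  A topological vector space is represented by its topology, whose \<^const>\<open>topspace\<close> is the
  underlying set.
\<close>

definition csubspace :: "('a \<Rightarrow> complex) set \<Rightarrow> bool" where
  "csubspace V \<longleftrightarrow>
     0 \<in> V \<and> (\<forall>f\<in>V. \<forall>g\<in>V. f + g \<in> V) \<and> (\<forall>c. \<forall>f\<in>V. (\<lambda>x. c * f x) \<in> V)"

definition convex_fun_set :: "('a \<Rightarrow> complex) set \<Rightarrow> bool" where
  "convex_fun_set C \<longleftrightarrow>
     (\<forall>f\<in>C. \<forall>g\<in>C. \<forall>t::real. 0 \<le> t \<and> t \<le> 1 \<longrightarrow>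
        (\<lambda>x. of_real (1 - t) * f x + of_real t * g x) \<in> C)"

definition zero_nhd :: "('a \<Rightarrow> complex) topology \<Rightarrow> ('a \<Rightarrow> complex) set \<Rightarrow> bool" where
  "zero_nhd X U \<longleftrightarrow> U \<subseteq> topspace X \<and> (\<exists>W. openin X W \<and> 0 \<in> W \<and> W \<subseteq> U)"

text \<open>The Hausdorff property is not included.\<close>

definition locally_convex_tvs :: "('a \<Rightarrow> complex) topology \<Rightarrow> bool" where
  "locally_convex_tvs X \<longleftrightarrow>
     csubspace (topspace X) \<and>
     continuous_map (prod_topology X X) X (\<lambda>(f, g). f + g) \<and>
     continuous_map (prod_topology euclidean X) X (\<lambda>(c, f). \<lambda>x. c * f x) \<and>
     (\<forall>U. zero_nhd X U \<longrightarrow> (\<exists>C. convex_fun_set C \<and> zero_nhd X C \<and> C \<subseteq> U))"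

definition seminorm_topology ::
  "('a \<Rightarrow> complex) set \<Rightarrow> (('a \<Rightarrow> complex) \<Rightarrow> ennreal) set \<Rightarrow> ('a \<Rightarrow> complex) topology" where
  "seminorm_topology V P = topology (\<lambda>W. W \<subseteq> V \<and>
     (\<forall>f\<in>W. \<exists>Q e. finite Q \<and> Q \<subseteq> P \<and> 0 < e \<and>
        {g \<in> V. \<forall>p\<in>Q. p (g - f) < ennreal e} \<subseteq> W))"

lemma istopology_seminorm:
  fixes V :: "('a \<Rightarrow> complex) set"
  shows "istopology (\<lambda>W. W \<subseteq> V \<and>
     (\<forall>f\<in>W. \<exists>Q e. finite Q \<and> Q \<subseteq> P \<and> 0 < e \<and>
        {g \<in> V. \<forall>p\<in>Q. p (g - f) < ennreal e} \<subseteq> W))"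
proof -
  define B where "B f Q e = {g \<in> V. \<forall>p\<in>Q. p (g - f) < ennreal e}"
    for f and Q :: "(('a \<Rightarrow> complex) \<Rightarrow> ennreal) set" and e :: real
  define R where "R W f \<longleftrightarrow> (\<exists>Q e. finite Q \<and> Q \<subseteq> P \<and> 0 < e \<and> B f Q e \<subseteq> W)" for W f
  have RI: "R W f" if "finite Q" "Q \<subseteq> P" "0 < e" "B f Q e \<subseteq> W" for W f Q e
    unfolding R_def using that by (intro exI conjI)
  have RE: "\<exists>Q e. finite Q \<and> Q \<subseteq> P \<and> 0 < e \<and> B f Q e \<subseteq> W" if "R W f" for W f
    using that unfolding R_def .
  have mono: "R W' f" if "R W f" "W \<subseteq> W'" for W W' f
    using RE[OF that(1)] RI that(2) by (metis order_trans)
  have inter: "R (S \<inter> T) f" if S: "R S f" and T: "R T f" for S T f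
  proof -
    obtain Q e where Q: "finite Q" "Q \<subseteq> P" "0 < e" "B f Q e \<subseteq> S"
      using RE[OF S] by (elim exE conjE)
    obtain Q' d where Q': "finite Q'" "Q' \<subseteq> P" "0 < d" "B f Q' d \<subseteq> T"
      using RE[OF T] by (elim exE conjE)
    have "B f (Q \<union> Q') (min e d) \<subseteq> B f Q e \<inter> B f Q' d"
    proof
      fix g assume g: "g \<in> B f (Q \<union> Q') (min e d)"
      have "ennreal (min e d) \<le> ennreal e" "ennreal (min e d) \<le> ennreal d"
        by (auto intro: ennreal_leI)
      with g show "g \<in> B f Q e \<inter> B f Q' d"
        unfolding B_def by (auto intro: less_le_trans)
    qed
    then have "B f (Q \<union> Q') (min e d) \<subseteq> S \<inter> T"
      using Q(4) Q'(4) by (metis Int_mono order_trans)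
    then show ?thesis
      using Q Q' by (intro RI) auto
  qed
  have "istopology (\<lambda>W. W \<subseteq> V \<and> (\<forall>f\<in>W. R W f))"
    unfolding istopology_def
  proof (intro conjI allI impI)
    fix S T assume S: "S \<subseteq> V \<and> (\<forall>f\<in>S. R S f)" and T: "T \<subseteq> V \<and> (\<forall>f\<in>T. R T f)"
    show "S \<inter> T \<subseteq> V" using S by auto
    show "\<forall>f\<in>S \<inter> T. R (S \<inter> T) f" using S T by (simp add: inter)
  next
    fix K assume K: "\<forall>S\<in>K. S \<subseteq> V \<and> (\<forall>f\<in>S. R S f)"
    show "\<Union>K \<subseteq> V" using K by (simp add: Union_least)
    show "\<forall>f\<in>\<Union>K. R (\<Union>K) f"
    proof
      fix f assume "f \<in> \<Union>K"
      then obtain S where "S \<in> K" "f \<in> S" by (elim UnionE)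
      then show "R (\<Union>K) f" using K mono Union_upper by metis
    qed
  qed
  then show ?thesis unfolding R_def B_def .
qed

lemma openin_seminorm_topology:
  "openin (seminorm_topology V P) W \<longleftrightarrow> W \<subseteq> V \<and>
     (\<forall>f\<in>W. \<exists>Q e. finite Q \<and> Q \<subseteq> P \<and> 0 < e \<and>
        {g \<in> V. \<forall>p\<in>Q. p (g - f) < ennreal e} \<subseteq> W)"
  unfolding seminorm_topology_def topology_inverse'[OF istopology_seminorm] ..

lemma topspace_seminorm_topology [simp]: "topspace (seminorm_topology V P) = V"
proof -
  have "openin (seminorm_topology V P) V"
    unfolding openin_seminorm_topology by (intro conjI ballI exI[of _ "{}"] exI[of _ 1]) auto
  then show ?thesis
    unfolding topspace_def using openin_seminorm_topology[of V P] by blast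
qed

lemma openin_seminorm_topology_empty:
  "openin (seminorm_topology V {}) W \<longleftrightarrow> W = {} \<or> W = V"
proof
  assume W: "openin (seminorm_topology V {}) W"
  show "W = {} \<or> W = V"
  proof (cases "W = {}")
    case False
    then obtain f where "f \<in> W" by auto
    then have "V \<subseteq> W"
      using W[unfolded openin_seminorm_topology] by force
    then show ?thesis
      using openin_subset[OF W] by simp
  qed simp
next
  assume "W = {} \<or> W = V"
  then show "openin (seminorm_topology V {}) W"
    using openin_topspace[of "seminorm_topology V {}"] by auto
qed

text \<open>
  Projective limit (for inclusions): the initial topology on the intersection. Locally convex
  inductive limit (for inclusions): the finest locally convex topology on the union that makes all
  inclusions continuous, obtained as the join of all such topologies.
\<close>

definition proj_limit :: "nat set \<Rightarrow> (nat \<Rightarrow> ('a \<Rightarrow> complex) topology) \<Rightarrow> ('a \<Rightarrow> complex) topology" where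
  "proj_limit I X = topology_generated_by
     {(\<Inter>j\<in>I. topspace (X j)) \<inter> U | i U. i \<in> I \<and> openin (X i) U}"

definition ind_limit :: "nat set \<Rightarrow> (nat \<Rightarrow> ('a \<Rightarrow> complex) topology) \<Rightarrow> ('a \<Rightarrow> complex) topology" where
  "ind_limit I X = topology_generated_by
     {W. \<exists>Y. locally_convex_tvs Y \<and> topspace Y = (\<Union>i\<in>I. topspace (X i)) \<and>
             (\<forall>i\<in>I. continuous_map (X i) Y (\<lambda>f. f)) \<and> openin Y W}"

lemma topspace_proj_limit:
  assumes "I \<noteq> {}"
  shows "topspace (proj_limit I X) = (\<Inter>i\<in>I. topspace (X i))"
  unfolding proj_limit_def topology_generated_by_topspace using assms by auto

lemma locally_convex_tvs_trivial:
  assumes "csubspace V"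
  shows "locally_convex_tvs (seminorm_topology V {})"
proof -
  note op = openin_seminorm_topology_empty
  have cm: "continuous_map Y (seminorm_topology V {}) h"
    if "\<And>y. y \<in> topspace Y \<Longrightarrow> h y \<in> V" for Y :: "'b topology" and h
  proof -
    have "{x \<in> topspace Y. h x \<in> V} = topspace Y" using that by blast
    then show ?thesis unfolding continuous_map_def op using that by auto
  qed
  have conv: "convex_fun_set V"
    unfolding convex_fun_set_def
  proof (intro ballI allI impI)
    fix f g t assume fg: "f \<in> V" "g \<in> V"
    have "(\<lambda>x. complex_of_real (1 - t) * f x) + (\<lambda>x. complex_of_real t * g x) \<in> V"
      using fg assms unfolding csubspace_def by blast
    then show "(\<lambda>x. complex_of_real (1 - t) * f x + complex_of_real t * g x) \<in> V"
      by (simp add: plus_fun_def)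
  qed
  have V: "zero_nhd (seminorm_topology V {}) V"
    unfolding zero_nhd_def op using assms by (auto simp: csubspace_def)
  have nhd: "V \<subseteq> U" if "zero_nhd (seminorm_topology V {}) U" for U
    using that unfolding zero_nhd_def op by auto
  show ?thesis
    unfolding locally_convex_tvs_def
  proof (intro conjI allI impI)
    show "csubspace (topspace (seminorm_topology V {}))" using assms by simp
    show "continuous_map (prod_topology (seminorm_topology V {}) (seminorm_topology V {}))
       (seminorm_topology V {}) (\<lambda>(f, g). f + g)"
      by (rule cm) (use assms in \<open>auto simp: csubspace_def\<close>)
    show "continuous_map (prod_topology euclidean (seminorm_topology V {}))
       (seminorm_topology V {}) (\<lambda>(c, f). \<lambda>x. c * f x)"
      by (rule cm) (use assms in \<open>auto simp: csubspace_def\<close>)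
    fix U assume "zero_nhd (seminorm_topology V {}) U"
    then show "\<exists>C. convex_fun_set C \<and> zero_nhd (seminorm_topology V {}) C \<and> C \<subseteq> U"
      using conv V nhd by blast
  qed
qed

lemma topspace_ind_limit:
  assumes "csubspace (\<Union>i\<in>I. topspace (X i))"
  shows "topspace (ind_limit I X) = (\<Union>i\<in>I. topspace (X i))" (is "_ = ?V")
proof -
  let ?Y = "seminorm_topology ?V {}"
  note op = openin_seminorm_topology_empty
  have "continuous_map (X i) ?Y (\<lambda>f. f)" if "i \<in> I" for i
  proof -
    have "{x \<in> topspace (X i). x \<in> ?V} = topspace (X i)" using that by blast
    then show ?thesis
      unfolding continuous_map_def op using that by auto
  qed
  moreover have "openin ?Y ?V" unfolding op by simp
  ultimately have "\<exists>Y. locally_convex_tvs Y \<and> topspace Y = ?V \<and>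
             (\<forall>i\<in>I. continuous_map (X i) Y (\<lambda>f. f)) \<and> openin Y ?V"
    using locally_convex_tvs_trivial[OF assms]
    by (intro exI[of _ ?Y]) simp
  then have "?V \<subseteq> topspace (ind_limit I X)"
    unfolding ind_limit_def topology_generated_by_topspace by blast
  moreover have "topspace (ind_limit I X) \<subseteq> ?V"
    unfolding ind_limit_def topology_generated_by_topspace
  proof (rule Union_least)
    fix W assume "W \<in> {W. \<exists>Y. locally_convex_tvs Y \<and> topspace Y = ?V \<and>
             (\<forall>i\<in>I. continuous_map (X i) Y (\<lambda>f. f)) \<and> openin Y W}"
    then obtain Y where "topspace Y = ?V" "openin Y W"
      by (elim CollectE exE conjE)
    then show "W \<subseteq> ?V" using openin_subset[of Y W] by simp
  qed
  ultimately show ?thesis by (rule subset_antisym[rotated])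
qed

definition tvs_bounded :: "('a \<Rightarrow> complex) topology \<Rightarrow> ('a \<Rightarrow> complex) set \<Rightarrow> bool" where
  "tvs_bounded X B \<longleftrightarrow> B \<subseteq> topspace X \<and>
     (\<forall>U. zero_nhd X U \<longrightarrow>
        (\<exists>r>0. \<forall>c::complex. r \<le> cmod c \<longrightarrow> B \<subseteq> (\<lambda>f x. c * f x) ` U))"

text \<open>
  Functionals are total functions in HOL; those in the dual are normalised to vanish off the
  underlying space, so that equality of functionals is equality on that space.
\<close>

definition dual_space :: "('a \<Rightarrow> complex) topology \<Rightarrow> (('a \<Rightarrow> complex) \<Rightarrow> complex) set" where
  "dual_space X = {T.
     (\<forall>f. f \<notin> topspace X \<longrightarrow> T f = 0) \<and>
     (\<forall>f\<in>topspace X. \<forall>g\<in>topspace X. T (f + g) = T f + T g) \<and>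
     (\<forall>c. \<forall>f\<in>topspace X. T (\<lambda>x. c * f x) = c * T f) \<and>
     continuous_map X euclidean T}"

definition strong_dual :: "('a \<Rightarrow> complex) topology \<Rightarrow> (('a \<Rightarrow> complex) \<Rightarrow> complex) topology" where
  "strong_dual X = seminorm_topology (dual_space X)
     {(\<lambda>T. SUP f\<in>B. ennreal (cmod (T f))) | B. tvs_bounded X B}"

definition linear_between ::
  "('a \<Rightarrow> complex) topology \<Rightarrow> ('b \<Rightarrow> complex) topology \<Rightarrow>
   (('a \<Rightarrow> complex) \<Rightarrow> ('b \<Rightarrow> complex)) \<Rightarrow> bool" where
  "linear_between X Y h \<longleftrightarrow>
     (\<forall>f\<in>topspace X. h f \<in> topspace Y) \<and>
     (\<forall>f\<in>topspace X. \<forall>g\<in>topspace X. h (f + g) = h f + h g) \<and>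
     (\<forall>c. \<forall>f\<in>topspace X. h (\<lambda>x. c * f x) = (\<lambda>y. c * h f y))"

definition equicontinuous_between ::
  "('a \<Rightarrow> complex) topology \<Rightarrow> ('b \<Rightarrow> complex) topology \<Rightarrow>
   (('a \<Rightarrow> complex) \<Rightarrow> ('b \<Rightarrow> complex)) set \<Rightarrow> bool" where
  "equicontinuous_between X Y H \<longleftrightarrow>
     (\<forall>h\<in>H. linear_between X Y h \<and> continuous_map X Y h) \<and>
     (\<forall>f\<in>topspace X. \<forall>W. zero_nhd Y W \<longrightarrow>
        (\<exists>U. openin X U \<and> f \<in> U \<and> (\<forall>h\<in>H. \<forall>g\<in>U. h g - h f \<in> W)))"

definition bilinear_between ::
  "('a \<Rightarrow> complex) topology \<Rightarrow> ('b \<Rightarrow> complex) topology \<Rightarrow> ('c \<Rightarrow> complex) topology \<Rightarrow>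
   (('a \<Rightarrow> complex) \<Rightarrow> ('b \<Rightarrow> complex) \<Rightarrow> ('c \<Rightarrow> complex)) \<Rightarrow> bool" where
  "bilinear_between X Y Z b \<longleftrightarrow>
     (\<forall>x\<in>topspace X. linear_between Y Z (b x)) \<and>
     (\<forall>y\<in>topspace Y. linear_between X Z (\<lambda>x. b x y))"

definition separately_continuous ::
  "('a \<Rightarrow> complex) topology \<Rightarrow> ('b \<Rightarrow> complex) topology \<Rightarrow> ('c \<Rightarrow> complex) topology \<Rightarrow>
   (('a \<Rightarrow> complex) \<Rightarrow> ('b \<Rightarrow> complex) \<Rightarrow> ('c \<Rightarrow> complex)) \<Rightarrow> bool" where
  "separately_continuous X Y Z b \<longleftrightarrow>
     (\<forall>x\<in>topspace X. continuous_map Y Z (b x)) \<and>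
     (\<forall>y\<in>topspace Y. continuous_map X Z (\<lambda>x. b x y))"

definition hypocontinuous ::
  "('a \<Rightarrow> complex) topology \<Rightarrow> ('b \<Rightarrow> complex) topology \<Rightarrow> ('c \<Rightarrow> complex) topology \<Rightarrow>
   (('a \<Rightarrow> complex) \<Rightarrow> ('b \<Rightarrow> complex) \<Rightarrow> ('c \<Rightarrow> complex)) \<Rightarrow> bool" where
  "hypocontinuous X Y Z b \<longleftrightarrow>
     (\<forall>A. tvs_bounded X A \<longrightarrow> equicontinuous_between Y Z (b ` A)) \<and>
     (\<forall>B. tvs_bounded Y B \<longrightarrow> equicontinuous_between X Z ((\<lambda>y x. b x y) ` B))"


section \<open>Weight functions\<close>

definition nonquasianalytic_weight :: "(real \<Rightarrow> real) \<Rightarrow> bool" where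
  "nonquasianalytic_weight \<omega> \<longleftrightarrow>
     continuous_on {0..} \<omega> \<and> mono_on {0..} \<omega> \<and> (\<forall>t\<ge>0. 0 \<le> \<omega> t) \<and>
     (\<exists>K\<ge>1. \<forall>t\<ge>0. \<omega> (2 * t) \<le> K * (1 + \<omega> t)) \<and>
     set_integrable lborel {1..} (\<lambda>t. \<omega> t / (1 + t\<^sup>2)) \<and>
     (\<exists>a b. 0 < b \<and> (\<forall>t\<ge>0. a + b * ln (1 + t) \<le> \<omega> t)) \<and>
     convex_on UNIV (\<lambda>t. \<omega> (exp t)) \<and>
     (\<forall>t\<in>{0..1}. \<omega> t = 0)"

definition young_conjugate :: "(real \<Rightarrow> real) \<Rightarrow> real \<Rightarrow> ereal" where
  "young_conjugate \<omega> s = (SUP t\<in>{0..}. ereal (s * t - \<omega> (exp t)))"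

text \<open>
  \<open>exp_neg y\<close> is \<open>exp (-y)\<close> for \<open>y > -\<infinity>\<close>, with \<open>exp (-\<infinity>) = 0\<close>. For a weight the Young conjugate is
  nonnegative, since \<open>\<omega> 1 = 0\<close>.
\<close>

definition exp_neg :: "ereal \<Rightarrow> real" where
  "exp_neg y = (if y = \<infinity> then 0 else exp (- real_of_ereal y))"

definition young_factor :: "(real \<Rightarrow> real) \<Rightarrow> nat \<Rightarrow> nat \<Rightarrow> real" where
  "young_factor \<omega> m k = exp_neg (ereal (real m) * young_conjugate \<omega> (real k / real m))"


section \<open>Partial derivatives and smooth functions\<close>

definition partial :: "'n \<Rightarrow> (real^'n \<Rightarrow> complex) \<Rightarrow> real^'n::finite \<Rightarrow> complex" where
  "partial i f x = vector_derivative (\<lambda>t. f (x + t *\<^sub>R axis i 1)) (at 0)"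

definition iter_partial :: "'n list \<Rightarrow> (real^'n \<Rightarrow> complex) \<Rightarrow> real^'n::finite \<Rightarrow> complex" where
  "iter_partial is f = foldr partial is f"

definition smooth :: "(real^'n::finite \<Rightarrow> complex) \<Rightarrow> bool" where
  "smooth f \<longleftrightarrow>
     (\<forall>is. continuous_on UNIV (iter_partial is f) \<and>
        (\<forall>i x. (\<lambda>t. iter_partial is f (x + t *\<^sub>R axis i 1)) differentiable (at 0)))"

text \<open>
  Multi-indices are functions \<open>'n \<Rightarrow> nat\<close>. The order in which the partial derivatives are taken is
  left unspecified; for smooth functions it is irrelevant.
\<close>

definition multi_partial :: "('n \<Rightarrow> nat) \<Rightarrow> (real^'n \<Rightarrow> complex) \<Rightarrow> real^'n::finite \<Rightarrow> complex" where
  "multi_partial \<alpha> f = iter_partial (SOME is. \<forall>i. count_list is i = \<alpha> i) f"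

lemma ex_list_with_counts:
  fixes \<alpha> :: "'n::finite \<Rightarrow> nat"
  shows "\<exists>is. \<forall>i. count_list is i = \<alpha> i"
proof -
  obtain xs :: "'n list" where xs: "set xs = UNIV" "distinct xs"
    using finite_distinct_list[of "UNIV :: 'n set"] by auto
  have "count_list (concat (map (\<lambda>j. replicate (\<alpha> j) j) ys)) i = (if i \<in> set ys then \<alpha> i else 0)"
    if "distinct ys" for ys i
  proof -
    have rep: "count_list (replicate n j) i = (if j = i then n else 0)" for n j
      by (induction n) auto
    show ?thesis using that by (induction ys) (auto simp: rep)
  qed
  with xs show ?thesis by (metis UNIV_I)
qed


section \<open>The function spaces\<close>

definition fourier :: "(real^'n::finite \<Rightarrow> complex) \<Rightarrow> real^'n \<Rightarrow> complex" where
  "fourier f \<xi> = (LINT x|lborel. cis (- (x \<bullet> \<xi>)) * f x)"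

definition S_set :: "(real \<Rightarrow> real) \<Rightarrow> (real^'n::finite \<Rightarrow> complex) set" where
  "S_set \<omega> = {f. integrable lborel f \<and> smooth f \<and> smooth (fourier f) \<and>
     (\<forall>l::real. 0 < l \<longrightarrow> (\<forall>\<alpha>.
        bdd_above (range (\<lambda>x. exp (l * \<omega> (norm x)) * cmod (multi_partial \<alpha> f x))) \<and>
        bdd_above (range (\<lambda>x. exp (l * \<omega> (norm x)) * cmod (multi_partial \<alpha> (fourier f) x)))))}"

definition S_norm :: "(real \<Rightarrow> real) \<Rightarrow> nat \<Rightarrow> nat \<Rightarrow> (real^'n::finite \<Rightarrow> complex) \<Rightarrow> ennreal" where
  "S_norm \<omega> m n f = (SUP \<alpha>. SUP x.
     ennreal (exp (real n * \<omega> (norm x)) * cmod (multi_partial \<alpha> f x) *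
              young_factor \<omega> m (\<Sum>i\<in>UNIV. \<alpha> i)))"

definition S_space :: "(real \<Rightarrow> real) \<Rightarrow> (real^'n::finite \<Rightarrow> complex) topology" where
  "S_space \<omega> = seminorm_topology (S_set \<omega>) {S_norm \<omega> m n | m n. 1 \<le> m \<and> 1 \<le> n}"

definition O_norm :: "(real \<Rightarrow> real) \<Rightarrow> nat \<Rightarrow> nat \<Rightarrow> (real^'n::finite \<Rightarrow> complex) \<Rightarrow> ennreal" where
  "O_norm \<omega> m n f = (SUP \<alpha>. SUP x.
     ennreal (cmod (multi_partial \<alpha> f x) *
              (exp (- real n * \<omega> (norm x)) * young_factor \<omega> m (\<Sum>i\<in>UNIV. \<alpha> i))))"

definition O_step :: "(real \<Rightarrow> real) \<Rightarrow> nat \<Rightarrow> nat \<Rightarrow> (real^'n::finite \<Rightarrow> complex) topology" where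
  "O_step \<omega> m n = seminorm_topology {f. smooth f \<and> O_norm \<omega> m n f < \<infinity>} {O_norm \<omega> m n}"

definition OM_space :: "(real \<Rightarrow> real) \<Rightarrow> (real^'n::finite \<Rightarrow> complex) topology" where
  "OM_space \<omega> = proj_limit {1..} (\<lambda>m. ind_limit {1..} (\<lambda>n. O_step \<omega> m n))"

definition OC_space :: "(real \<Rightarrow> real) \<Rightarrow> (real^'n::finite \<Rightarrow> complex) topology" where
  "OC_space \<omega> = ind_limit {1..} (\<lambda>n. proj_limit {1..} (\<lambda>m. O_step \<omega> m n))"


section \<open>The multiplication operator\<close>

text \<open>
  An element of the dual of \<open>OC_space \<omega>\<close> is regarded as an element of the dual of \<open>S_space \<omega>\<close> by
  restriction; off \<open>S_set \<omega>\<close> the values are set to 0, as in \<^const>\<open>dual_space\<close>.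
\<close>

definition restrict_S ::
  "(real \<Rightarrow> real) \<Rightarrow> ((real^'n::finite \<Rightarrow> complex) \<Rightarrow> complex) \<Rightarrow> (real^'n \<Rightarrow> complex) \<Rightarrow> complex" where
  "restrict_S \<omega> T = (\<lambda>g. if g \<in> S_set \<omega> then T g else 0)"

definition mult_S' ::
  "(real \<Rightarrow> real) \<Rightarrow> (real^'n::finite \<Rightarrow> complex) \<Rightarrow> ((real^'n \<Rightarrow> complex) \<Rightarrow> complex) \<Rightarrow>
   (real^'n \<Rightarrow> complex) \<Rightarrow> complex" where
  "mult_S' \<omega> f T = restrict_S \<omega> (\<lambda>g. T (f * g))"

definition mult_op ::
  "(real \<Rightarrow> real) \<Rightarrow> (real^'n::finite \<Rightarrow> complex) \<Rightarrow> ((real^'n \<Rightarrow> complex) \<Rightarrow> complex) \<Rightarrow>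
   (real^'n \<Rightarrow> complex) \<Rightarrow> complex" where
  "mult_op \<omega> f T = mult_S' \<omega> f (restrict_S \<omega> T)"

end

theory Submission
  imports Defs
begin

text \<open>
  The space \<open>S_set \<omega>\<close> consists of the smooth functions all of whose norms \<open>S_norm \<omega> m n\<close> are finite.
  For one inclusion, (a weak form of) Fourier inversion bounds all derivatives of \<open>f\<close> by
  \<open>exp (m \<phi>\<^sup>*(|\<alpha>|/m))\<close>; interpolating between this bound for the derivative of order \<open>2k\<close> and the decay of \<open>f\<close>
  itself, one coordinate at a time, adds the weight \<open>exp (n \<omega>)\<close>. Here one needs the inequality
  \<open>\<parallel>F\<^sup>(\<^sup>k\<^sup>)\<parallel>\<^sup>2 \<le> C\<^sup>k \<parallel>F\<parallel> \<parallel>F\<^sup>(\<^sup>2\<^sup>k\<^sup>)\<parallel>\<close> on a half line, directed away from the origin. For the other inclusion, the Fourier transform of a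
  function with finite norms is at most the infimum over \<open>k\<close> of \<open>|\<xi>|\<^sup>-\<^sup>k exp (m \<phi>\<^sup>*(k/m))\<close>, which is comparable to
  \<open>exp (-m \<omega>(\<xi>))\<close> by convexity. The Leibniz rule then shows that multiplication by elements of
  \<open>OM_space \<omega>\<close> acts on \<open>S_set \<omega>\<close>.

  Hypocontinuity needs no barrelledness. For a bounded set \<open>B\<close> of \<open>S_space \<omega>\<close> the seminorm
  \<open>f \<mapsto> SUP g\<in>B. O_norm \<omega> m 1 (f * g)\<close> is finite and continuous on a whole inductive limit
  \<open>ind\<^sub>n O_step \<omega> m' n\<close>, hence bounded on bounded subsets of \<open>OM_space \<omega>\<close>. A set of functionals that is bounded on bounded subsets of
  \<open>OC_space \<omega>\<close> satisfies a uniform estimate \<open>|T h| \<le> C O_norm \<omega> m 1 h\<close>, because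
  the intersection over \<open>m\<close> of the spaces \<open>O_step \<omega> m 1\<close> is metrizable.
\<close>

section \<open>Smooth functions\<close>

text \<open>Two losses shape the estimates: for k derivatives the Leibniz rule costs a factor
  \<open>2 ^ k\<close> and the interpolation a factor \<open>16 ^ k\<close>. Both are paid for in
  the index m. By the doubling condition, shifting the variable of the supremum that defines the
  Young conjugate by \<open>ln 2\<close> trades \<open>2 ^ k\<close> for the passage from
  \<open>\<kappa> * m\<close> to m, up to a constant. Hence a bound at index m always requires its
  ingredients at a larger index, and the estimates are stated for all m together. The hypothesis on
  the logarithm makes the Young conjugate finite and bounds polynomials by exp \<omega>, so that exp
  (- \<omega>) is integrable.

  The topology of \<open>OC_space \<omega>\<close> is reached through its first step: a product f *
  g with g in \<open>S_set \<omega>\<close> is again in \<open>S_set \<omega>\<close> and so in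
  every \<open>O_step \<omega> m 1\<close>. On that step the neighbourhoods of zero contain balls of
  a single norm \<open>O_norm \<omega> m 1\<close>. In \<open>OM_space \<omega>\<close> the growth
  exponent n of a multiplier is not bounded uniformly, but every exponent is compensated by the
  arbitrarily fast decay of g at the same index m; this is why one seminorm can be continuous on all
  steps at once.\<close>

lemma has_vector_derivative_line:
  fixes v :: "'a::real_vector" and f :: "'a \<Rightarrow> 'b::real_normed_vector"
  assumes "((\<lambda>t. f (x + a *\<^sub>R v + t *\<^sub>R v)) has_vector_derivative D) (at 0)"
  shows "((\<lambda>t. f (x + t *\<^sub>R v)) has_vector_derivative D) (at a)"
proof -
  have "((\<lambda>t. f (x + a *\<^sub>R v + t *\<^sub>R v)) \<circ> (\<lambda>t. t - a) has_vector_derivative 1 *\<^sub>R D) (at a)"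
    by (rule vector_diff_chain_at) (auto intro!: derivative_eq_intros assms)
  moreover have "(\<lambda>t. f (x + a *\<^sub>R v + t *\<^sub>R v)) \<circ> (\<lambda>t. t - a) = (\<lambda>t. f (x + t *\<^sub>R v))"
    by (auto simp: o_def algebra_simps)
  ultimately show ?thesis by simp
qed

lemma iter_partial_Nil [simp]: "iter_partial [] f = f"
  and iter_partial_Cons: "iter_partial (i # is) f = partial i (iter_partial is f)"
  and iter_partial_append: "iter_partial (is @ js) f = iter_partial is (iter_partial js f)"
  by (simp_all add: iter_partial_def)

lemma smooth_iter_partial: "smooth f \<Longrightarrow> smooth (iter_partial js f)"
  unfolding smooth_def iter_partial_append[symmetric] by blast

lemma smooth_partial: "smooth f \<Longrightarrow> smooth (partial i f)"
  using smooth_iter_partial[of f "[i]"] by (simp add: iter_partial_Cons)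

lemma smooth_continuous: "smooth f \<Longrightarrow> continuous_on UNIV f"
  unfolding smooth_def by (metis iter_partial_Nil)

lemma smooth_has_partial:
  assumes "smooth f"
  shows "((\<lambda>t. f (x + t *\<^sub>R axis i 1)) has_vector_derivative partial i f (x + a *\<^sub>R axis i 1)) (at a)"
proof (rule has_vector_derivative_line)
  have "(\<lambda>t. f (x + a *\<^sub>R axis i 1 + t *\<^sub>R axis i 1)) differentiable (at 0)"
    using assms unfolding smooth_def by (metis iter_partial_Nil)
  then show "((\<lambda>t. f (x + a *\<^sub>R axis i 1 + t *\<^sub>R axis i 1)) has_vector_derivative
      partial i f (x + a *\<^sub>R axis i 1)) (at 0)"
    unfolding partial_def by (simp add: vector_derivative_works)
qed

lemma partial_eqI:
  "((\<lambda>t. f (x + t *\<^sub>R axis i 1)) has_vector_derivative D) (at 0) \<Longrightarrow> partial i f x = D"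
  unfolding partial_def by (rule vector_derivative_at)

text \<open>Every iterated derivative stays in \<open>A\<close>, so a class of continuous functions
  closed under partial derivatives consists of smooth functions. No formula for the iterated
  derivatives has to be found.\<close>

lemma smooth_coinduct:
  assumes "f \<in> A"
    and cont: "\<And>f. f \<in> A \<Longrightarrow> continuous_on UNIV f"
    and der: "\<And>f i. f \<in> A \<Longrightarrow> \<exists>g\<in>A. \<forall>x. ((\<lambda>t. f (x + t *\<^sub>R axis i 1)) has_vector_derivative g x) (at 0)"
  shows "smooth f"
proof -
  have A: "partial i g \<in> A" if g: "g \<in> A" for g i
  proof -
    obtain h where "h \<in> A" "\<forall>x. ((\<lambda>t. g (x + t *\<^sub>R axis i 1)) has_vector_derivative h x) (at 0)"
      using der[OF g] by blast
    moreover from this have "partial i g = h" by (auto intro: partial_eqI)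
    ultimately show ?thesis by simp
  qed
  have *: "iter_partial is f \<in> A" for "is"
    by (induction "is") (auto simp: iter_partial_Cons A assms(1))
  show ?thesis
    unfolding smooth_def
  proof (intro allI conjI cont[OF *])
    fix "is" i x
    show "(\<lambda>t. iter_partial is f (x + t *\<^sub>R axis i 1)) differentiable at 0"
      using der[OF *[of "is"], of i] by (auto intro: differentiableI_vector)
  qed
qed

section \<open>Sums, products and coordinate functions\<close>

lemma smooth_add:
  assumes "smooth f" "smooth g"
  shows "smooth (f + g)"
proof (rule smooth_coinduct[where A = "{f + g | f g. smooth f \<and> smooth g}"])
  fix h :: "real^'a \<Rightarrow> complex" and i :: 'a assume "h \<in> {f + g | f g. smooth f \<and> smooth g}"
  then obtain f g where h: "h = f + g" "smooth f" "smooth g" by blast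
  show "continuous_on UNIV h"
    unfolding h plus_fun_def by (intro continuous_intros smooth_continuous h)
  show "\<exists>g\<in>{f + g |f g. smooth f \<and> smooth g}.
       \<forall>x. ((\<lambda>t. h (x + t *\<^sub>R axis i 1)) has_vector_derivative g x) (at 0)"
    using smooth_has_partial[OF h(2), where a = 0 and i = i]
      smooth_has_partial[OF h(3), where a = 0 and i = i]
    by (intro bexI[of _ "partial i f + partial i g"])
      (auto simp: h intro!: derivative_eq_intros intro: smooth_partial h)
qed (use assms in blast)

lemma partial_add:
  assumes "smooth f" "smooth g"
  shows "partial i (f + g) = partial i f + partial i g"
proof
  fix x show "partial i (f + g) x = (partial i f + partial i g) x"
    using smooth_has_partial[OF assms(1), where a = 0 and i = i]
      smooth_has_partial[OF assms(2), where a = 0 and i = i]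
    by (intro partial_eqI) (auto intro!: derivative_eq_intros)
qed

lemma iter_partial_add:
  assumes "smooth f" "smooth g"
  shows "iter_partial is (f + g) = iter_partial is f + iter_partial is g"
  by (induction "is")
    (simp_all only: iter_partial_Nil iter_partial_Cons partial_add smooth_iter_partial assms)

text \<open>Products alone are not closed under differentiation, but finite sums of products are;
  this is the class for \<open>smooth_coinduct\<close> in \<open>smooth_mult\<close>.\<close>

inductive_set product_sums :: "(real^'n::finite \<Rightarrow> complex) set" where
  "smooth f \<Longrightarrow> smooth g \<Longrightarrow> f * g \<in> product_sums"
| "h \<in> product_sums \<Longrightarrow> k \<in> product_sums \<Longrightarrow> h + k \<in> product_sums"

lemma has_partial_mult:
  assumes "smooth f" "smooth g"
  shows "((\<lambda>t. (f * g) (x + t *\<^sub>R axis i 1)) has_vector_derivative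
     (partial i f * g + f * partial i g) x) (at 0)"
    using smooth_has_partial[OF assms(1), where a = 0 and i = i]
      smooth_has_partial[OF assms(2), where a = 0 and i = i]
    by (auto intro!: derivative_eq_intros)

lemma smooth_mult:
  assumes "smooth f" "smooth g"
  shows "smooth (f * g)"
proof (rule smooth_coinduct[where A = product_sums])
  show "f * g \<in> product_sums" using assms by (rule product_sums.intros)
next
  fix h :: "real^'a \<Rightarrow> complex" assume "h \<in> product_sums"
  then show "continuous_on UNIV h"
  proof induction
    case (1 f g)
    then show ?case unfolding times_fun_def by (intro continuous_intros smooth_continuous)
  next
    case (2 h k)
    then show ?case unfolding plus_fun_def by (intro continuous_intros)
  qed
next
  fix h :: "real^'a \<Rightarrow> complex" and i assume "h \<in> product_sums"
  then show "\<exists>g\<in>product_sums.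
       \<forall>x. ((\<lambda>t. h (x + t *\<^sub>R axis i 1)) has_vector_derivative g x) (at 0)"
  proof induction
    case (1 f g)
    then show ?case
      by (intro bexI[of _ "partial i f * g + f * partial i g"] allI has_partial_mult)
        (auto intro: product_sums.intros smooth_partial)
  next
    case (2 h k)
    then obtain h' k' where "h' \<in> product_sums" "k' \<in> product_sums"
      "\<forall>x. ((\<lambda>t. h (x + t *\<^sub>R axis i 1)) has_vector_derivative h' x) (at 0)"
      "\<forall>x. ((\<lambda>t. k (x + t *\<^sub>R axis i 1)) has_vector_derivative k' x) (at 0)" by blast
    then show ?case
      by (intro bexI[of _ "h' + k'"]) (auto intro: product_sums.intros intro!: derivative_eq_intros)
  qed
qed

lemma partial_mult:
  assumes "smooth f" "smooth g"
  shows "partial i (f * g) = partial i f * g + f * partial i g"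
  by (rule ext, rule partial_eqI, rule has_partial_mult[OF assms])

lemma smooth_const: "smooth (\<lambda>_. c)"
proof (rule smooth_coinduct[where A = "range (\<lambda>c _. c)"])
  fix f :: "real^'a \<Rightarrow> complex" and i assume "f \<in> range (\<lambda>c _. c)"
  then show "\<exists>g\<in>range (\<lambda>c _. c).
     \<forall>x. ((\<lambda>t. f (x + t *\<^sub>R axis i 1)) has_vector_derivative g x) (at 0)"
    by (intro bexI[of _ "\<lambda>_. 0"]) auto
qed auto

lemma partial_const [simp]: "partial i (\<lambda>_. c) = (\<lambda>_. 0)"
  by (rule ext, rule partial_eqI) auto

lemma partial_cmult:
  assumes "smooth f"
  shows "partial i (\<lambda>x. c * f x) = (\<lambda>x. c * partial i f x)"
  using partial_mult[OF smooth_const assms, of i c] by (simp add: times_fun_def plus_fun_def)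

lemma smooth_cmult: "smooth f \<Longrightarrow> smooth (\<lambda>x. c * f x)"
  using smooth_mult[OF smooth_const, of f c] by (simp add: times_fun_def)

lemma iter_partial_cmult:
  assumes "smooth f"
  shows "iter_partial is (\<lambda>x. c * f x) = (\<lambda>x. c * iter_partial is f x)"
  by (induction "is") (auto simp: iter_partial_Cons partial_cmult smooth_iter_partial assms)

lemma has_partial_coordinate:
  "((\<lambda>t. complex_of_real ((x + t *\<^sub>R axis i 1) $ j)) has_vector_derivative (if i = j then 1 else 0)) (at 0)"
proof -
  have "((\<lambda>t. (x + t *\<^sub>R axis i 1) $ j) has_real_derivative (if i = j then 1 else 0)) (at 0)"
    by (auto intro!: derivative_eq_intros simp: axis_def)
  from has_vector_derivative_of_real[OF this] show ?thesis by (simp split: if_splits)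
qed

lemma smooth_coordinate: "smooth (\<lambda>x::real^'n::finite. complex_of_real (x $ j))"
proof (rule smooth_coinduct[where A = "range (\<lambda>c _. c) \<union> {\<lambda>x. complex_of_real (x $ j)}"])
  fix f :: "real^'n \<Rightarrow> complex" and i
  assume "f \<in> range (\<lambda>c _. c) \<union> {\<lambda>x. complex_of_real (x $ j)}"
  then show "\<exists>g\<in>range (\<lambda>c _. c) \<union> {\<lambda>x. complex_of_real (x $ j)}.
     \<forall>x. ((\<lambda>t. f (x + t *\<^sub>R axis i 1)) has_vector_derivative g x) (at 0)"
  proof
    assume "f \<in> range (\<lambda>c _. c)"
    then show ?thesis by (intro bexI[of _ "\<lambda>_. 0"]) auto
  next
    assume "f \<in> {\<lambda>x. complex_of_real (x $ j)}"
    then show ?thesis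
      by (intro bexI[of _ "\<lambda>_. if i = j then 1 else 0"])
       (use has_partial_coordinate[where i = i and j = j] in auto)
  qed
qed (auto intro!: continuous_intros)

lemma partial_coordinate:
  "partial i (\<lambda>x::real^'n::finite. complex_of_real (x $ j)) = (\<lambda>_. if i = j then 1 else 0)"
  by (rule ext, rule partial_eqI, rule has_partial_coordinate)

text \<open>Differentiate \<open>f (x + t e\<^sub>j) = f x + \<integral>\<^sub>0\<^sup>t \<partial>\<^sub>j f\<close> first in direction \<open>e\<^sub>i\<close>, under the integral sign,
  and then in \<open>t\<close>.\<close>
lemma partial_commute:
  fixes f :: "real^'n::finite \<Rightarrow> complex"
  assumes f: "smooth f"
  shows "partial i (partial j f) = partial j (partial i f)"
proof
  fix x :: "real^'n"
  let ?ei = "axis i 1 :: real^'n" and ?ej = "axis j 1 :: real^'n"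
  have cont: "continuous_on A (\<lambda>s. g (h s))" if "smooth g" "continuous_on A h"
    for g :: "real^'n \<Rightarrow> complex" and h :: "'c::topological_space \<Rightarrow> real^'n" and A
    using continuous_on_compose2[OF smooth_continuous[OF that(1)] that(2)] by simp
  have int: "integral {0..t} (\<lambda>s. partial j f (y + s *\<^sub>R ?ej)) = f (y + t *\<^sub>R ?ej) - f y"
    if "0 \<le> t" for t y
    using fundamental_theorem_of_calculus[OF that, of "\<lambda>t. f (y + t *\<^sub>R ?ej)"
        "\<lambda>s. partial j f (y + s *\<^sub>R ?ej)"]
    by (simp add: smooth_has_partial[OF f] has_vector_derivative_at_within integral_unique)
  have eq: "partial i f (x + t *\<^sub>R ?ej) =
      partial i f x + integral {0..t} (\<lambda>s. partial i (partial j f) (x + s *\<^sub>R ?ej))"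
    if t: "0 \<le> t" for t
  proof -
    have "((\<lambda>r. integral (cbox 0 t) (\<lambda>s. partial j f (x + s *\<^sub>R ?ej + r *\<^sub>R ?ei)))
       has_vector_derivative integral (cbox 0 t)
        (\<lambda>s. partial i (partial j f) (x + s *\<^sub>R ?ej + 0 *\<^sub>R ?ei))) (at 0 within UNIV)"
    proof (rule leibniz_rule_vector_derivative[where
          fx = "\<lambda>r s. partial i (partial j f) (x + s *\<^sub>R ?ej + r *\<^sub>R ?ei)"])
      show "(\<lambda>s. partial j f (x + s *\<^sub>R ?ej + r *\<^sub>R ?ei)) integrable_on cbox 0 t" for r
        by (intro integrable_continuous cont smooth_partial f continuous_intros)
      show "continuous_on (UNIV \<times> cbox 0 t)
          (\<lambda>(r, s). partial i (partial j f) (x + s *\<^sub>R ?ej + r *\<^sub>R ?ei))"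
        unfolding split_def by (intro cont smooth_partial f continuous_intros)
    qed (simp_all add: smooth_has_partial smooth_partial f)
    moreover have "integral (cbox 0 t) (\<lambda>s. partial j f (x + s *\<^sub>R ?ej + r *\<^sub>R ?ei)) =
        f (x + t *\<^sub>R ?ej + r *\<^sub>R ?ei) - f (x + r *\<^sub>R ?ei)" for r
      using int[OF t, of "x + r *\<^sub>R ?ei"] by (simp add: algebra_simps)
    ultimately have "((\<lambda>r. f (x + t *\<^sub>R ?ej + r *\<^sub>R ?ei) - f (x + r *\<^sub>R ?ei))
       has_vector_derivative integral {0..t}
        (\<lambda>s. partial i (partial j f) (x + s *\<^sub>R ?ej))) (at 0)"
      by simp
    moreover have "((\<lambda>r. f (x + t *\<^sub>R ?ej + r *\<^sub>R ?ei) - f (x + r *\<^sub>R ?ei))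
       has_vector_derivative partial i f (x + t *\<^sub>R ?ej) - partial i f x) (at 0)"
      using smooth_has_partial[OF f, of "x + t *\<^sub>R ?ej" i 0] smooth_has_partial[OF f, of x i 0]
      by (intro has_vector_derivative_diff) simp_all
    ultimately have "partial i f (x + t *\<^sub>R ?ej) - partial i f x =
        integral {0..t} (\<lambda>s. partial i (partial j f) (x + s *\<^sub>R ?ej))"
      by (rule vector_derivative_unique_at[rotated])
    then show ?thesis by (simp add: diff_eq_eq add.commute)
  qed
  \<comment> \<open>The integral formula \<open>eq\<close> is available for t \<ge> 0 only, so the
    two derivatives at 0 are compared within {0..1}; a one-sided derivative is still unique.\<close>
  have "((\<lambda>t. partial i f (x + t *\<^sub>R ?ej)) has_vector_derivative
      partial i (partial j f) (x + 0 *\<^sub>R ?ej)) (at 0 within {0..1})"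
  proof (rule has_vector_derivative_transform)
    show "((\<lambda>t. partial i f x + integral {0..t} (\<lambda>s. partial i (partial j f) (x + s *\<^sub>R ?ej)))
      has_vector_derivative partial i (partial j f) (x + 0 *\<^sub>R ?ej)) (at 0 within {0..1})"
    proof -
      have "((\<lambda>t. integral {0..t} (\<lambda>s. partial i (partial j f) (x + s *\<^sub>R ?ej))) has_vector_derivative
          partial i (partial j f) (x + 0 *\<^sub>R ?ej)) (at 0 within {0..1})"
        by (intro integral_has_vector_derivative cont smooth_partial f continuous_intros) simp
      from has_vector_derivative_add[OF has_vector_derivative_const this, of "partial i f x"]
      show ?thesis by simp
    qed
  qed (auto simp: eq)
  moreover have "((\<lambda>t. partial i f (x + t *\<^sub>R ?ej)) has_vector_derivative
      partial j (partial i f) (x + 0 *\<^sub>R ?ej)) (at 0 within {0..1})"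
    by (rule has_vector_derivative_at_within, rule smooth_has_partial, rule smooth_partial, rule f)
  ultimately have "partial i (partial j f) (x + 0 *\<^sub>R ?ej) = partial j (partial i f) (x + 0 *\<^sub>R ?ej)"
    by (rule vector_derivative_unique_within[rotated]) (simp add: trivial_limit_within)
  then show "partial i (partial j f) x = partial j (partial i f) x" by simp
qed

section \<open>Independence of the order of differentiation\<close>

lemma iter_partial_partial:
  assumes "smooth f"
  shows "iter_partial is (partial i f) = partial i (iter_partial is f)"
proof (induction "is")
  case (Cons j "is")
  show ?case
    unfolding iter_partial_Cons Cons.IH by (rule partial_commute[OF smooth_iter_partial[OF assms]])
qed simp

text \<open>Makes the list chosen by \<open>SOME\<close> in \<open>multi_partial\<close> immaterial,
  and later allows all derivatives in one coordinate to be collected in front.\<close>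

lemma iter_partial_mset_cong:
  assumes "smooth f" "mset is = mset js"
  shows "iter_partial is f = iter_partial js f"
  using assms(2)
proof (induction "is" arbitrary: js)
  case (Cons i "is")
  have "i \<in> set js" using mset_eq_setD[OF Cons.prems] by auto
  then obtain as bs where js: "js = as @ i # bs" by (meson split_list)
  with Cons have "iter_partial is f = iter_partial (as @ bs) f" by simp
  then show ?case
    by (simp only: js iter_partial_append iter_partial_Cons iter_partial_partial smooth_iter_partial assms(1))
qed simp

lemma multi_partial_count_list:
  fixes f :: "real^'n::finite \<Rightarrow> complex"
  assumes "smooth f"
  shows "multi_partial (count_list is) f = iter_partial is f"
proof -
  have "\<forall>i. count_list (SOME js. \<forall>i. count_list js i = count_list is i) i = count_list is i"
    by (rule someI[of _ "is"]) simp
  then show ?thesis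
    unfolding multi_partial_def
    by (intro iter_partial_mset_cong assms) (auto simp: multiset_eq_iff count_mset)
qed

lemma sum_count_list_UNIV: "(\<Sum>i\<in>UNIV. count_list is (i::'n::finite)) = length is"
  by (rule sum_count_set) auto

lemma multi_partial_list:
  fixes f :: "real^'n::finite \<Rightarrow> complex"
  assumes "smooth f"
  obtains "is" where "multi_partial \<alpha> f = iter_partial is f" "(\<Sum>i\<in>UNIV. \<alpha> i) = length is"
proof -
  obtain "is" where "\<forall>i. count_list is i = \<alpha> i" using ex_list_with_counts by metis
  then have "\<alpha> = count_list is" by auto
  with that show ?thesis using multi_partial_count_list[OF assms] sum_count_list_UNIV by metis
qed

lemma csubspace_smooth: "csubspace {f :: real^'n::finite \<Rightarrow> complex. smooth f}"
  unfolding csubspace_def using smooth_add smooth_cmult smooth_const[of 0] by (auto simp: zero_fun_def)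

section \<open>The Fourier transform\<close>

text \<open>Where n \<le> |x| \<le> n + 1, the integrand is at most (1 + n) to the power -(D + 2),
  and the ball of radius n + 1 has volume of order (n + 1) ^ D, which leaves the series of 1 / (1 +
  n)^2. Whole balls in place of shells cost one power; hence D + 2.\<close>

lemma integrable_inverse_power_norm:
  "integrable lborel (\<lambda>x::'a::euclidean_space. inverse ((1 + norm x) ^ (DIM('a) + 2)))"
proof (rule integrableI_bounded)
  let ?D = "DIM('a)"
  let ?f = "\<lambda>x::'a. inverse ((1 + norm x) ^ (?D + 2))"
  define c where "c n = inverse ((1 + real n) ^ (?D + 2))" for n
  have le: "ennreal (norm (?f x)) \<le>
      (\<Sum>n. ennreal (c n) * indicator (cball 0 (real n + 1)) x)" for x
  proof -
    define n where "n = nat \<lfloor>norm x\<rfloor>"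
    have n: "real n \<le> norm x" "norm x \<le> real n + 1"
      unfolding n_def using norm_ge_zero[of x] by linarith+
    have "?f x \<le> c n"
      unfolding c_def using n by (intro le_imp_inverse_le power_mono zero_less_power) auto
    moreover have "norm (?f x) = ?f x" by simp
    ultimately have "norm (?f x) \<le> c n" by (simp only:)
    then have "ennreal (norm (?f x)) \<le>
        ennreal (c n) * indicator (cball 0 (real n + 1)) x"
      using n by (auto intro: ennreal_leI)
    also have "\<dots> \<le>
      (\<Sum>n. ennreal (c n) * indicator (cball 0 (real n + 1)) x)"
    proof -
      have "F n \<le> suminf F" for F :: "nat \<Rightarrow> ennreal"
        using sum_le_suminf[of F "{n}"] by simp
      then show ?thesis .
    qed
    finally show ?thesis .
  qed
  have "(\<integral>\<^sup>+ x. ennreal (norm (?f x)) \<partial>lborel) \<le>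
    (\<integral>\<^sup>+ (x::'a). (\<Sum>n. ennreal (c n) * indicator (cball 0 (real n + 1)) x) \<partial>lborel)"
    by (intro nn_integral_mono le)
  also have "\<dots> = (\<Sum>n. \<integral>\<^sup>+ (x::'a). ennreal (c n) * indicator (cball 0 (real n + 1)) x \<partial>lborel)"
    by (intro nn_integral_suminf borel_measurable_times_ennreal borel_measurable_indicator) auto
  also have "\<dots> = (\<Sum>n. ennreal (unit_ball_vol ?D * (1 / (1 + real n)\<^sup>2)))"
  proof (intro suminf_cong)
    fix n
    have "(\<integral>\<^sup>+ (x::'a). ennreal (c n) * indicator (cball 0 (real n + 1)) x \<partial>lborel)
      = ennreal (c n) * ennreal (unit_ball_vol ?D * (real n + 1) ^ ?D)"
      by (simp add: nn_integral_cmult_indicator emeasure_cball)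
    also have "\<dots> = ennreal (c n * (unit_ball_vol ?D * (real n + 1) ^ ?D))"
      unfolding c_def by (rule ennreal_mult[symmetric]) auto
    also have "c n * (unit_ball_vol ?D * (real n + 1) ^ ?D) =
      unit_ball_vol ?D * (1 / (1 + real n)\<^sup>2)"
    proof -
      have "1 + real n \<noteq> 0" by linarith
      then show ?thesis unfolding c_def power_add by (simp add: divide_simps add.commute)
    qed
    finally show "(\<integral>\<^sup>+ (x::'a). ennreal (c n) * indicator (cball 0 (real n + 1)) x \<partial>lborel)
      = ennreal (unit_ball_vol ?D * (1 / (1 + real n)\<^sup>2))" .
  qed
  also have "\<dots> < \<infinity>"
  proof -
    have "summable (\<lambda>n. 1 / (1 + real n)\<^sup>2)"
    proof -
      have "summable (\<lambda>n. inverse ((real (Suc n))\<^sup>2))"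
        unfolding summable_Suc_iff[of "\<lambda>n. inverse ((real n)\<^sup>2)"] by (rule inverse_power_summable) simp
      then show ?thesis by (simp add: inverse_eq_divide)
    qed
    then have "summable (\<lambda>n. unit_ball_vol ?D * (1 / (1 + real n)\<^sup>2))" by (rule summable_mult)
    then show ?thesis by (subst suminf_ennreal2) auto
  qed
  finally show "(\<integral>\<^sup>+ x. ennreal (norm (?f x)) \<partial>lborel) < \<infinity>" .
qed auto

lemma continuous_borel: "continuous_on UNIV f \<Longrightarrow> f \<in> borel_measurable lborel"
  using borel_measurable_continuous_onI by auto

lemma borel_measurable_cis [measurable (raw)]:
  "f \<in> borel_measurable M \<Longrightarrow> (\<lambda>x. cis (f x)) \<in> borel_measurable M"
  by (rule borel_measurable_continuous_on[of cis]) (auto intro!: continuous_intros)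

lemma norm_cis_diff_le: "norm (cis t - 1) \<le> \<bar>t\<bar>"
  using dist_exp_i_1[of t] abs_sin_x_le_abs_x[of "t / 2"] by (simp add: cis_conv_exp)

lemma integral_lborel_affine:
  fixes f :: "'a::euclidean_space \<Rightarrow> 'b::{banach, second_countable_topology}"
  assumes f: "integrable lborel f" and c: "c \<noteq> 0"
  shows "integrable lborel (\<lambda>x. f (t + c *\<^sub>R x))"
    "(\<integral>x. f (t + c *\<^sub>R x) \<partial>lborel) = (1 / \<bar>c\<bar> ^ DIM('a)) *\<^sub>R (\<integral>x. f x \<partial>lborel)"
proof -
  have m [measurable]: "f \<in> borel_measurable borel" using f by auto
  have aff: "lborel = density (distr lborel borel (\<lambda>x::'a. t + c *\<^sub>R x)) (\<lambda>_. ennreal (\<bar>c\<bar> ^ DIM('a)))"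
    by (rule lborel_affine[OF c])
  have "integrable (density (distr lborel borel (\<lambda>x::'a. t + c *\<^sub>R x)) (\<lambda>_. ennreal (\<bar>c\<bar> ^ DIM('a)))) f"
    using f aff by simp
  then have "integrable lborel (\<lambda>x. \<bar>c\<bar> ^ DIM('a) *\<^sub>R f (t + c *\<^sub>R x))"
    by (subst (asm) integrable_density) (auto simp: integrable_distr_eq)
  from integrable_scaleR_right[OF this, of "1 / \<bar>c\<bar> ^ DIM('a)"]
  show "integrable lborel (\<lambda>x. f (t + c *\<^sub>R x))" using c by simp
  have "(\<integral>x. f x \<partial>lborel) = integral\<^sup>L (density (distr lborel borel (\<lambda>x::'a. t + c *\<^sub>R x)) (\<lambda>_. ennreal (\<bar>c\<bar> ^ DIM('a)))) f"
    using aff by simp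
  also have "\<dots> = \<bar>c\<bar> ^ DIM('a) *\<^sub>R (\<integral>x. f (t + c *\<^sub>R x) \<partial>lborel)"
    by (subst integral_density) (auto simp: integral_distr)
  finally show "(\<integral>x. f (t + c *\<^sub>R x) \<partial>lborel) = (1 / \<bar>c\<bar> ^ DIM('a)) *\<^sub>R (\<integral>x. f x \<partial>lborel)"
    using c by simp
qed

lemma integrable_cis_mult:
  fixes f :: "real^'n::finite \<Rightarrow> complex"
  assumes "integrable lborel f" and [measurable]: "g \<in> borel_measurable borel"
  shows "integrable lborel (\<lambda>x. cis (g x) * f x)"
  using assms(1)
proof (rule Bochner_Integration.integrable_bound)
  have [measurable]: "f \<in> borel_measurable borel" using assms(1) by auto
  show "(\<lambda>x. cis (g x) * f x) \<in> borel_measurable lborel" by measurable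
qed (simp add: norm_mult)

section \<open>Continuity and derivatives of Fourier transforms\<close>

lemma norm_fourier_le:
  assumes "integrable lborel f"
  shows "norm (fourier f \<xi>) \<le> (\<integral>x. norm (f x) \<partial>lborel)"
proof -
  have "norm (fourier f \<xi>) \<le> (\<integral>x. norm (cis (- (x \<bullet> \<xi>)) * f x) \<partial>lborel)"
    unfolding fourier_def by (rule integral_norm_bound)
  then show ?thesis by (simp add: norm_mult)
qed

lemma continuous_fourier:
  fixes f :: "real^'n::finite \<Rightarrow> complex"
  assumes f: "integrable lborel f"
  shows "continuous_on UNIV (fourier f)"
proof -
  have [measurable]: "f \<in> borel_measurable borel" using f by auto
  have cis: "isCont cis t" for t
    using continuous_on_cis[OF continuous_on_id, of UNIV]
    by (simp add: continuous_on_eq_continuous_at)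
  have "(\<lambda>n. fourier f (X n)) \<longlonglongrightarrow> fourier f \<xi>" if X: "X \<longlonglongrightarrow> \<xi>" for X \<xi>
    unfolding fourier_def
  proof (rule integral_dominated_convergence)
    show "integrable lborel (\<lambda>x. norm (f x))" using f by simp
    show "AE x in lborel. (\<lambda>n. cis (- (x \<bullet> X n)) * f x) \<longlonglongrightarrow> cis (- (x \<bullet> \<xi>)) * f x"
      by (intro AE_I2 tendsto_mult tendsto_const isCont_tendsto_compose[of _ cis] cis tendsto_intros X)
  qed (auto simp: norm_mult)
  then show ?thesis
    unfolding continuous_on_eq_continuous_at[OF open_UNIV] continuous_at_sequentially by (auto simp: o_def)
qed

text \<open>Differentiation under the integral sign: the remainder \<open>e y x\<close>, divided by
  |y|, tends to 0 for each x and is dominated by 2 |v| |x| |u x|, since |cis t - 1| \<le>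
  |t|.\<close>

lemma fourier_has_vector_derivative:
  fixes u :: "real^'n::finite \<Rightarrow> complex"
  assumes u: "integrable lborel u" and xu: "integrable lborel (\<lambda>x. norm x * norm (u x))"
  shows "((\<lambda>t. fourier u (\<xi> + t *\<^sub>R v)) has_vector_derivative
    fourier (\<lambda>x. - \<i> * of_real (x \<bullet> v) * u x) (\<xi> + a *\<^sub>R v)) (at a)"
proof (rule has_vector_derivative_line)
  define \<xi>' where "\<xi>' = \<xi> + a *\<^sub>R v"
  have [measurable]: "u \<in> borel_measurable borel" using u by auto
  define d where "d x = - \<i> * of_real (x \<bullet> v) * u x" for x
  have d: "integrable lborel d"
  proof (rule Bochner_Integration.integrable_bound)
    show "integrable lborel (\<lambda>x. norm v * (norm x * norm (u x)))" using xu by simp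
    show "d \<in> borel_measurable lborel" unfolding d_def by measurable
    show "AE x in lborel. norm (d x) \<le> norm (norm v * (norm x * norm (u x)))"
      unfolding d_def using Cauchy_Schwarz_ineq2[of _ v]
      by (intro AE_I2) (simp add: norm_mult mult.assoc[symmetric] mult.commute[of "norm v"] mult_right_mono)
  qed
  define e where "e y x = cis (- (x \<bullet> (\<xi>' + y *\<^sub>R v))) * u x - cis (- (x \<bullet> \<xi>')) * u x - y *\<^sub>R (cis (- (x \<bullet> \<xi>')) * d x)" for y x
  have e_eq: "e y x = cis (- (x \<bullet> \<xi>')) * u x * (cis (- (y * (x \<bullet> v))) - 1 - y *\<^sub>R (- \<i> * of_real (x \<bullet> v)))" for y x
  proof -
    have "cis (- (x \<bullet> (\<xi>' + y *\<^sub>R v))) = cis (- (x \<bullet> \<xi>')) * cis (- (y * (x \<bullet> v)))"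
      by (simp add: inner_add_right cis_mult)
    then show ?thesis unfolding e_def d_def by (simp add: algebra_simps)
  qed
  have int: "fourier u (\<xi>' + y *\<^sub>R v) - fourier u \<xi>' - y *\<^sub>R fourier d \<xi>' = (\<integral>x. e y x \<partial>lborel)" for y
    unfolding fourier_def e_def
    by (simp add: integrable_cis_mult[OF u] integrable_cis_mult[OF d] d_def[symmetric])
  have e_norm: "norm (e y x) / \<bar>y\<bar> \<le> 2 * norm v * (norm x * norm (u x))" for y x
  proof -
    have "norm (cis (- (y * (x \<bullet> v))) - 1 - y *\<^sub>R (- \<i> * of_real (x \<bullet> v))) \<le>
       norm (cis (- (y * (x \<bullet> v))) - 1) + norm (y *\<^sub>R (- \<i> * of_real (x \<bullet> v)))"
      by (rule norm_triangle_ineq4)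
    also have "\<dots> \<le> \<bar>y\<bar> * \<bar>x \<bullet> v\<bar> + \<bar>y\<bar> * \<bar>x \<bullet> v\<bar>"
      using norm_cis_diff_le[of "- (y * (x \<bullet> v))"] by (intro add_mono) (auto simp: norm_mult abs_mult)
    also have "\<dots> \<le> \<bar>y\<bar> * (2 * (norm x * norm v))"
      using mult_left_mono[OF Cauchy_Schwarz_ineq2[of x v], of "\<bar>y\<bar>"] by (simp add: algebra_simps)
    finally have "norm (e y x) \<le> norm (u x) * (\<bar>y\<bar> * (2 * (norm x * norm v)))"
      unfolding e_eq norm_mult[of "_ * _"] by (auto simp: norm_mult intro!: mult_left_mono)
    then show ?thesis by (cases "y = 0") (auto simp: field_simps)
  qed
  have e_lim: "((\<lambda>y. norm (e y x) / \<bar>y\<bar>) \<longlongrightarrow> 0) (at 0)" for x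
  proof -
    have "((\<lambda>y. cis (- (y * (x \<bullet> v)))) has_derivative (\<lambda>y. y *\<^sub>R (- \<i> * of_real (x \<bullet> v)))) (at 0)"
      by (auto intro!: derivative_eq_intros simp: scaleR_conv_of_real)
    then have "((\<lambda>y. norm (cis (- (y * (x \<bullet> v))) - 1 - y *\<^sub>R (- \<i> * of_real (x \<bullet> v))) / \<bar>y\<bar>) \<longlongrightarrow> 0) (at 0)"
      unfolding has_derivative_iff_norm by simp
    from tendsto_mult_left[OF this, of "norm (u x)"] show ?thesis
      unfolding e_eq by (simp add: norm_mult mult.assoc)
  qed
  have "((\<lambda>y. \<integral>x. norm (e y x) / \<bar>y\<bar> \<partial>lborel) \<longlongrightarrow> (\<integral>x. 0 \<partial>(lborel :: (real^'n) measure))) (at 0)"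
    unfolding tendsto_at_iff_sequentially o_def
  proof (intro allI impI)
    fix X :: "nat \<Rightarrow> real" assume X: "\<forall>i. X i \<in> UNIV - {0}" "X \<longlonglongrightarrow> 0"
    show "(\<lambda>n. \<integral>x. norm (e (X n) x) / \<bar>X n\<bar> \<partial>lborel) \<longlonglongrightarrow> (\<integral>x. 0 \<partial>(lborel :: (real^'n) measure))"
    proof (rule integral_dominated_convergence)
      show "integrable lborel (\<lambda>x. 2 * norm v * (norm x * norm (u x)))" using xu by simp
      show "(\<lambda>x. norm (e (X n) x) / \<bar>X n\<bar>) \<in> borel_measurable lborel" for n
        unfolding e_def d_def by measurable
      show "AE x in lborel. (\<lambda>n. norm (e (X n) x) / \<bar>X n\<bar>) \<longlonglongrightarrow> 0"
        using e_lim X unfolding tendsto_at_iff_sequentially o_def by auto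
      show "AE x in lborel. norm (norm (e (X n) x) / \<bar>X n\<bar>) \<le> 2 * norm v * (norm x * norm (u x))" for n
        using e_norm by auto
    qed simp
  qed
  then have lim: "((\<lambda>y. \<integral>x. norm (e y x) / \<bar>y\<bar> \<partial>lborel) \<longlongrightarrow> 0) (at 0)" by simp
  have "((\<lambda>t. fourier u (\<xi>' + t *\<^sub>R v)) has_vector_derivative fourier d \<xi>') (at 0)"
    unfolding has_vector_derivative_def has_derivative_iff_norm
  proof (intro conjI bounded_linear_scaleR_left)
    show "((\<lambda>y. norm (fourier u (\<xi>' + y *\<^sub>R v) - fourier u (\<xi>' + 0 *\<^sub>R v) - (y - 0) *\<^sub>R fourier d \<xi>') / norm (y - 0))
       \<longlongrightarrow> 0) (at 0)"
    proof (rule Lim_null_comparison[OF always_eventually lim], rule allI)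
      fix y
      have "norm (\<integral>x. e y x \<partial>lborel) / \<bar>y\<bar> \<le> (\<integral>x. norm (e y x) \<partial>lborel) / \<bar>y\<bar>"
        by (intro divide_right_mono integral_norm_bound) auto
      then show "norm (norm (fourier u (\<xi>' + y *\<^sub>R v) - fourier u (\<xi>' + 0 *\<^sub>R v) - (y - 0) *\<^sub>R fourier d \<xi>') / norm (y - 0))
         \<le> (\<integral>x. norm (e y x) / \<bar>y\<bar> \<partial>lborel)"
        by (simp add: int)
    qed
  qed
  then show "((\<lambda>t. fourier u (\<xi> + a *\<^sub>R v + t *\<^sub>R v)) has_vector_derivative
    fourier (\<lambda>x. - \<i> * of_real (x \<bullet> v) * u x) (\<xi> + a *\<^sub>R v)) (at 0)"
    unfolding \<xi>'_def d_def .
qed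

text \<open>By translation invariance the integral of \<open>w (x + v) - w x = \<integral>\<^sub>0\<^sup>1 dw (x + s v) ds\<close> vanishes,
  and by Fubini it equals the integral of \<open>dw\<close>.\<close>
lemma integral_directional_derivative:
  fixes w dw :: "'a::euclidean_space \<Rightarrow> complex"
  assumes w: "integrable lborel w" and dw: "integrable lborel dw" and cont: "continuous_on UNIV dw"
    and deriv: "\<And>x a. ((\<lambda>t. w (x + t *\<^sub>R v)) has_vector_derivative dw (x + a *\<^sub>R v)) (at a)"
  shows "(\<integral>x. dw x \<partial>lborel) = 0"
proof -
  have [measurable]: "dw \<in> borel_measurable borel" using dw by auto
  note tr = integral_lborel_affine[where c = 1, simplified]
  define k where "k = (\<lambda>(s::real, x). indicator {0..1} s *\<^sub>R dw (s *\<^sub>R v + x))"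
  have k: "integrable (lborel \<Otimes>\<^sub>M lborel) k"
  proof (rule lborel_pair.Fubini_integrable)
    show "k \<in> borel_measurable (lborel \<Otimes>\<^sub>M lborel)" unfolding k_def by measurable
    have "(\<integral>x. norm (k (s, x)) \<partial>lborel) = indicator {0..1} s * (\<integral>x. norm (dw x) \<partial>lborel)" for s
      unfolding k_def using tr(2)[of "\<lambda>x. norm (dw x)" "s *\<^sub>R v"] dw by simp
    then show "integrable lborel (\<lambda>s. \<integral>x. norm (k (s, x)) \<partial>lborel)"
      by (simp add: integrable_mult_left)
    show "AE s in lborel. integrable lborel (\<lambda>x. k (s, x))"
      unfolding k_def using tr(1)[OF dw] by (auto intro!: integrable_scaleR_right)
  qed
  have ftc: "(\<integral>s. k (s, x) \<partial>lborel) = w (v + x) - w x" for x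
  proof -
    have "((\<lambda>s. dw (x + s *\<^sub>R v)) has_integral (w (x + 1 *\<^sub>R v) - w (x + 0 *\<^sub>R v))) {0..1}"
      by (rule fundamental_theorem_of_calculus) (auto intro: has_vector_derivative_at_within deriv)
    moreover have "set_integrable lborel {0..1} (\<lambda>s. dw (x + s *\<^sub>R v))"
      by (rule borel_integrable_atLeastAtMost')
        (auto intro!: continuous_on_compose2[OF cont] continuous_intros)
    ultimately have "(LINT s:{0..1}|lborel. dw (x + s *\<^sub>R v)) = w (x + 1 *\<^sub>R v) - w (x + 0 *\<^sub>R v)"
      using set_borel_integral_eq_integral(2) integral_unique by metis
    then show ?thesis by (simp add: k_def set_lebesgue_integral_def add.commute)
  qed
  have "(\<integral>x. (\<integral>s. k (s, x) \<partial>lborel) \<partial>lborel) = (\<integral>s. (\<integral>x. k (s, x) \<partial>lborel) \<partial>lborel)"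
    using lborel_pair.Fubini_integral[of "\<lambda>s x. k (s, x)"] k by simp
  also have "\<dots> = (\<integral>s. indicator {0..1::real} s *\<^sub>R (\<integral>x. dw x \<partial>lborel) \<partial>lborel)"
    unfolding k_def using tr(2)[OF dw] by simp
  also have "\<dots> = (\<integral>x. dw x \<partial>lborel)" by simp
  finally have "(\<integral>x. dw x \<partial>lborel) = (\<integral>x. w (v + x) - w x \<partial>lborel)"
    unfolding ftc ..
  also have "\<dots> = 0" using tr[OF w, of v] w by simp
  finally show ?thesis .
qed

text \<open>\<open>integral_directional_derivative\<close> is applied to u times the character; the
  product rule yields the transform of \<open>du\<close> and a multiple of the transform of
  \<open>u\<close>, and their combination has integral 0.\<close>

lemma fourier_derivative:
  fixes u du :: "real^'n::finite \<Rightarrow> complex"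
  assumes u: "integrable lborel u" "continuous_on UNIV u"
    and du: "integrable lborel du" "continuous_on UNIV du"
    and deriv: "\<And>x a. ((\<lambda>t. u (x + t *\<^sub>R v)) has_vector_derivative du (x + a *\<^sub>R v)) (at a)"
  shows "fourier du \<xi> = \<i> * of_real (v \<bullet> \<xi>) * fourier u \<xi>"
proof -
  define w where "w x = cis (- (x \<bullet> \<xi>)) * u x" for x
  define dw where "dw x = cis (- (x \<bullet> \<xi>)) * du x - \<i> * of_real (v \<bullet> \<xi>) * (cis (- (x \<bullet> \<xi>)) * u x)" for x
  have iu: "integrable lborel (\<lambda>x. cis (- (x \<bullet> \<xi>)) * u x)" "integrable lborel (\<lambda>x. cis (- (x \<bullet> \<xi>)) * du x)"
    by (auto intro!: integrable_cis_mult u du)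
  have "(\<integral>x. dw x \<partial>lborel) = 0"
  proof (rule integral_directional_derivative)
    show "integrable lborel w" "integrable lborel dw"
      unfolding w_def dw_def using iu by auto
    show "continuous_on UNIV dw"
      unfolding dw_def by (intro continuous_intros u du)
    show "((\<lambda>t. w (x + t *\<^sub>R v)) has_vector_derivative dw (x + a *\<^sub>R v)) (at a)" for x a
    proof -
      have "((\<lambda>t. cis (- ((x + t *\<^sub>R v) \<bullet> \<xi>))) has_vector_derivative
         - (v \<bullet> \<xi>) *\<^sub>R (\<i> * cis (- ((x + a *\<^sub>R v) \<bullet> \<xi>)))) (at a)"
        unfolding has_vector_derivative_def
        by (auto intro!: derivative_eq_intros simp: inner_add_left)
      from has_vector_derivative_mult[OF this deriv[of x a]]
      show ?thesis
        unfolding w_def dw_def by (simp add: scaleR_conv_of_real algebra_simps)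
    qed
  qed
  then show ?thesis
    unfolding dw_def fourier_def using iu by simp
qed

section \<open>The Gaussian and a weak form of Fourier inversion\<close>

definition gaussian :: "real^'n::finite \<Rightarrow> complex" where
  "gaussian x = of_real (exp (- (norm x)\<^sup>2 / 2))"

lemma continuous_gaussian: "continuous_on A gaussian"
  unfolding gaussian_def by (intro continuous_intros) auto

lemma power_exp_bounded:
  obtains C :: real where "\<And>t. 0 \<le> t \<Longrightarrow> (1 + t) ^ k * exp (- t\<^sup>2 / 2) \<le> C"
proof
  fix t :: real assume t: "0 \<le> t"
  have "real k * t \<le> (t\<^sup>2 + (real k)\<^sup>2) / 2"
    using zero_le_power2[of "real k - t"] unfolding power2_diff by (simp add: field_simps)
  then have *: "real k * t - t\<^sup>2 / 2 \<le> (real k)\<^sup>2 / 2" unfolding add_divide_distrib by linarith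
  have "(1 + t) ^ k * exp (- t\<^sup>2 / 2) \<le> exp t ^ k * exp (- t\<^sup>2 / 2)"
    using t exp_ge_add_one_self[of t] by (intro mult_right_mono power_mono) auto
  also have "\<dots> = exp (real k * t - t\<^sup>2 / 2)"
    by (simp only: exp_of_nat_mult[symmetric] exp_add[symmetric]) simp
  also have "\<dots> \<le> exp ((real k)\<^sup>2 / 2)" using * by simp
  finally show "(1 + t) ^ k * exp (- t\<^sup>2 / 2) \<le> exp ((real k)\<^sup>2 / 2)" .
qed

lemma integrable_gaussian_power:
  "integrable lborel (\<lambda>x::real^'n::finite. (1 + norm x) ^ k * norm (gaussian x))"
proof -
  let ?D = "DIM(real^'n)"
  obtain C :: real where C: "\<And>t. 0 \<le> t \<Longrightarrow> (1 + t) ^ (k + (?D + 2)) * exp (- t\<^sup>2 / 2) \<le> C"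
    using power_exp_bounded by blast
  show ?thesis
  proof (rule Bochner_Integration.integrable_bound)
    show "integrable lborel (\<lambda>x::real^'n. C * inverse ((1 + norm x) ^ (?D + 2)))"
      by (intro integrable_mult_right integrable_inverse_power_norm)
    show "(\<lambda>x::real^'n. (1 + norm x) ^ k * norm (gaussian x)) \<in> borel_measurable lborel"
      by (intro continuous_borel continuous_intros continuous_gaussian)
    have "norm ((1 + norm x) ^ k * norm (gaussian x)) \<le> norm (C * inverse ((1 + norm x) ^ (?D + 2)))"
      for x :: "real^'n"
    proof -
      have pos: "0 < (1 + norm x) ^ (?D + 2)"
        by (intro zero_less_power add_pos_nonneg) auto
      have "(1 + norm x) ^ k * exp (- (norm x)\<^sup>2 / 2) * (1 + norm x) ^ (?D + 2) \<le> C"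
        using C[of "norm x"] unfolding power_add[of _ k] by (simp only: mult_ac norm_ge_zero)
      then have "(1 + norm x) ^ k * exp (- (norm x)\<^sup>2 / 2) \<le> C * inverse ((1 + norm x) ^ (?D + 2))"
        using pos by (simp only: pos_le_divide_eq divide_inverse[symmetric])
      also have "\<dots> \<le> norm \<dots>" by simp
      finally show ?thesis by (simp add: gaussian_def)
    qed
    then show "AE x::real^'n in lborel. norm ((1 + norm x) ^ k * norm (gaussian x)) \<le>
        norm (C * inverse ((1 + norm x) ^ (?D + 2)))" by simp
  qed
qed

lemma integrable_gaussian: "integrable lborel (gaussian :: real^'n::finite \<Rightarrow> complex)"
proof (rule Bochner_Integration.integrable_bound[OF integrable_gaussian_power[of 0]])
  show "gaussian \<in> borel_measurable (lborel :: (real^'n) measure)"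
    by (rule continuous_borel[OF continuous_gaussian])
qed auto

lemma integrable_norm_gaussian:
  "integrable lborel (\<lambda>x::real^'n::finite. norm x * norm (gaussian x))"
proof (rule Bochner_Integration.integrable_bound[OF integrable_gaussian_power[of 1]])
  show "(\<lambda>x::real^'n. norm x * norm (gaussian x)) \<in> borel_measurable lborel"
    by (intro continuous_borel continuous_intros continuous_gaussian)
qed (auto intro!: AE_I2 mult_right_mono)

text \<open>The directional derivative of the Gaussian is a multiplication, and the transform
  interchanges the two operations. So along the ray t \<xi> the transform satisfies the same linear
  differential equation as the Gaussian; \<open>h\<close> is the quotient of the two solutions and
  hence constant.\<close>

lemma fourier_gaussian:
  fixes \<xi> :: "real^'n::finite"
  shows "fourier gaussian \<xi> = fourier gaussian (0 :: real^'n) * of_real (exp (- (norm \<xi>)\<^sup>2 / 2))"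
proof -
  define d where "d x = - of_real (x \<bullet> \<xi>) * gaussian x" for x :: "real^'n"
  have d: "fourier d \<eta> = \<i> * of_real (\<xi> \<bullet> \<eta>) * fourier gaussian \<eta>" for \<eta>
  proof (rule fourier_derivative[OF integrable_gaussian continuous_gaussian])
    show "continuous_on UNIV d"
      unfolding d_def by (intro continuous_intros continuous_gaussian)
    then have m: "d \<in> borel_measurable lborel" by (rule continuous_borel)
    show "integrable lborel d"
    proof (rule Bochner_Integration.integrable_bound[OF _ m])
      show "integrable lborel (\<lambda>x::real^'n. norm \<xi> * (norm x * norm (gaussian x)))"
        by (intro integrable_mult_right integrable_norm_gaussian)
      show "AE x in lborel. norm (d x) \<le> norm (norm \<xi> * (norm x * norm (gaussian x)))"
        unfolding d_def using Cauchy_Schwarz_ineq2[of _ \<xi>]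
        by (intro AE_I2) (simp add: norm_mult mult.assoc[symmetric] mult.commute[of "norm \<xi>"] mult_right_mono)
    qed
    show "((\<lambda>t. gaussian (x + t *\<^sub>R \<xi>)) has_vector_derivative d (x + a *\<^sub>R \<xi>)) (at a)" for x a
    proof -
      have eq: "(norm (x + t *\<^sub>R \<xi>))\<^sup>2 = x \<bullet> x + 2 * t * (x \<bullet> \<xi>) + t\<^sup>2 * (\<xi> \<bullet> \<xi>)" for t
        unfolding power2_norm_eq_inner
        by (simp add: inner_add_left inner_add_right inner_commute power2_eq_square)
      have "((\<lambda>t. exp (- (x \<bullet> x + 2 * t * (x \<bullet> \<xi>) + t\<^sup>2 * (\<xi> \<bullet> \<xi>)) / 2)) has_real_derivative
         - ((x + a *\<^sub>R \<xi>) \<bullet> \<xi>) * exp (- (x \<bullet> x + 2 * a * (x \<bullet> \<xi>) + a\<^sup>2 * (\<xi> \<bullet> \<xi>)) / 2)) (at a)"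
        by (auto intro!: derivative_eq_intros simp: inner_add_left)
      from has_vector_derivative_of_real[OF this] show ?thesis
        unfolding gaussian_def d_def eq by simp
    qed
  qed
  define h where "h t = fourier gaussian (t *\<^sub>R \<xi>) * of_real (exp (t\<^sup>2 * (norm \<xi>)\<^sup>2 / 2))" for t
  have "(h has_vector_derivative 0) (at t)" for t
  proof -
    have "((\<lambda>t. fourier gaussian (0 + t *\<^sub>R \<xi>)) has_vector_derivative
        fourier (\<lambda>x. - \<i> * of_real (x \<bullet> \<xi>) * gaussian x) (0 + t *\<^sub>R \<xi>)) (at t)"
      by (rule fourier_has_vector_derivative[OF integrable_gaussian integrable_norm_gaussian])
    moreover have "fourier (\<lambda>x. - \<i> * of_real (x \<bullet> \<xi>) * gaussian x) \<eta> = \<i> * fourier d \<eta>" for \<eta>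
      unfolding fourier_def d_def by (subst integral_mult_right_zero[symmetric]) (simp add: mult_ac)
    ultimately have 1: "((\<lambda>t. fourier gaussian (t *\<^sub>R \<xi>)) has_vector_derivative
        \<i> * (\<i> * of_real (\<xi> \<bullet> (t *\<^sub>R \<xi>)) * fourier gaussian (t *\<^sub>R \<xi>))) (at t)"
      by (simp add: d)
    have "((\<lambda>t. exp (t\<^sup>2 * (norm \<xi>)\<^sup>2 / 2)) has_real_derivative
        t * (norm \<xi>)\<^sup>2 * exp (t\<^sup>2 * (norm \<xi>)\<^sup>2 / 2)) (at t)"
      by (auto intro!: derivative_eq_intros)
    from has_vector_derivative_mult[OF 1 has_vector_derivative_of_real[OF this]]
    show ?thesis
      unfolding h_def by (simp add: power2_norm_eq_inner mult_ac)
  qed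
  then obtain c where "\<And>t. h t = c"
    using has_vector_derivative_zero_constant[of UNIV h] by (metis UNIV_I convex_UNIV)
  then have "h 1 = h 0" by simp
  then show ?thesis
    unfolding h_def by (simp add: exp_minus field_simps)
qed

text \<open>This number is (2 pi) to the power n/2; its square is the constant of Fourier
  inversion.\<close>

definition gauss_const :: "'n::finite itself \<Rightarrow> real" where
  "gauss_const _ = (\<integral>(x::real^'n). exp (- (norm x)\<^sup>2 / 2) \<partial>lborel)"

lemma fourier_gaussian_0: "fourier gaussian (0 :: real^'n::finite) = of_real (gauss_const TYPE('n))"
  unfolding fourier_def gauss_const_def gaussian_def by (simp add: integral_complex_of_real)

lemma gauss_const_pos: "0 < gauss_const TYPE('n::finite)"
proof -
  have int: "integrable lborel (\<lambda>x::real^'n. exp (- (norm x)\<^sup>2 / 2))"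
    using integrable_gaussian_power[of 0, where ?'n = 'n] by (simp add: gaussian_def)
  have "gauss_const TYPE('n) \<noteq> 0"
  proof
    assume "gauss_const TYPE('n) = 0"
    then have "AE x::real^'n in lborel. exp (- (norm x)\<^sup>2 / 2) = (0::real)"
      unfolding gauss_const_def using integral_nonneg_eq_0_iff_AE[OF int] by simp
    then have "AE x::real^'n in lborel. False" by simp
    then have "emeasure lborel (UNIV :: (real^'n) set) = 0"
      by (simp add: eventually_False ae_filter_eq_bot_iff)
    then show False by simp
  qed
  moreover have "0 \<le> gauss_const TYPE('n)" unfolding gauss_const_def by simp
  ultimately show ?thesis by simp
qed

text \<open>The weak form of Fourier inversion that is needed: averages of \<open>f\<close> against the Fourier transforms
  of wide Gaussians are bounded by the \<open>L\<^sup>1\<close> norm of \<open>fourier f\<close>, and they converge to \<open>f x\<close> up to the constant.\<close>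
lemma norm_le_integral_fourier:
  fixes f :: "real^'n::finite \<Rightarrow> complex"
  assumes f: "integrable lborel f" "continuous_on UNIV f" "\<And>x. norm (f x) \<le> B"
    and ff: "integrable lborel (fourier f)"
  shows "(gauss_const TYPE('n))\<^sup>2 * norm (f x) \<le> (\<integral>\<xi>. norm (fourier f \<xi>) \<partial>lborel)"
proof -
  let ?c = "gauss_const TYPE('n)"
  let ?G = "fourier gaussian :: real^'n \<Rightarrow> complex"
  have [measurable]: "f \<in> borel_measurable borel" "(gaussian :: real^'n \<Rightarrow> complex) \<in> borel_measurable borel"
    using continuous_borel[OF f(2)] continuous_borel[OF continuous_gaussian] by auto
  have G: "?G z = of_real ?c * gaussian z" for z
    by (subst fourier_gaussian) (simp add: fourier_gaussian_0 gaussian_def)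
  have iG: "integrable lborel ?G"
    unfolding G by (intro integrable_mult_right integrable_gaussian)
  have intG: "(\<integral>z. ?G z \<partial>lborel) = of_real (?c\<^sup>2)"
  proof -
    have "(\<integral>(z::real^'n). gaussian z \<partial>lborel) = ?G 0" unfolding fourier_def by simp
    then have "(\<integral>(z::real^'n). gaussian z \<partial>lborel) = of_real ?c" by (simp add: fourier_gaussian_0)
    then show ?thesis unfolding G by (simp add: power2_eq_square)
  qed
  have bound: "norm (\<integral>z. f (x + e *\<^sub>R z) * ?G z \<partial>lborel) \<le> (\<integral>\<xi>. norm (fourier f \<xi>) \<partial>lborel)"
    if e: "0 < e" for e
  proof -
    let ?E = "1 / e ^ DIM(real^'n)"
    have fe: "integrable lborel (\<lambda>z. f (x + e *\<^sub>R z))"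
      using e by (intro integral_lborel_affine f) auto
    define k where "k = (\<lambda>(z, \<xi>). f (x + e *\<^sub>R z) * (cis (- (\<xi> \<bullet> z)) * gaussian \<xi>))"
    have k: "integrable (lborel \<Otimes>\<^sub>M lborel) k"
    proof (rule lborel_pair.Fubini_integrable)
      show "k \<in> borel_measurable (lborel \<Otimes>\<^sub>M lborel)" unfolding k_def by measurable
      show "integrable lborel (\<lambda>z. \<integral>\<xi>. norm (k (z, \<xi>)) \<partial>lborel)"
        unfolding k_def using fe by (simp add: norm_mult)
      show "AE z in lborel. integrable lborel (\<lambda>\<xi>. k (z, \<xi>))"
        unfolding k_def split_conv
        by (intro AE_I2 integrable_mult_right integrable_cis_mult integrable_gaussian) measurable
    qed
    have "(\<integral>z. f (x + e *\<^sub>R z) * ?G z \<partial>lborel) = (\<integral>z. (\<integral>\<xi>. k (z, \<xi>) \<partial>lborel) \<partial>lborel)"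
      unfolding k_def fourier_def by simp
    also have "\<dots> = (\<integral>\<xi>. (\<integral>z. k (z, \<xi>) \<partial>lborel) \<partial>lborel)"
      using lborel_pair.Fubini_integral[of "\<lambda>z \<xi>. k (z, \<xi>)"] k by simp
    finally have eq: "(\<integral>z. f (x + e *\<^sub>R z) * ?G z \<partial>lborel) = (\<integral>\<xi>. (\<integral>z. k (z, \<xi>) \<partial>lborel) \<partial>lborel)" .
    \<comment> \<open>The substitution y = x + e z turns the integral into the Fourier transform of
      f at \<xi> / e, up to a unimodular factor, a Gaussian factor of modulus at most 1, and e to
      the power -D. Rescaling \<xi> in \<open>sc\<close> cancels that power, so the final bound does
      not depend on e.\<close>
    have inner: "norm (\<integral>z. k (z, \<xi>) \<partial>lborel) \<le> ?E * norm (fourier f ((1 / e) *\<^sub>R \<xi>))" for \<xi>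
    proof -
      define F where "F y = gaussian \<xi> * cis (x \<bullet> \<xi> / e) * (cis (- (y \<bullet> ((1 / e) *\<^sub>R \<xi>))) * f y)" for y
      have iF: "integrable lborel F"
        unfolding F_def by (intro integrable_mult_right integrable_cis_mult f) measurable
      have "k (z, \<xi>) = F (x + e *\<^sub>R z)" for z
      proof -
        have "cis (- (\<xi> \<bullet> z)) = cis (x \<bullet> \<xi> / e) * cis (- ((x + e *\<^sub>R z) \<bullet> ((1 / e) *\<^sub>R \<xi>)))"
          unfolding cis_mult using e by (simp add: inner_add_left inner_add_right inner_commute add_divide_distrib)
        then show ?thesis unfolding k_def F_def by (simp add: mult_ac)
      qed
      then have "(\<integral>z. k (z, \<xi>) \<partial>lborel) = ?E *\<^sub>R (\<integral>y. F y \<partial>lborel)"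
        using integral_lborel_affine(2)[OF iF, of e x] e by simp
      also have "(\<integral>y. F y \<partial>lborel) = gaussian \<xi> * cis (x \<bullet> \<xi> / e) * fourier f ((1 / e) *\<^sub>R \<xi>)"
        unfolding F_def fourier_def by simp
      finally have "norm (\<integral>z. k (z, \<xi>) \<partial>lborel) = ?E * (norm (gaussian \<xi>) * norm (fourier f ((1 / e) *\<^sub>R \<xi>)))"
        using e by (simp add: norm_mult norm_divide norm_power)
      also have "\<dots> \<le> ?E * (1 * norm (fourier f ((1 / e) *\<^sub>R \<xi>)))"
        using e by (intro mult_left_mono mult_right_mono) (auto simp: gaussian_def)
      finally show ?thesis by simp
    qed
    have sc: "integrable lborel (\<lambda>\<xi>. norm (fourier f (0 + (1 / e) *\<^sub>R \<xi>)))"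
      "(\<integral>\<xi>. norm (fourier f (0 + (1 / e) *\<^sub>R \<xi>)) \<partial>lborel) = e ^ DIM(real^'n) * (\<integral>\<xi>. norm (fourier f \<xi>) \<partial>lborel)"
      using integral_lborel_affine[OF integrable_norm[OF ff], of "1 / e" 0] e
      by (simp_all add: power_divide)
    have "norm (\<integral>z. f (x + e *\<^sub>R z) * ?G z \<partial>lborel) \<le> (\<integral>\<xi>. norm (\<integral>z. k (z, \<xi>) \<partial>lborel) \<partial>lborel)"
      unfolding eq by (rule integral_norm_bound)
    also have "\<dots> \<le> (\<integral>\<xi>. ?E * norm (fourier f (0 + (1 / e) *\<^sub>R \<xi>)) \<partial>lborel)"
    proof (rule integral_mono)
      show "integrable lborel (\<lambda>\<xi>. norm (\<integral>z. k (z, \<xi>) \<partial>lborel))"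
        using lborel_pair.integrable_snd[of "\<lambda>z \<xi>. k (z, \<xi>)"] k by (intro integrable_norm) simp
    qed (use sc inner in auto)
    also have "\<dots> = (\<integral>\<xi>. norm (fourier f \<xi>) \<partial>lborel)"
      using sc(2) e by simp
    finally show ?thesis .
  qed
  have "(\<lambda>n. \<integral>z. f (x + (1 / real (Suc n)) *\<^sub>R z) * ?G z \<partial>lborel) \<longlonglongrightarrow> (\<integral>z. f x * ?G z \<partial>lborel)"
  proof (rule integral_dominated_convergence)
    show "integrable lborel (\<lambda>z. B * norm (?G z))" using iG by simp
    show "AE z in lborel. (\<lambda>n. f (x + (1 / real (Suc n)) *\<^sub>R z) * ?G z) \<longlonglongrightarrow> f x * ?G z"
    proof (intro AE_I2 tendsto_mult tendsto_const)
      fix z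
      have "(\<lambda>n. x + (1 / real (Suc n)) *\<^sub>R z) \<longlonglongrightarrow> x + 0 *\<^sub>R z"
        by (intro tendsto_intros LIMSEQ_Suc[OF lim_1_over_n])
      then show "(\<lambda>n. f (x + (1 / real (Suc n)) *\<^sub>R z)) \<longlonglongrightarrow> f x"
        by (intro continuous_on_tendsto_compose[OF f(2)]) auto
    qed
    show "AE z in lborel. norm (f (x + (1 / real (Suc n)) *\<^sub>R z) * ?G z) \<le> B * norm (?G z)" for n
      using f(3) by (intro AE_I2) (simp add: norm_mult mult_right_mono)
  qed (simp_all add: G)
  from tendsto_norm[OF this]
  have "norm (\<integral>z. f x * ?G z \<partial>lborel) \<le> (\<integral>\<xi>. norm (fourier f \<xi>) \<partial>lborel)"
    by (rule tendsto_upperbound[OF _ always_eventually]) (auto simp del: of_nat_Suc intro!: bound)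
  then show ?thesis
    by (simp add: intG norm_mult norm_power mult.commute)
qed

section \<open>Intermediate derivatives on a half line\<close>

text \<open>The density of the exponential distribution. The half line is open so as to agree with
  \<open>einterval 0 \<infinity>\<close> in \<open>codiff_derivative\<close>.\<close>

definition exp_weight :: "real \<Rightarrow> real" where
  "exp_weight s = indicator {0<..} s * exp (- s)"

text \<open>An average over the points x + h s with s > 0. For h > 0 it looks only ahead, so bounds
  on the half line [0, \<infinity>) are preserved; a two-sided mean would not do this.\<close>

definition resolvent :: "real \<Rightarrow> (real \<Rightarrow> complex) \<Rightarrow> real \<Rightarrow> complex" where
  "resolvent h g x = (\<integral>s. exp_weight s *\<^sub>R g (x + h * s) \<partial>lborel)"

definition cont_bounded :: "(real \<Rightarrow> complex) \<Rightarrow> bool" where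
  "cont_bounded g \<longleftrightarrow> continuous_on UNIV g \<and> (\<exists>B. \<forall>x. norm (g x) \<le> B)"

lemma exp_weight_nonneg [simp]: "0 \<le> exp_weight s"
  by (simp add: exp_weight_def)

lemma integrable_exp_weight: "integrable lborel exp_weight"
  and integral_exp_weight: "integral\<^sup>L lborel exp_weight \<le> 1"
proof -
  have "(\<integral>\<^sup>+s. ennreal (exp_weight s) \<partial>lborel) \<le> (\<integral>\<^sup>+s. ennreal (exp (- s)) * indicator {0..} s \<partial>lborel)"
    by (rule nn_integral_mono) (simp add: exp_weight_def split: split_indicator)
  also have "\<dots> = ennreal (0 - (- exp (- 0)))"
  proof (rule nn_integral_FTC_atLeast)
    show "((\<lambda>s. - exp (- s)) \<longlongrightarrow> (0::real)) at_top"
      using tendsto_minus[OF filterlim_compose[OF exp_at_bot filterlim_uminus_at_bot_at_top]] by simp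
  qed (auto intro!: derivative_eq_intros)
  finally have *: "(\<integral>\<^sup>+s. ennreal (exp_weight s) \<partial>lborel) \<le> 1" by simp
  have m: "exp_weight \<in> borel_measurable lborel" unfolding exp_weight_def[abs_def] by simp
  show i: "integrable lborel exp_weight"
    using * by (intro integrableI_bounded m) (auto simp: order_le_less_trans)
  have "ennreal (integral\<^sup>L lborel exp_weight) \<le> 1"
    using nn_integral_eq_integral[OF i] * by simp
  then show "integral\<^sup>L lborel exp_weight \<le> 1" by simp
qed

lemma cont_bounded_measurable: "cont_bounded g \<Longrightarrow> g \<in> borel_measurable borel"
  unfolding cont_bounded_def by (auto intro: borel_measurable_continuous_onI)

lemma exp_weight_measurable [measurable]: "exp_weight \<in> borel_measurable borel"
  unfolding exp_weight_def[abs_def] by simp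

lemma integrable_resolvent:
  assumes "cont_bounded g"
  shows "integrable lborel (\<lambda>s. exp_weight s *\<^sub>R g (x + h * s))"
proof -
  have [measurable]: "g \<in> borel_measurable borel" using assms by (rule cont_bounded_measurable)
  obtain B where B: "\<And>x. norm (g x) \<le> B" using assms unfolding cont_bounded_def by blast
  show ?thesis
  proof (rule Bochner_Integration.integrable_bound)
    show "integrable lborel (\<lambda>s. B * exp_weight s)" by (intro integrable_mult_right integrable_exp_weight)
    show "AE s in lborel. norm (exp_weight s *\<^sub>R g (x + h * s)) \<le> norm (B * exp_weight s)"
    proof (rule AE_I2)
      fix s
      have "exp_weight s * norm (g (x + h * s)) \<le> exp_weight s * B"
        by (intro mult_left_mono B) simp
      also have "\<dots> \<le> \<bar>B * exp_weight s\<bar>" by (simp add: mult.commute)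
      finally show "norm (exp_weight s *\<^sub>R g (x + h * s)) \<le> norm (B * exp_weight s)" by simp
    qed
  qed measurable
qed

lemma norm_resolvent_le:
  assumes g: "cont_bounded g" and M: "\<And>s. 0 < s \<Longrightarrow> norm (g (x + h * s)) \<le> M"
  shows "norm (resolvent h g x) \<le> M"
proof -
  have M0: "0 \<le> M" using M[of 1] norm_ge_zero[of "g (x + h * 1)"] by (simp del: norm_ge_zero)
  have "norm (resolvent h g x) \<le> (\<integral>s. norm (exp_weight s *\<^sub>R g (x + h * s)) \<partial>lborel)"
    unfolding resolvent_def by (rule integral_norm_bound)
  also have "\<dots> \<le> (\<integral>s. M * exp_weight s \<partial>lborel)"
  proof (rule integral_mono)
    show "integrable lborel (\<lambda>s. norm (exp_weight s *\<^sub>R g (x + h * s)))"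
      by (intro integrable_norm integrable_resolvent g)
    show "norm (exp_weight s *\<^sub>R g (x + h * s)) \<le> M * exp_weight s" for s
      using M[of s] by (auto simp: exp_weight_def mult.commute split: split_indicator)
  qed (intro integrable_mult_right integrable_exp_weight)
  also have "\<dots> \<le> M" using integral_exp_weight M0 by (simp add: mult_left_le)
  finally show ?thesis .
qed

lemma cont_bounded_resolvent:
  assumes g: "cont_bounded g"
  shows "cont_bounded (resolvent h g)"
proof -
  have [measurable]: "g \<in> borel_measurable borel" using g by (rule cont_bounded_measurable)
  obtain B where B: "\<And>x. norm (g x) \<le> B" using g unfolding cont_bounded_def by blast
  have cg: "continuous_on UNIV g" using g unfolding cont_bounded_def by blast
  have "(\<lambda>n. resolvent h g (X n)) \<longlonglongrightarrow> resolvent h g x" if X: "X \<longlonglongrightarrow> x" for X x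
    unfolding resolvent_def
  proof (rule integral_dominated_convergence)
    show "integrable lborel (\<lambda>s. B * exp_weight s)" by (intro integrable_mult_right integrable_exp_weight)
    show "AE s in lborel. (\<lambda>n. exp_weight s *\<^sub>R g (X n + h * s)) \<longlonglongrightarrow> exp_weight s *\<^sub>R g (x + h * s)"
      by (intro AE_I2 tendsto_scaleR tendsto_const continuous_on_tendsto_compose[OF cg] tendsto_add X) auto
    show "AE s in lborel. norm (exp_weight s *\<^sub>R g (X n + h * s)) \<le> B * exp_weight s" for n
      using B by (intro AE_I2) (simp add: mult.commute[of B] mult_left_mono)
  qed measurable
  then have "continuous_on UNIV (resolvent h g)"
    unfolding continuous_on_eq_continuous_at[OF open_UNIV] continuous_at_sequentially by (auto simp: o_def)
  moreover have "norm (resolvent h g x) \<le> B" for x by (intro norm_resolvent_le g B)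
  ultimately show ?thesis unfolding cont_bounded_def by blast
qed

lemma cont_bounded_diff: "cont_bounded f \<Longrightarrow> cont_bounded g \<Longrightarrow> cont_bounded (\<lambda>x. f x - g x)"
  unfolding cont_bounded_def
proof (elim conjE exE, intro conjI exI allI)
  fix A B x assume "\<forall>x. norm (f x) \<le> A" "\<forall>x. norm (g x) \<le> B"
  then show "norm (f x - g x) \<le> A + B"
    by (meson add_mono norm_triangle_ineq4 order_trans)
qed (intro continuous_intros)

lemma cont_bounded_cmult:
  assumes "cont_bounded g"
  shows "cont_bounded (\<lambda>x. c * g x)"
proof -
  obtain B where "\<And>x. norm (g x) \<le> B" using assms unfolding cont_bounded_def by blast
  then have "norm (c * g x) \<le> norm c * B" for x by (simp add: norm_mult mult_left_mono)
  with assms show ?thesis unfolding cont_bounded_def by (auto intro!: continuous_intros)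
qed

lemma resolvent_diff:
  "cont_bounded f \<Longrightarrow> cont_bounded g \<Longrightarrow>
    resolvent h (\<lambda>x. f x - g x) = (\<lambda>x. resolvent h f x - resolvent h g x)"
  unfolding resolvent_def by (rule ext) (simp add: scaleR_diff_right integrable_resolvent)

lemma resolvent_cmult: "resolvent h (\<lambda>x. c * g x) = (\<lambda>x. c * resolvent h g x)"
  unfolding resolvent_def by (simp flip: integral_mult_right_zero add: mult_scaleR_right)

text \<open>A bounded substitute for differentiation: it is defined for every bounded continuous
  function, at most doubles a bound on the half line if h > 0, and contains one derivative by
  \<open>codiff_derivative\<close>.\<close>

definition codiff :: "real \<Rightarrow> (real \<Rightarrow> complex) \<Rightarrow> real \<Rightarrow> complex" where
  "codiff h g = (\<lambda>x. g x - resolvent h g x)"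

lemma cont_bounded_codiff: "cont_bounded g \<Longrightarrow> cont_bounded (codiff h g)"
  unfolding codiff_def by (intro cont_bounded_diff cont_bounded_resolvent)

lemma codiff_cmult: "codiff h (\<lambda>x. c * g x) = (\<lambda>x. c * codiff h g x)"
  unfolding codiff_def resolvent_cmult by (simp add: right_diff_distrib)

lemma resolvent_codiff:
  "cont_bounded g \<Longrightarrow> resolvent h (codiff h g) = codiff h (resolvent h g)"
  unfolding codiff_def by (simp add: resolvent_diff cont_bounded_resolvent)

text \<open>Integration by parts: \<open>h R g' = R g - g\<close> for \<open>R = (1 - h d/dx)\<^sup>-\<^sup>1\<close>.\<close>
lemma codiff_derivative:
  assumes g: "cont_bounded g" and g': "cont_bounded g'"
    and deriv: "\<And>x. (g has_vector_derivative g' x) (at x)"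
  shows "codiff h g = (\<lambda>x. - of_real h * resolvent h g' x)"
proof
  fix x
  define G where "G s = exp (- s) *\<^sub>R g (x + h * s)" for s
  define G' where "G' s = exp (- s) *\<^sub>R (h *\<^sub>R g' (x + h * s)) - exp (- s) *\<^sub>R g (x + h * s)" for s
  have dG: "(G has_vector_derivative G' s) (at s)" for s
  proof -
    have "(g \<circ> (\<lambda>s. x + h * s) has_vector_derivative h *\<^sub>R g' (x + h * s)) (at s)"
      by (rule vector_diff_chain_at[OF _ deriv]) (auto intro!: derivative_eq_intros)
    moreover have "((\<lambda>s. exp (- s)) has_real_derivative - exp (- s)) (at s)"
      by (auto intro!: derivative_eq_intros)
    ultimately have "((\<lambda>s. exp (- s) *\<^sub>R g (x + h * s)) has_vector_derivative
        exp (- s) *\<^sub>R (h *\<^sub>R g' (x + h * s)) + (- exp (- s)) *\<^sub>R g (x + h * s)) (at s)"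
      unfolding o_def by (rule has_vector_derivative_scaleR[rotated])
    then show ?thesis
      unfolding G_def[abs_def] G'_def by simp
  qed
  have cont: "continuous_on UNIV g" "continuous_on UNIV g'"
    using g g' unfolding cont_bounded_def by auto
  have cG': "continuous_on UNIV G'"
    unfolding G'_def by (intro continuous_intros continuous_on_compose2[OF cont(1)] continuous_on_compose2[OF cont(2)]) auto
  have ind: "indicator {0<..} s *\<^sub>R G' s = h *\<^sub>R (exp_weight s *\<^sub>R g' (x + h * s)) - exp_weight s *\<^sub>R g (x + h * s)" for s
    unfolding G'_def exp_weight_def by (simp add: scaleR_diff_right mult.commute split: split_indicator)
  have "(LBINT s=0..\<infinity>. G' s) = 0 - g x"
  proof (rule interval_integral_FTC_integrable)
    show "(G has_vector_derivative G' s) (at s)" for s by (rule dG)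
    show "isCont G' s" for s using cG' by (simp add: continuous_on_eq_continuous_at)
    have "einterval 0 \<infinity> = {0<..}" by (auto simp: einterval_def zero_ereal_def)
    then show "set_integrable lborel (einterval 0 \<infinity>) G'"
      unfolding set_integrable_def
      by (simp only: ind) (intro Bochner_Integration.integrable_diff integrable_scaleR_right integrable_resolvent g g')
    have "(G \<longlongrightarrow> g x) (at 0)"
      using has_vector_derivative_continuous[OF dG, of 0] unfolding continuous_at G_def by simp
    then show "((G \<circ> real_of_ereal) \<longlongrightarrow> g x) (at_right 0)"
      unfolding zero_ereal_def
      by (subst ereal_tendsto_simps) (rule tendsto_within_subset, auto)
    obtain B where B: "\<And>x. norm (g x) \<le> B" using g unfolding cont_bounded_def by blast
    have "((\<lambda>s. exp (- s) * B) \<longlongrightarrow> 0 * B) at_top"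
      by (intro tendsto_mult tendsto_const filterlim_compose[OF exp_at_bot filterlim_uminus_at_bot_at_top])
    then have "(G \<longlongrightarrow> 0) at_top"
      by (intro Lim_null_comparison[of G "\<lambda>s. exp (- s) * B"]) (auto simp: G_def B intro!: mult_left_mono)
    then show "((G \<circ> real_of_ereal) \<longlongrightarrow> 0) (at_left \<infinity>)"
      by (simp add: ereal_tendsto_simps)
  qed simp
  also have "(LBINT s=0..\<infinity>. G' s) = (\<integral>s. indicator {0<..} s *\<^sub>R G' s \<partial>lborel)"
    unfolding interval_lebesgue_integral_0_infty set_lebesgue_integral_def ..
  also have "\<dots> = h *\<^sub>R resolvent h g' x - resolvent h g x"
    unfolding ind resolvent_def
    by (subst Bochner_Integration.integral_diff, intro integrable_scaleR_right integrable_resolvent g',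
        intro integrable_resolvent g, subst integral_scaleR_right, rule refl)
  finally show "codiff h g x = - of_real h * resolvent h g' x"
    by (simp add: codiff_def scaleR_conv_of_real algebra_simps)
qed

section \<open>Powers of the resolvent and of its complement\<close>

lemma funpow_closed: "(\<And>x. P x \<Longrightarrow> P (f x)) \<Longrightarrow> P x \<Longrightarrow> P ((f ^^ n) x)"
  by (induction n) auto

lemma resolvent_funpow_cmult: "(resolvent h ^^ n) (\<lambda>x. c * g x) = (\<lambda>x. c * (resolvent h ^^ n) g x)"
  by (induction n) (auto simp: resolvent_cmult)

lemma resolvent_funpow_codiff:
  "cont_bounded g \<Longrightarrow> (resolvent h ^^ n) (codiff h g) = codiff h ((resolvent h ^^ n) g)"
  by (induction n) (auto simp: resolvent_codiff funpow_closed[where P = cont_bounded] cont_bounded_resolvent)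

lemma resolvent_funpow_codiff_funpow:
  "cont_bounded g \<Longrightarrow> (resolvent h ^^ n) ((codiff h ^^ j) g) = (codiff h ^^ j) ((resolvent h ^^ n) g)"
  by (induction j) (auto simp: resolvent_funpow_codiff funpow_closed[where P = cont_bounded] cont_bounded_codiff)

text \<open>Each application of \<open>codiff_derivative\<close> trades one \<open>codiff\<close>
  for one \<open>resolvent\<close>, one derivative and a factor -h; the operators commute, so the
  resolvents can be collected in front.\<close>

lemma codiff_funpow_derivative:
  assumes F: "\<And>j. j \<le> n \<Longrightarrow> cont_bounded (F j)"
    and deriv: "\<And>j x. j < n \<Longrightarrow> (F j has_vector_derivative F (Suc j) x) (at x)"
    and "j + a \<le> n"
  shows "(codiff h ^^ a) (F j) = (\<lambda>x. (- of_real h) ^ a * (resolvent h ^^ a) (F (j + a)) x)"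
  using assms(3)
proof (induction a)
  case (Suc a)
  have "(codiff h ^^ Suc a) (F j) = codiff h (\<lambda>x. (- of_real h) ^ a * (resolvent h ^^ a) (F (j + a)) x)"
    using Suc by simp
  also have "\<dots> = (\<lambda>x. (- of_real h) ^ a * (resolvent h ^^ a) (codiff h (F (j + a))) x)"
    using Suc.prems by (simp add: codiff_cmult resolvent_funpow_codiff F)
  also have "codiff h (F (j + a)) = (\<lambda>x. - of_real h * resolvent h (F (Suc (j + a))) x)"
    using Suc.prems by (intro codiff_derivative F deriv) auto
  also have "(resolvent h ^^ a) \<dots> = (\<lambda>x. - of_real h * (resolvent h ^^ a) (resolvent h (F (Suc (j + a)))) x)"
    by (rule resolvent_funpow_cmult)
  also have "(resolvent h ^^ a) (resolvent h (F (Suc (j + a)))) = (resolvent h ^^ Suc a) (F (j + Suc a))"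
    by (simp add: funpow_swap1)
  finally show ?case by (simp add: mult_ac)
qed simp

text \<open>Global boundedness, with an unspecified constant, keeps the averages defined on the
  whole line; only the half-line bound \<open>M\<close> is quantitative.\<close>

definition half_bound :: "real \<Rightarrow> (real \<Rightarrow> complex) \<Rightarrow> bool" where
  "half_bound M g \<longleftrightarrow> cont_bounded g \<and> (\<forall>x\<ge>0. norm (g x) \<le> M)"

lemma half_bound_mono: "half_bound M g \<Longrightarrow> M \<le> N \<Longrightarrow> half_bound N g"
  unfolding half_bound_def by fastforce

lemma half_bound_resolvent:
  assumes "0 < h" "half_bound M g"
  shows "half_bound M (resolvent h g)"
  using assms unfolding half_bound_def by (auto intro!: cont_bounded_resolvent norm_resolvent_le)

lemma half_bound_codiff:
  assumes "0 < h" "half_bound M g"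
  shows "half_bound (2 * M) (codiff h g)"
proof -
  have "half_bound M (resolvent h g)" using assms by (rule half_bound_resolvent)
  with assms have "norm (g x - resolvent h g x) \<le> M + M" if "0 \<le> x" for x
    using norm_triangle_ineq4[of "g x" "resolvent h g x"] that unfolding half_bound_def
    by (meson add_mono order_trans)
  with assms show ?thesis
    unfolding half_bound_def using cont_bounded_codiff[of g h] by (auto simp: codiff_def)
qed

lemma half_bound_resolvent_funpow:
  "0 < h \<Longrightarrow> half_bound M g \<Longrightarrow> half_bound M ((resolvent h ^^ n) g)"
  by (induction n) (auto intro: half_bound_resolvent)

lemma half_bound_codiff_funpow:
  "0 < h \<Longrightarrow> half_bound M g \<Longrightarrow> half_bound (2 ^ n * M) ((codiff h ^^ n) g)"
proof (induction n)
  case (Suc n)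
  from half_bound_codiff[OF Suc.prems(1) Suc.IH[OF Suc.prems]] show ?case by (simp add: mult.assoc)
qed simp

lemma half_bound_cmult: "half_bound M g \<Longrightarrow> half_bound (norm c * M) (\<lambda>x. c * g x)"
  unfolding half_bound_def by (auto simp: cont_bounded_cmult norm_mult mult_left_mono)

text \<open>Write \<open>R\<close> for the resolvent and \<open>D = 1 - R\<close>. Since \<open>1 = R + D\<close>, the function \<open>F k\<close> is a sum of
  \<open>2\<^sup>2\<^sup>k\<close> terms of the form \<open>R\<^sup>i D\<^sup>j (F k)\<close>, where \<open>i \<ge> k\<close> or \<open>j \<ge> k\<close>; in the first case
  \<open>k\<close> derivatives are removed by \<open>R\<close>, in the second \<open>k\<close> derivatives are gained from \<open>D\<close>.\<close>
lemma intermediate_derivative_scaled: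
  assumes h: "0 < h"
    and F: "\<And>j. j \<le> 2 * k \<Longrightarrow> cont_bounded (F j)"
    and deriv: "\<And>j x. j < 2 * k \<Longrightarrow> (F j has_vector_derivative F (Suc j) x) (at x)"
    and M0: "\<And>x. 0 \<le> x \<Longrightarrow> norm (F 0 x) \<le> M0" and M2: "\<And>x. 0 \<le> x \<Longrightarrow> norm (F (2 * k) x) \<le> M2"
  shows "norm (F k 0) \<le> 16 ^ k * (M0 / h ^ k + h ^ k * M2)"
proof -
  let ?R = "resolvent h" and ?D = "codiff h"
  define B where "B = 4 ^ k * (M0 / h ^ k + h ^ k * M2)"
  have nn: "0 \<le> M0" "0 \<le> M2"
    using M0[of 0] M2[of 0] by (auto intro: order_trans[OF norm_ge_zero])
  have B1: "4 ^ k * (M0 / h ^ k + h ^ k * M2) \<le> 2 ^ n * B" for n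
  proof -
    have "0 \<le> B" unfolding B_def using nn h by (intro mult_nonneg_nonneg add_nonneg_nonneg) auto
    then have "1 * B \<le> 2 ^ n * B" by (intro mult_right_mono) auto
    then show ?thesis unfolding B_def by simp
  qed
  have nn': "0 \<le> M0 / h ^ k" "0 \<le> h ^ k * M2" using nn h by auto
  have Fk: "cont_bounded (F k)" using F[of k] by simp
  have hk: "(- of_real h :: complex) ^ k \<noteq> 0" using h by simp
  have nh: "norm ((- of_real h :: complex) ^ k) = h ^ k" using h by (simp add: norm_power)
  have "half_bound M0 (F 0)" using M0 F[of 0] unfolding half_bound_def by auto
  then have D0: "half_bound (2 ^ k * M0) ((?D ^^ k) (F 0))" by (rule half_bound_codiff_funpow[OF h])
  have "(?D ^^ k) (F 0) = (\<lambda>x. (- of_real h) ^ k * (?R ^^ k) (F k) x)"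
    using codiff_funpow_derivative[of "2 * k" F 0 k h] F deriv by simp
  then have Rk: "(?R ^^ k) (F k) = (\<lambda>x. inverse ((- of_real h) ^ k) * (?D ^^ k) (F 0) x)"
    using hk by auto
  have R: "half_bound (2 ^ k * (M0 / h ^ k)) ((?R ^^ k) (F k))"
    using half_bound_cmult[OF D0, of "inverse ((- of_real h) ^ k)"] unfolding Rk norm_inverse nh
    by (simp add: field_simps)
  have Dk: "(?D ^^ k) (F k) = (\<lambda>x. (- of_real h) ^ k * (?R ^^ k) (F (2 * k)) x)"
    using codiff_funpow_derivative[of "2 * k" F k k h] F deriv by (simp add: mult_2)
  have "half_bound M2 (F (2 * k))" using M2 F[of "2 * k"] unfolding half_bound_def by auto
  from half_bound_cmult[OF half_bound_resolvent_funpow[OF h this, of k], of "(- of_real h) ^ k"]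
  have D: "half_bound (h ^ k * M2) ((?D ^^ k) (F k))" unfolding Dk nh .
  \<comment> \<open>Here \<open>n\<close> counts the factors R and D missing from the corner i = j =
    k. The edges i = k and j = k are estimated directly; inside the square, g = R g + D g doubles
    the bound. Starting from i = j = 0 this gives 2 ^ (2 * k) * B, and together with the 4 ^ k in
    \<open>B\<close> the factor 16 ^ k.\<close>
  have main: "half_bound (2 ^ n * B) ((?R ^^ i) ((?D ^^ j) (F k)))"
    if "i \<le> k" "j \<le> k" "n = (k - i) + (k - j)" for i j n
    using that
  proof (induction n arbitrary: i j rule: less_induct)
    case (less n)
    show ?case
    proof (cases "i = k \<or> j = k")
      case True
      then show ?thesis
      proof
        assume i: "i = k"
        have "(2::real) ^ j * 2 ^ k \<le> 2 ^ k * 2 ^ k"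
          using less.prems by (intro mult_right_mono power_increasing) auto
        also have "\<dots> = 4 ^ k" by (simp flip: power_mult_distrib)
        finally have "(2 ^ j * 2 ^ k) * (M0 / h ^ k) \<le> 4 ^ k * (M0 / h ^ k + h ^ k * M2)"
          using nn' by (intro mult_mono) auto
        also have "\<dots> \<le> 2 ^ n * B" by (rule B1)
        finally have le: "2 ^ j * (2 ^ k * (M0 / h ^ k)) \<le> 2 ^ n * B" by (simp only: mult.assoc)
        have "half_bound (2 ^ j * (2 ^ k * (M0 / h ^ k))) ((?D ^^ j) ((?R ^^ k) (F k)))"
          by (rule half_bound_codiff_funpow[OF h R])
        from half_bound_mono[OF this le] show ?thesis
          unfolding i resolvent_funpow_codiff_funpow[OF Fk] .
      next
        assume j: "j = k"
        have "1 * (h ^ k * M2) \<le> 4 ^ k * (M0 / h ^ k + h ^ k * M2)"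
          using nn' by (intro mult_mono) auto
        also have "\<dots> \<le> 2 ^ n * B" by (rule B1)
        finally show ?thesis
          unfolding j using half_bound_mono[OF half_bound_resolvent_funpow[OF h D, of i]] by simp
      qed
    next
      case False
      with less.prems have ij: "i < k" "j < k" by auto
      define g where "g = (?R ^^ i) ((?D ^^ j) (F k))"
      have cg: "cont_bounded ((?D ^^ j) (F k))"
        by (intro funpow_closed[where P = cont_bounded] cont_bounded_codiff Fk)
      have n: "n - 1 < n" "n - 1 = (k - Suc i) + (k - j)" "n - 1 = (k - i) + (k - Suc j)"
        using ij less.prems by auto
      have 1: "half_bound (2 ^ (n - 1) * B) (?R g)"
        using less.IH[OF n(1) _ _ n(2)] ij by (simp add: g_def)
      have 2: "half_bound (2 ^ (n - 1) * B) (?D g)"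
        using less.IH[OF n(1) _ _ n(3)] ij resolvent_funpow_codiff[OF cg] by (simp add: g_def)
      have "norm (g x) \<le> 2 ^ n * B" if "0 \<le> x" for x
      proof -
        have "norm (g x) \<le> norm (?R g x) + norm (?D g x)"
          using norm_triangle_ineq[of "?R g x" "?D g x"] by (simp add: codiff_def)
        also have "\<dots> \<le> 2 ^ (n - 1) * B + 2 ^ (n - 1) * B"
          using 1 2 that unfolding half_bound_def by (intro add_mono) auto
        also have "\<dots> = 2 ^ n * B" using n(1) by (cases n) auto
        finally show ?thesis .
      qed
      moreover have "cont_bounded g"
        unfolding g_def by (intro funpow_closed[where P = cont_bounded] cont_bounded_resolvent cg)
      ultimately show ?thesis unfolding g_def half_bound_def by simp
    qed
  qed
  have "half_bound (2 ^ (k + k) * B) (F k)" using main[of 0 0 "k + k"] by simp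
  then have "norm (F k 0) \<le> 2 ^ (k + k) * B" unfolding half_bound_def by simp
  also have "2 ^ (k + k) * B = 16 ^ k * (M0 / h ^ k + h ^ k * M2)"
    unfolding B_def power_add by (simp flip: power_mult_distrib mult.assoc)
  finally show ?thesis .
qed

text \<open>The scale h with h ^ k = sqrt (M0 / M2) makes both terms of
  \<open>intermediate_derivative_scaled\<close> equal to sqrt (M0 * M2). For k = 0 there is no such
  choice, but then F 0 is bounded by both M0 and M2.\<close>

lemma intermediate_derivative:
  assumes F: "\<And>j. j \<le> 2 * k \<Longrightarrow> cont_bounded (F j)"
    and deriv: "\<And>j x. j < 2 * k \<Longrightarrow> (F j has_vector_derivative F (Suc j) x) (at x)"
    and M0: "0 < M0" "\<And>x. 0 \<le> x \<Longrightarrow> norm (F 0 x) \<le> M0"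
    and M2: "0 < M2" "\<And>x. 0 \<le> x \<Longrightarrow> norm (F (2 * k) x) \<le> M2"
  shows "norm (F k 0) \<le> 2 * 16 ^ k * sqrt (M0 * M2)"
proof (cases "k = 0")
  case True
  then have "(norm (F 0 0))\<^sup>2 \<le> M0 * M2"
    unfolding power2_eq_square using M0 M2 by (intro mult_mono) (auto simp: less_imp_le)
  then have "norm (F 0 0) \<le> sqrt (M0 * M2)" by (rule real_le_rsqrt)
  also have "\<dots> \<le> 2 * sqrt (M0 * M2)" using M0 M2 by simp
  finally show ?thesis using True by simp
next
  case False
  define h where "h = root k (sqrt (M0 / M2))"
  have h: "0 < h" "h ^ k = sqrt (M0 / M2)"
    unfolding h_def using M0 M2 False by (auto simp: real_root_gt_zero)
  have s: "sqrt M0 * sqrt M0 = M0" "sqrt M2 * sqrt M2 = M2" "sqrt M0 > 0" "sqrt M2 > 0"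
    using M0 M2 by auto
  have "M0 / h ^ k = sqrt (M0 * M2)" "h ^ k * M2 = sqrt (M0 * M2)"
    unfolding h(2) real_sqrt_divide real_sqrt_mult using s by (simp_all add: field_simps)
  with intermediate_derivative_scaled[OF h(1) F deriv M0(2) M2(2)] show ?thesis by simp
qed

section \<open>Topologies defined by seminorms\<close>

lemma csubspaceD:
  assumes "csubspace V"
  shows "0 \<in> V" "f \<in> V \<Longrightarrow> g \<in> V \<Longrightarrow> f + g \<in> V" "f \<in> V \<Longrightarrow> (\<lambda>x. c * f x) \<in> V"
    "f \<in> V \<Longrightarrow> g \<in> V \<Longrightarrow> f - g \<in> V"
proof -
  show *: "0 \<in> V" "\<And>f g. f \<in> V \<Longrightarrow> g \<in> V \<Longrightarrow> f + g \<in> V" "\<And>c f. f \<in> V \<Longrightarrow> (\<lambda>x. c * f x) \<in> V"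
    using assms unfolding csubspace_def by blast+
  assume "f \<in> V" "g \<in> V"
  then have "f + (\<lambda>x. (-1) * g x) \<in> V" using * by blast
  also have "f + (\<lambda>x. (-1) * g x) = f - g" by (simp add: fun_eq_iff)
  finally show "f - g \<in> V" .
qed

text \<open>Infinite values are allowed. Homogeneity as an inequality suffices: on a subspace,
  applying it to c and to 1/c gives equality, and c = 0 forces p 0 = 0 because 0 times infinity is 0
  in \<open>ennreal\<close>.\<close>

definition seminorm_on :: "('a \<Rightarrow> complex) set \<Rightarrow> (('a \<Rightarrow> complex) \<Rightarrow> ennreal) \<Rightarrow> bool" where
  "seminorm_on V p \<longleftrightarrow> (\<forall>f\<in>V. \<forall>g\<in>V. p (f + g) \<le> p f + p g) \<and>
     (\<forall>c. \<forall>f\<in>V. p (\<lambda>x. c * f x) \<le> ennreal (cmod c) * p f)"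

lemma seminorm_onD:
  assumes "seminorm_on V p"
  shows "f \<in> V \<Longrightarrow> g \<in> V \<Longrightarrow> p (f + g) \<le> p f + p g"
    "f \<in> V \<Longrightarrow> p (\<lambda>x. c * f x) \<le> ennreal (cmod c) * p f"
  using assms unfolding seminorm_on_def by blast+

lemma seminorm_on_zero:
  assumes "seminorm_on V p" "0 \<in> V"
  shows "p 0 = 0"
proof -
  have "p (\<lambda>x. 0 * (0 :: 'a \<Rightarrow> complex) x) \<le> ennreal (cmod 0) * p 0"
    by (rule seminorm_onD(2)[OF assms])
  then show ?thesis by (simp add: zero_fun_def)
qed

lemma seminorm_on_triangle:
  assumes "seminorm_on V p" "csubspace V" "f \<in> V" "g \<in> V" "h \<in> V"
  shows "p (h - f) \<le> p (h - g) + p (g - f)"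
proof -
  have "p ((h - g) + (g - f)) \<le> p (h - g) + p (g - f)"
    using assms by (intro seminorm_onD(1)[OF assms(1)] csubspaceD(4)) auto
  then show ?thesis by simp
qed

lemma ennreal_less_realE:
  assumes "x < ennreal e"
  obtains r where "x = ennreal r" "0 \<le> r" "r < e"
  using assms by (cases x) (auto simp: ennreal_less_iff)

lemma openin_seminorm_ball:
  assumes V: "csubspace V" and p: "p \<in> P" "seminorm_on V p" and f: "f \<in> V"
  shows "openin (seminorm_topology V P) {g \<in> V. p (g - f) < ennreal e}"
  unfolding openin_seminorm_topology
proof (intro conjI ballI)
  fix g assume "g \<in> {g \<in> V. p (g - f) < ennreal e}"
  then have g: "g \<in> V" "p (g - f) < ennreal e" by auto
  from g(2) obtain r where r: "p (g - f) = ennreal r" "0 \<le> r" "r < e" by (rule ennreal_less_realE)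
  have "p (h - f) < ennreal e" if h: "h \<in> V" "p (h - g) < ennreal (e - r)" for h
  proof -
    from h(2) obtain s where s: "p (h - g) = ennreal s" "0 \<le> s" "s < e - r" by (rule ennreal_less_realE)
    have "p (h - f) \<le> ennreal s + ennreal r"
      using seminorm_on_triangle[OF p(2) V f g(1) h(1)] r s by simp
    also have "\<dots> = ennreal (s + r)" using r s by simp
    also have "\<dots> < ennreal e" using r s by (intro ennreal_lessI) auto
    finally show ?thesis .
  qed
  then show "\<exists>Q d. finite Q \<and> Q \<subseteq> P \<and> 0 < d \<and>
      {h \<in> V. \<forall>p\<in>Q. p (h - g) < ennreal d} \<subseteq> {g \<in> V. p (g - f) < ennreal e}"
    using r p(1) by (intro exI[of _ "{p}"] exI[of _ "e - r"]) auto
qed auto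

lemma seminorm_ball_centre:
  assumes "csubspace V" "seminorm_on V p" "f \<in> V" "0 < e"
  shows "f \<in> {g \<in> V. p (g - f) < ennreal e}"
proof -
  have "f - f = 0" by (rule diff_self)
  then show ?thesis using assms seminorm_on_zero[OF assms(2) csubspaceD(1)[OF assms(1)]] by (simp only: mem_Collect_eq) simp
qed

lemma zero_nhd_seminorm_ball:
  assumes V: "csubspace V" and p: "p \<in> P" "seminorm_on V p" and e: "0 < e"
  shows "zero_nhd (seminorm_topology V P) {g \<in> V. p g < ennreal e}"
proof -
  have "openin (seminorm_topology V P) {g \<in> V. p (g - 0) < ennreal e}"
    by (intro openin_seminorm_ball assms csubspaceD(1))
  then have "openin (seminorm_topology V P) {g \<in> V. p g < ennreal e}" by simp
  then show ?thesis
    unfolding zero_nhd_def using seminorm_on_zero[OF p(2)] csubspaceD(1)[OF V] e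
    by (intro conjI exI[of _ "{g \<in> V. p g < ennreal e}"]) auto
qed

text \<open>Intersects the neighbourhoods of finitely many seminorms while staying uniform in
  \<open>H\<close>; a singleton \<open>H\<close> gives continuity, a general one
  equicontinuity.\<close>

lemma seminorm_nhds_finite:
  assumes "finite Q"
    and nhds: "\<And>p. p \<in> Q \<Longrightarrow> \<exists>U. openin X U \<and> x \<in> U \<and> (\<forall>h\<in>H. \<forall>y\<in>U. R p h y)"
    and x: "x \<in> topspace X"
  shows "\<exists>U. openin X U \<and> x \<in> U \<and> (\<forall>h\<in>H. \<forall>y\<in>U. \<forall>p\<in>Q. R p h y)"
  using assms(1,2)
proof (induction Q)
  case empty
  show ?case using x by (intro exI[of _ "topspace X"]) auto
next
  case (insert p Q)
  obtain U where "openin X U" "x \<in> U" "\<forall>h\<in>H. \<forall>y\<in>U. R p h y" using insert.prems by blast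
  moreover obtain U' where "openin X U'" "x \<in> U'" "\<forall>h\<in>H. \<forall>y\<in>U'. \<forall>p\<in>Q. R p h y"
    using insert by blast
  ultimately show ?case by (intro exI[of _ "U \<inter> U'"]) auto
qed

lemma continuous_map_seminorm_topology:
  assumes V: "\<And>x. x \<in> topspace X \<Longrightarrow> h x \<in> V"
    and nhds: "\<And>x p e. x \<in> topspace X \<Longrightarrow> p \<in> P \<Longrightarrow> 0 < e \<Longrightarrow>
      \<exists>U. openin X U \<and> x \<in> U \<and> (\<forall>y\<in>U. p (h y - h x) < ennreal e)"
  shows "continuous_map X (seminorm_topology V P) h"
  unfolding continuous_map_def
proof (intro conjI allI impI)
  show "h \<in> topspace X \<rightarrow> topspace (seminorm_topology V P)" using V by simp
  fix W assume W: "openin (seminorm_topology V P) W"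
  show "openin X {x \<in> topspace X. h x \<in> W}"
    unfolding openin_subopen[of X "{x \<in> topspace X. h x \<in> W}"]
  proof
    fix x assume "x \<in> {x \<in> topspace X. h x \<in> W}"
    then have x: "x \<in> topspace X" "h x \<in> W" by auto
    then obtain Q e where Q: "finite Q" "Q \<subseteq> P" "0 < e" "{g \<in> V. \<forall>p\<in>Q. p (g - h x) < ennreal e} \<subseteq> W"
      using W unfolding openin_seminorm_topology by blast
    have "\<exists>U. openin X U \<and> x \<in> U \<and> (\<forall>k\<in>{h}. \<forall>y\<in>U. \<forall>p\<in>Q. p (k y - k x) < ennreal e)"
      by (rule seminorm_nhds_finite[OF Q(1) _ x(1)]) (use nhds[OF x(1) _ Q(3)] Q(2) in auto)
    then obtain U where U: "openin X U" "x \<in> U" "\<forall>y\<in>U. \<forall>p\<in>Q. p (h y - h x) < ennreal e" by auto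
    have "U \<subseteq> topspace X" by (rule openin_subset[OF U(1)])
    then have "U \<subseteq> {x \<in> topspace X. h x \<in> W}" using U(3) Q(4) V by blast
    then show "\<exists>T. openin X T \<and> x \<in> T \<and> T \<subseteq> {x \<in> topspace X. h x \<in> W}" using U by blast
  qed
qed

lemma equicontinuous_between_seminorm_topology:
  assumes V: "csubspace V"
    and lin: "\<And>h. h \<in> H \<Longrightarrow> linear_between X (seminorm_topology V P) h"
    and nhds: "\<And>x p e. x \<in> topspace X \<Longrightarrow> p \<in> P \<Longrightarrow> 0 < e \<Longrightarrow>
      \<exists>U. openin X U \<and> x \<in> U \<and> (\<forall>h\<in>H. \<forall>y\<in>U. p (h y - h x) < ennreal e)"
  shows "equicontinuous_between X (seminorm_topology V P) H"
  unfolding equicontinuous_between_def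
proof (intro conjI ballI allI impI)
  have range: "h x \<in> V" if "h \<in> H" "x \<in> topspace X" for h x
    using lin[OF that(1)] that(2) unfolding linear_between_def by simp
  show "linear_between X (seminorm_topology V P) h" if "h \<in> H" for h by (rule lin[OF that])
  show "continuous_map X (seminorm_topology V P) h" if "h \<in> H" for h
  proof (rule continuous_map_seminorm_topology[OF range[OF that]])
    fix x p and e :: real assume "x \<in> topspace X" "p \<in> P" "0 < e"
    from nhds[OF this] show "\<exists>U. openin X U \<and> x \<in> U \<and> (\<forall>y\<in>U. p (h y - h x) < ennreal e)"
      using that by blast
  qed
  fix x W assume x: "x \<in> topspace X" and "zero_nhd (seminorm_topology V P) W"
  then obtain W' where W': "openin (seminorm_topology V P) W'" "0 \<in> W'" "W' \<subseteq> W"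
    unfolding zero_nhd_def by blast
  then obtain Q e where Q: "finite Q" "Q \<subseteq> P" "0 < e" "{g \<in> V. \<forall>p\<in>Q. p (g - 0) < ennreal e} \<subseteq> W'"
    unfolding openin_seminorm_topology by blast
  have "\<exists>U. openin X U \<and> x \<in> U \<and> (\<forall>h\<in>H. \<forall>y\<in>U. \<forall>p\<in>Q. p (h y - h x) < ennreal e)"
    by (rule seminorm_nhds_finite[OF Q(1) _ x]) (use nhds[OF x _ Q(3)] Q(2) in auto)
  then obtain U where U: "openin X U" "x \<in> U" "\<forall>h\<in>H. \<forall>y\<in>U. \<forall>p\<in>Q. p (h y - h x) < ennreal e" by blast
  have "h y - h x \<in> W" if "h \<in> H" "y \<in> U" for h y
  proof -
    have "h y - h x \<in> V"
      using openin_subset[OF U(1)] that x by (intro csubspaceD(4)[OF V] range) auto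
    then have "h y - h x \<in> {g \<in> V. \<forall>p\<in>Q. p (g - 0) < ennreal e}" using U(3) that by simp
    then show ?thesis using Q(4) W'(3) by blast
  qed
  then show "\<exists>U. openin X U \<and> x \<in> U \<and> (\<forall>h\<in>H. \<forall>g\<in>U. h g - h x \<in> W)" using U by blast
qed

lemma convex_seminorm_ball:
  assumes V: "csubspace V" and p: "seminorm_on V p" and e: "0 < e"
  shows "convex_fun_set {g \<in> V. p g < ennreal e}"
  unfolding convex_fun_set_def
proof (intro ballI allI impI)
  fix f g and t :: real
  assume "f \<in> {g \<in> V. p g < ennreal e}" "g \<in> {g \<in> V. p g < ennreal e}" and t: "0 \<le> t \<and> t \<le> 1"
  then have fg: "f \<in> V" "g \<in> V" "p f < ennreal e" "p g < ennreal e" by auto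
  from fg(3) obtain r where r: "p f = ennreal r" "0 \<le> r" "r < e" by (rule ennreal_less_realE)
  from fg(4) obtain s where s: "p g = ennreal s" "0 \<le> s" "s < e" by (rule ennreal_less_realE)
  let ?a = "\<lambda>x. complex_of_real (1 - t) * f x" and ?b = "\<lambda>x. complex_of_real t * g x"
  have ab: "?a \<in> V" "?b \<in> V" using fg V by (auto intro: csubspaceD)
  have eq: "?a + ?b = (\<lambda>x. complex_of_real (1 - t) * f x + complex_of_real t * g x)"
    by (simp add: plus_fun_def)
  have na: "cmod (complex_of_real (1 - t)) = 1 - t" "cmod (complex_of_real t) = t"
    using t by (simp_all only: norm_of_real) auto
  have "p (?a + ?b) \<le> p ?a + p ?b" by (rule seminorm_onD(1)[OF p ab])
  also have "\<dots> \<le> ennreal (1 - t) * p f + ennreal t * p g"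
    using seminorm_onD(2)[OF p fg(1), of "complex_of_real (1 - t)"]
      seminorm_onD(2)[OF p fg(2), of "complex_of_real t"] unfolding na by (rule add_mono)
  also have "\<dots> = ennreal ((1 - t) * r + t * s)"
    using t r s by (simp add: ennreal_mult'' ennreal_plus)
  also have "\<dots> < ennreal e"
  proof (rule ennreal_lessI[OF e])
    have "(1 - t) * r + t * s \<le> (1 - t) * max r s + t * max r s"
      using t by (intro add_mono mult_left_mono) auto
    also have "\<dots> = max r s" by (simp add: algebra_simps)
    finally show "(1 - t) * r + t * s < e" using r s by linarith
  qed
  finally show "(\<lambda>x. complex_of_real (1 - t) * f x + complex_of_real t * g x) \<in> {g \<in> V. p g < ennreal e}"
    using csubspaceD(2)[OF V ab] unfolding eq by simp
qed

text \<open>Provides admissible topologies for the definition of \<open>ind_limit\<close>: if a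
  finite seminorm on the union is continuous on every step, its balls are open in the inductive
  limit. Finiteness of \<open>p\<close> gives continuity in the scalar.\<close>

lemma locally_convex_tvs_seminorm:
  assumes V: "csubspace V" and p: "seminorm_on V p" and fin: "\<And>f. f \<in> V \<Longrightarrow> p f < \<infinity>"
  shows "locally_convex_tvs (seminorm_topology V {p})" (is "locally_convex_tvs ?X")
proof -
  have ball: "openin ?X {g \<in> V. p (g - f) < ennreal e}" if "f \<in> V" for f e
    by (intro openin_seminorm_ball V p that) simp
  have centre: "f \<in> {g \<in> V. p (g - f) < ennreal e}" if "f \<in> V" "0 < e" for f e
    using that seminorm_on_zero[OF p csubspaceD(1)[OF V]] by (simp add: zero_fun_def[symmetric])
  have add: "continuous_map (prod_topology ?X ?X) ?X (\<lambda>(f, g). f + g)"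
  proof (rule continuous_map_seminorm_topology)
    fix x q and e :: real
    assume x: "x \<in> topspace (prod_topology ?X ?X)" and q: "q \<in> {p}" and e: "0 < e"
    obtain f g where fg: "x = (f, g)" "f \<in> V" "g \<in> V" using x by auto
    let ?U = "{h \<in> V. p (h - f) < ennreal (e / 2)} \<times> {h \<in> V. p (h - g) < ennreal (e / 2)}"
    have "p (f' + g' - (f + g)) < ennreal e" if "(f', g') \<in> ?U" for f' g'
    proof -
      have "p (f' - f) < ennreal (e / 2)" "p (g' - g) < ennreal (e / 2)" and V': "f' \<in> V" "g' \<in> V"
        using that by auto
      then have "p (f' - f) + p (g' - g) < ennreal (e / 2) + ennreal (e / 2)"
        by (auto elim!: ennreal_less_realE simp: ennreal_less_iff simp flip: ennreal_plus)
      also have "\<dots> = ennreal e" using e by (simp flip: ennreal_plus)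
      finally have "p ((f' - f) + (g' - g)) < ennreal e"
        using seminorm_onD(1)[OF p csubspaceD(4)[OF V V'(1) fg(2)] csubspaceD(4)[OF V V'(2) fg(3)]]
        by (rule order_le_less_trans[rotated])
      also have "(f' - f) + (g' - g) = f' + g' - (f + g)" by simp
      finally show ?thesis .
    qed
    moreover have "openin (prod_topology ?X ?X) ?U"
      using ball fg by (simp add: openin_prod_Times_iff)
    moreover have "x \<in> ?U" using centre[OF fg(2), of "e / 2"] centre[OF fg(3), of "e / 2"] e fg(1) by simp
    ultimately show "\<exists>U. openin (prod_topology ?X ?X) U \<and> x \<in> U \<and>
        (\<forall>y\<in>U. q ((case y of (f, g) \<Rightarrow> f + g) - (case x of (f, g) \<Rightarrow> f + g)) < ennreal e)"
      using q fg(1) by (intro exI[of _ ?U]) auto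
  qed (auto intro: csubspaceD[OF V])
  have scale: "continuous_map (prod_topology euclidean ?X) ?X (\<lambda>(c :: complex, f). \<lambda>x. c * f x)"
  proof (rule continuous_map_seminorm_topology)
    fix x :: "complex \<times> ('a \<Rightarrow> complex)" and q and e :: real
    assume x: "x \<in> topspace (prod_topology euclidean ?X)" and q: "q \<in> {p}" and e: "0 < e"
    obtain c :: complex and f where cf: "x = (c, f)" "f \<in> V" using x by auto
    obtain r where r: "p f = ennreal r" "0 \<le> r" using fin[OF cf(2)] by (cases "p f") auto
    \<comment> \<open>Adapted to the splitting c' f' - c f = c' (f' - f) + (c' - c) f; the bound d
      \<le> 1 ensures |c'| \<le> |c| + 1.\<close>
    define d where "d = min 1 (e / (2 * (r + 1)))"
    define d' where "d' = e / (2 * (cmod c + 1))"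
    have c1: "0 < cmod c + 1" by (simp add: add_nonneg_pos)
    have d: "0 < d" "0 < d'" unfolding d_def d'_def using e r c1 by auto
    let ?U = "ball c d \<times> {h \<in> V. p (h - f) < ennreal d'}"
    have "p ((\<lambda>x. c' * f' x) - (\<lambda>x. c * f x)) < ennreal e" if U: "(c', f') \<in> ?U" for c' f'
    proof -
      have c': "cmod (c' - c) < d" and f': "f' \<in> V" "p (f' - f) < ennreal d'"
        using U by (auto simp: dist_norm norm_minus_commute)
      from f'(2) obtain s where s: "p (f' - f) = ennreal s" "0 \<le> s" "s < d'" by (rule ennreal_less_realE)
      have nc': "cmod c' \<le> cmod c + 1"
        using norm_triangle_sub[of c' c] c' unfolding d_def by simp
      let ?a = "\<lambda>x. c' * (f' - f) x" and ?b = "\<lambda>x. (c' - c) * f x"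
      have ab: "?a \<in> V" "?b \<in> V" by (intro csubspaceD(3)[OF V] csubspaceD(4)[OF V] f' cf)+
      have "p (?a + ?b) \<le> p ?a + p ?b" by (rule seminorm_onD(1)[OF p ab])
      also have "\<dots> \<le> ennreal (cmod c') * p (f' - f) + ennreal (cmod (c' - c)) * p f"
        by (intro add_mono seminorm_onD(2)[OF p] csubspaceD(4)[OF V] f' cf)
      also have "\<dots> = ennreal (cmod c' * s + cmod (c' - c) * r)"
        using s r by (simp add: ennreal_mult'' ennreal_plus)
      also have "\<dots> < ennreal e"
      proof (rule ennreal_lessI[OF e])
        have "cmod c' * s \<le> (cmod c + 1) * s" using nc' s by (intro mult_right_mono)
        also have "\<dots> < (cmod c + 1) * d'" using c1 s by (intro mult_strict_left_mono)
        also have "\<dots> = e / 2" unfolding d'_def using c1 by (simp add: field_simps)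
        finally have 1: "cmod c' * s < e / 2" .
        have "cmod (c' - c) * r \<le> (e / (2 * (r + 1))) * r"
          using c' r unfolding d_def by (intro mult_right_mono) auto
        also have "\<dots> \<le> e / 2" using e r by (simp add: field_simps)
        finally show "cmod c' * s + cmod (c' - c) * r < e" using 1 by simp
      qed
      also have "?a + ?b = (\<lambda>x. c' * f' x) - (\<lambda>x. c * f x)"
        by (simp add: fun_eq_iff algebra_simps)
      finally show ?thesis .
    qed
    moreover have "openin (prod_topology euclidean ?X) ?U"
      using ball cf by (simp add: openin_prod_Times_iff)
    moreover have "x \<in> ?U" using centre[OF cf(2) d(2)] d cf(1) by simp
    ultimately show "\<exists>U. openin (prod_topology euclidean ?X) U \<and> x \<in> U \<and>
        (\<forall>y\<in>U. q ((case y of (c, f) \<Rightarrow> \<lambda>x. c * f x) - (case x of (c, f) \<Rightarrow> \<lambda>x. c * f x)) < ennreal e)"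
      using q cf(1) by (intro exI[of _ ?U]) auto
  qed (auto intro: csubspaceD[OF V])
  have conv: "\<exists>C. convex_fun_set C \<and> zero_nhd ?X C \<and> C \<subseteq> U" if U: "zero_nhd ?X U" for U
  proof -
    obtain W where W: "openin ?X W" "0 \<in> W" "W \<subseteq> U" using U unfolding zero_nhd_def by blast
    then obtain Q e where Q: "Q \<subseteq> {p}" "0 < e" "{g \<in> V. \<forall>p\<in>Q. p (g - 0) < ennreal e} \<subseteq> W"
      unfolding openin_seminorm_topology by blast
    have "{g \<in> V. p g < ennreal e} \<subseteq> U" using Q W(3) by auto
    moreover have "zero_nhd ?X {g \<in> V. p g < ennreal e}"
      by (intro zero_nhd_seminorm_ball V p Q) simp
    ultimately show ?thesis using convex_seminorm_ball[OF V p Q(2)] by blast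
  qed
  show ?thesis
    unfolding locally_convex_tvs_def using V add scale conv by simp
qed

section \<open>Open sets of projective and inductive limits\<close>

lemma openin_proj_limit:
  "i \<in> I \<Longrightarrow> openin (X i) U \<Longrightarrow> openin (proj_limit I X) ((\<Inter>j\<in>I. topspace (X j)) \<inter> U)"
  unfolding proj_limit_def by (rule topology_generated_by_Basis) blast

lemma openin_ind_limit:
  assumes "locally_convex_tvs Y" "topspace Y = (\<Union>i\<in>I. topspace (X i))"
    "\<And>i. i \<in> I \<Longrightarrow> continuous_map (X i) Y (\<lambda>f. f)" "openin Y W"
  shows "openin (ind_limit I X) W"
  unfolding ind_limit_def by (rule topology_generated_by_Basis) (use assms in blast)

text \<open>For the generating sets this is continuity of the inclusion; taking the trace on a step
  commutes with finite intersections and with unions.\<close>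

lemma openin_ind_limit_step:
  assumes "openin (ind_limit I X) W" "i \<in> I"
  shows "openin (X i) (W \<inter> topspace (X i))"
  using openin_topology_generated_by[OF assms(1)[unfolded ind_limit_def]]
proof induction
  case (Int a b)
  have "a \<inter> b \<inter> topspace (X i) = (a \<inter> topspace (X i)) \<inter> (b \<inter> topspace (X i))" by blast
  then show ?case using openin_Int[OF Int.IH] by (simp only:)
next
  case (UN K)
  have "\<Union>K \<inter> topspace (X i) = (\<Union>k\<in>K. k \<inter> topspace (X i))" by blast
  moreover have "openin (X i) (\<Union>k\<in>K. k \<inter> topspace (X i))"
    by (rule openin_Union) (use UN.IH in blast)
  ultimately show ?case by (simp only:)
next
  case (Basis W)
  then obtain Y where "\<forall>i\<in>I. continuous_map (X i) Y (\<lambda>f. f)" "openin Y W" by blast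
  then have "openin (X i) {f \<in> topspace (X i). f \<in> W}"
    using assms(2) openin_continuous_map_preimage by fastforce
  also have "{f \<in> topspace (X i). f \<in> W} = W \<inter> topspace (X i)" by blast
  finally show ?case .
qed simp

text \<open>Since the seminorms increase with the index, the balls of p i and p j both contain a
  ball of p (max i j). So one index suffices where the initial topology would ask for finitely
  many.\<close>

lemma openin_proj_limit_decreasing_seminorms:
  assumes I: "I \<noteq> {}" "I \<subseteq> {(1::nat)..}"
    and mono: "\<And>i j f. i \<in> I \<Longrightarrow> j \<in> I \<Longrightarrow> i \<le> j \<Longrightarrow> f \<in> V \<Longrightarrow> p i f \<le> p j f"
    and V: "V = (\<Inter>i\<in>I. E i)" "csubspace V"
    and W: "openin (proj_limit I (\<lambda>i. seminorm_topology (E i) {p i})) W" and f: "f \<in> W"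
  shows "\<exists>i\<in>I. \<exists>e>0. {g \<in> V. p i (g - f) < ennreal e} \<subseteq> W"
  using openin_topology_generated_by[OF W[unfolded proj_limit_def]] f
proof (induction arbitrary: f)
  case (Int a b)
  have "openin (proj_limit I (\<lambda>i. seminorm_topology (E i) {p i})) a"
    unfolding proj_limit_def openin_topology_generated_by_iff by (rule Int.hyps(1))
  from openin_subset[OF this] have "a \<subseteq> V"
    unfolding topspace_proj_limit[OF I(1)] V(1) topspace_seminorm_topology .
  then have fV: "f \<in> V" using Int.prems by blast
  obtain i d where i: "i \<in> I" "0 < d" "{g \<in> V. p i (g - f) < ennreal d} \<subseteq> a"
    using Int.IH(1)[of f] Int.prems by blast
  obtain j e where j: "j \<in> I" "0 < e" "{g \<in> V. p j (g - f) < ennreal e} \<subseteq> b"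
    using Int.IH(2)[of f] Int.prems by blast
  have "max i j \<in> I" using i(1) j(1) by (simp add: max_def)
  moreover have "{g \<in> V. p (max i j) (g - f) < ennreal (min d e)} \<subseteq> a \<inter> b"
  proof
    fix g assume "g \<in> {g \<in> V. p (max i j) (g - f) < ennreal (min d e)}"
    then have g: "g \<in> V" "p (max i j) (g - f) < ennreal (min d e)" by auto
    have "g - f \<in> V" using g(1) fV by (rule csubspaceD(4)[OF V(2)])
    then have "p i (g - f) \<le> p (max i j) (g - f)" "p j (g - f) \<le> p (max i j) (g - f)"
      using mono[OF i(1) \<open>max i j \<in> I\<close>] mono[OF j(1) \<open>max i j \<in> I\<close>] by auto
    moreover have "ennreal (min d e) \<le> ennreal d" "ennreal (min d e) \<le> ennreal e"
      by (auto intro: ennreal_leI)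
    ultimately have "p i (g - f) < ennreal d" "p j (g - f) < ennreal e"
      using g(2) by (meson le_less_trans less_le_trans)+
    then show "g \<in> a \<inter> b" using g(1) i(3) j(3) by blast
  qed
  moreover have "0 < min d e" using i(2) j(2) by simp
  ultimately show ?case by blast
next
  case (UN K)
  then obtain k where "k \<in> K" "f \<in> k" by blast
  with UN.IH[of k f] show ?case by blast
next
  case (Basis W)
  then obtain i U where i: "i \<in> I" "W = (\<Inter>i\<in>I. E i) \<inter> U" "openin (seminorm_topology (E i) {p i}) U"
    by auto
  then obtain Q e where Q: "Q \<subseteq> {p i}" "0 < e" "{g \<in> E i. \<forall>q\<in>Q. q (g - f) < ennreal e} \<subseteq> U"
    using Basis.prems unfolding openin_seminorm_topology by blast
  have "{g \<in> V. p i (g - f) < ennreal e} \<subseteq> W"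
    using Q i(1) unfolding i(2) V(1) by auto
  then show ?case using i(1) Q(2) by blast
qed simp

section \<open>Dual spaces and bounded sets\<close>

lemma csubspace_dual_space:
  assumes X: "csubspace (topspace X)"
  shows "csubspace (dual_space X)"
  unfolding csubspace_def
proof (intro conjI ballI allI)
  show "0 \<in> dual_space X" unfolding dual_space_def by (simp add: zero_fun_def)
  fix S T assume "S \<in> dual_space X" "T \<in> dual_space X"
  then show "S + T \<in> dual_space X"
    unfolding dual_space_def plus_fun_def by (auto intro: continuous_map_add simp: algebra_simps)
next
  fix c T assume T: "T \<in> dual_space X"
  then have "continuous_map X euclidean T" unfolding dual_space_def by blast
  then have "continuous_map X euclidean ((\<lambda>z. c * z) \<circ> T)"
    by (rule continuous_map_compose) (auto intro!: continuous_intros)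
  then show "(\<lambda>x. c * T x) \<in> dual_space X"
    using T unfolding dual_space_def by (auto simp: algebra_simps o_def)
qed

lemma seminorm_on_sup_norm: "seminorm_on V (\<lambda>T. SUP f\<in>B. ennreal (cmod (T f)))"
  unfolding seminorm_on_def
proof (intro conjI ballI allI)
  fix S T :: "'a \<Rightarrow> complex"
  show "(SUP f\<in>B. ennreal (cmod ((S + T) f))) \<le> (SUP f\<in>B. ennreal (cmod (S f))) + (SUP f\<in>B. ennreal (cmod (T f)))"
  proof (rule SUP_least)
    fix f assume f: "f \<in> B"
    have "ennreal (cmod ((S + T) f)) \<le> ennreal (cmod (S f)) + ennreal (cmod (T f))"
      by (simp add: norm_triangle_ineq ennreal_leI flip: ennreal_plus)
    also have "\<dots> \<le> (SUP f\<in>B. ennreal (cmod (S f))) + (SUP f\<in>B. ennreal (cmod (T f)))"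
      using f by (intro add_mono SUP_upper)
    finally show "ennreal (cmod ((S + T) f)) \<le> \<dots>" .
  qed
next
  fix c and T :: "'a \<Rightarrow> complex"
  show "(SUP f\<in>B. ennreal (cmod (c * T f))) \<le> ennreal (cmod c) * (SUP f\<in>B. ennreal (cmod (T f)))"
    by (rule SUP_least) (auto simp: norm_mult ennreal_mult'' intro!: mult_left_mono SUP_upper)
qed

text \<open>A bounded set lies in r times the unit ball of \<open>p\<close>, so \<open>p\<close> is
  at most r on it.\<close>

lemma tvs_bounded_seminorm:
  assumes B: "tvs_bounded X B" and U: "zero_nhd X {f \<in> topspace X. p f < ennreal 1}"
    and p: "seminorm_on (topspace X) p"
  shows "\<exists>r. \<forall>f\<in>B. p f \<le> ennreal r"
proof -
  obtain r where r: "0 < r" "\<And>c. r \<le> cmod c \<Longrightarrow> B \<subseteq> (\<lambda>f x. c * f x) ` {f \<in> topspace X. p f < ennreal 1}"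
    using B U unfolding tvs_bounded_def by blast
  have "p f \<le> ennreal r" if "f \<in> B" for f
  proof -
    have "f \<in> (\<lambda>f x. of_real r * f x) ` {f \<in> topspace X. p f < ennreal 1}"
      using r(2)[of "of_real r"] r(1) that by auto
    then obtain g where g: "g \<in> topspace X" "p g < ennreal 1" "f = (\<lambda>x. of_real r * g x)" by blast
    have "p f \<le> ennreal (cmod (of_real r)) * p g" unfolding g(3) by (rule seminorm_onD(2)[OF p g(1)])
    also have "\<dots> \<le> ennreal r * 1"
      using g(2) r(1) by (intro mult_mono) auto
    finally show ?thesis by simp
  qed
  then show ?thesis by blast
qed

lemma dual_bounded_on_bounded:
  assumes X: "csubspace (topspace X)" and T: "T \<in> dual_space X" and B: "tvs_bounded X B"
  shows "\<exists>r. \<forall>f\<in>B. cmod (T f) \<le> r"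
proof -
  let ?p = "\<lambda>f. ennreal (cmod (T f))"
  have p: "seminorm_on (topspace X) ?p"
    using T unfolding seminorm_on_def dual_space_def
    by (auto simp: norm_mult ennreal_mult'' norm_triangle_ineq ennreal_leI simp flip: ennreal_plus)
  have "openin X {f \<in> topspace X. T f \<in> ball 0 1}"
    using T unfolding dual_space_def by (intro openin_continuous_map_preimage[where Y = euclidean]) auto
  also have "{f \<in> topspace X. T f \<in> ball 0 1} = {f \<in> topspace X. ?p f < ennreal 1}"
    by (auto simp: ennreal_less_iff simp del: ennreal_1)
  finally have "openin X {f \<in> topspace X. ?p f < ennreal 1}" .
  moreover have "?p 0 < ennreal 1" using seminorm_on_zero[OF p csubspaceD(1)[OF X]] by simp
  ultimately have "zero_nhd X {f \<in> topspace X. ?p f < ennreal 1}"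
    unfolding zero_nhd_def using csubspaceD(1)[OF X] by blast
  from tvs_bounded_seminorm[OF B this p] obtain r where "\<forall>f\<in>B. ?p f \<le> ennreal r" by blast
  then have "\<forall>f\<in>B. cmod (T f) \<le> max r 0"
    by (metis ennreal_le_iff ennreal_max_0 max.commute max.cobounded1 max.cobounded2)
  then show ?thesis by blast
qed

text \<open>The supremum over \<open>B\<close> is one of the seminorms that define the strong dual,
  so \<open>tvs_bounded_seminorm\<close> applies to it and \<open>D\<close>.\<close>

lemma strong_dual_bounded_on_bounded:
  assumes X: "csubspace (topspace X)" and D: "tvs_bounded (strong_dual X) D" and B: "tvs_bounded X B"
  shows "\<exists>r. \<forall>T\<in>D. \<forall>f\<in>B. cmod (T f) \<le> r"
proof -
  let ?p = "\<lambda>T. SUP f\<in>B. ennreal (cmod (T f))"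
  have "zero_nhd (strong_dual X) {T \<in> dual_space X. ?p T < ennreal 1}"
    unfolding strong_dual_def
    by (rule zero_nhd_seminorm_ball[OF csubspace_dual_space[OF X] _ seminorm_on_sup_norm]) (use B in auto)
  then have U: "zero_nhd (strong_dual X) {T \<in> topspace (strong_dual X). ?p T < ennreal 1}"
    unfolding strong_dual_def by simp
  from tvs_bounded_seminorm[OF D U seminorm_on_sup_norm]
  obtain r where r: "\<forall>T\<in>D. ?p T \<le> ennreal r" by blast
  have "cmod (T f) \<le> max r 0" if "T \<in> D" "f \<in> B" for T f
  proof -
    have "ennreal (cmod (T f)) \<le> ?p T" using that by (intro SUP_upper)
    also have "\<dots> \<le> ennreal (max r 0)" using r that by (auto intro: order_trans[OF _ ennreal_leI])
    finally show ?thesis by simp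
  qed
  then show ?thesis by blast
qed

lemma csubspace_seminorm_finite:
  assumes "csubspace V" "seminorm_on V p"
  shows "csubspace {f \<in> V. p f < \<infinity>}"
  unfolding csubspace_def
proof (intro conjI ballI allI)
  show "0 \<in> {f \<in> V. p f < \<infinity>}" using seminorm_on_zero[OF assms(2)] csubspaceD(1)[OF assms(1)] by simp
next
  fix f g assume "f \<in> {f \<in> V. p f < \<infinity>}" "g \<in> {f \<in> V. p f < \<infinity>}"
  then show "f + g \<in> {f \<in> V. p f < \<infinity>}"
    using csubspaceD(2)[OF assms(1)] seminorm_onD(1)[OF assms(2), of f g] by (auto simp: order_le_less_trans)
next
  fix c f assume "f \<in> {f \<in> V. p f < \<infinity>}"
  then show "(\<lambda>x. c * f x) \<in> {f \<in> V. p f < \<infinity>}"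
    using csubspaceD(3)[OF assms(1)] seminorm_onD(2)[OF assms(2), of f c]
    by (auto simp: ennreal_mult_less_top order_le_less_trans)
qed

lemma seminorm_on_subset: "seminorm_on V p \<Longrightarrow> W \<subseteq> V \<Longrightarrow> seminorm_on W p"
  unfolding seminorm_on_def by (meson subsetD)

lemma csubspace_increasing_UN:
  assumes "\<And>n. (1::nat) \<le> n \<Longrightarrow> csubspace (V n)" "\<And>n n'. 1 \<le> n \<Longrightarrow> n \<le> n' \<Longrightarrow> V n \<subseteq> V n'"
  shows "csubspace (\<Union>n\<in>{1..}. V n)"
  unfolding csubspace_def
proof (intro conjI ballI allI)
  show "0 \<in> (\<Union>n\<in>{1..}. V n)" using csubspaceD(1)[OF assms(1)[of 1]] by (intro UN_I[of 1]) simp_all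
next
  fix f g assume "f \<in> (\<Union>n\<in>{1..}. V n)" "g \<in> (\<Union>n\<in>{1..}. V n)"
  then obtain k l where kl: "1 \<le> k" "1 \<le> l" "f \<in> V k" "g \<in> V l" by auto
  have "f \<in> V (max k l)" using assms(2)[of k "max k l"] kl by (meson max.cobounded1 subsetD)
  moreover have "g \<in> V (max k l)" using assms(2)[of l "max k l"] kl by (meson max.cobounded2 subsetD)
  moreover have "csubspace (V (max k l))" using kl by (intro assms(1)) simp
  ultimately have "f + g \<in> V (max k l)" using csubspaceD(2) by blast
  then show "f + g \<in> (\<Union>n\<in>{1..}. V n)" using kl by (intro UN_I[of "max k l"]) auto
next
  fix c f assume "f \<in> (\<Union>n\<in>{1..}. V n)"
  then obtain k where k: "1 \<le> k" "f \<in> V k" by auto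
  then show "(\<lambda>x. c * f x) \<in> (\<Union>n\<in>{1..}. V n)"
    using csubspaceD(3)[OF assms(1)[OF k(1)] k(2)] by (intro UN_I[of k]) simp_all
qed

lemma csubspace_INT: "(\<And>i. i \<in> I \<Longrightarrow> csubspace (V i)) \<Longrightarrow> csubspace (\<Inter>i\<in>I. V i)"
  unfolding csubspace_def by (simp only: INT_iff) simp

section \<open>Weight functions and the Young conjugate\<close>

text \<open>The infimum of the slopes to the right of s, i.e. the right derivative, lies above all
  slopes to the left. The second property later shows that the slope is nonnegative for increasing
  functions.\<close>

lemma convex_on_supporting_slope:
  fixes f :: "real \<Rightarrow> real"
  assumes f: "convex_on UNIV f"
  obtains p where "\<And>t. f s + p * (t - s) \<le> f t"
    "\<And>t. t < s \<Longrightarrow> (f s - f t) / (s - t) \<le> p"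
proof -
  define p where "p = (INF u\<in>{s<..}. (f u - f s) / (u - s))"
  have slope: "(f s - f t) / (s - t) \<le> (f u - f s) / (u - s)" if "t < s" "s < u" for t u
  proof -
    have "(f t - f s) / (t - s) \<le> (f s - f u) / (s - u)"
      using convex_on_slope_le[OF f, of t u s] that by (meson UNIV_I order_trans)
    also have "(f t - f s) / (t - s) = (f s - f t) / (s - t)"
      by (metis minus_diff_eq minus_divide_divide)
    also have "(f s - f u) / (s - u) = (f u - f s) / (u - s)"
      by (metis minus_diff_eq minus_divide_divide)
    finally show ?thesis .
  qed
  have left: "(f s - f t) / (s - t) \<le> p" if "t < s" for t
    unfolding p_def using slope[OF that] by (intro cINF_greatest) auto
  have bdd: "bdd_below ((\<lambda>u. (f u - f s) / (u - s)) ` {s<..})"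
    using slope[of "s - 1"] by (intro bdd_belowI2[of _ "(f s - f (s - 1)) / (s - (s - 1))"]) auto
  have right: "p \<le> (f u - f s) / (u - s)" if "s < u" for u
    unfolding p_def using that by (intro cINF_lower bdd) auto
  have "f s + p * (t - s) \<le> f t" for t
    using left[of t] right[of t] by (cases t s rule: linorder_cases) (auto simp: field_simps)
  with left that show ?thesis by blast
qed

text \<open>For a > 0 take c = 1 / a; for a = 0 the second condition is void and c only has to be
  large. It normalises a vector whose norm a may vanish.\<close>

lemma inverse_scaling:
  assumes "0 \<le> a" "real j * a < b"
  obtains c :: real where "0 < c" "c * a \<le> 1" "real j < c * b"
proof (cases "a = 0")
  case True
  then have "0 < b" using assms(2) by simp
  then have "(real j + 1) / b * b = real j + 1" "0 < (real j + 1) / b" by simp_all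
  then show ?thesis using True that[of "(real j + 1) / b"] by simp
next
  case False
  then have "0 < a" using assms by simp
  with assms(2) show ?thesis by (intro that[of "1 / a"]) (auto simp: field_simps)
qed

locale weight =
  fixes \<omega> :: "real \<Rightarrow> real"
  assumes nonquasianalytic: "nonquasianalytic_weight \<omega>"
    and ln_smallo: "(\<lambda>t. ln (1 + t)) \<in> o[at_top](\<omega>)"
begin

lemma omega_continuous: "continuous_on {0..} \<omega>"
  and omega_mono: "0 \<le> s \<Longrightarrow> s \<le> t \<Longrightarrow> \<omega> s \<le> \<omega> t"
  and omega_nonneg: "0 \<le> t \<Longrightarrow> 0 \<le> \<omega> t"
  and omega_convex: "convex_on UNIV (\<lambda>t. \<omega> (exp t))"
  and omega_eq_0: "0 \<le> t \<Longrightarrow> t \<le> 1 \<Longrightarrow> \<omega> t = 0"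
  using nonquasianalytic unfolding nonquasianalytic_weight_def mono_on_def by simp_all

lemma omega_norm_nonneg [simp]: "0 \<le> \<omega> (norm x)"
  by (simp add: omega_nonneg)

lemma continuous_omega_norm: "continuous_on A (\<lambda>x. \<omega> (norm x))"
  by (rule continuous_on_compose2[OF omega_continuous]) (auto intro!: continuous_intros)

text \<open>The constant of the doubling condition as a natural number, so that
  \<open>\<kappa> * m\<close> is again an index of the norms.\<close>

definition \<kappa> :: nat where
  "\<kappa> = (SOME K. 1 \<le> K \<and> (\<forall>t\<ge>0. \<omega> (2 * t) \<le> real K * (1 + \<omega> t)))"

lemma kappa: "1 \<le> \<kappa>" "0 \<le> t \<Longrightarrow> \<omega> (2 * t) \<le> real \<kappa> * (1 + \<omega> t)"
proof -
  obtain K where K: "1 \<le> K" "\<And>t. 0 \<le> t \<Longrightarrow> \<omega> (2 * t) \<le> K * (1 + \<omega> t)"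
    using nonquasianalytic unfolding nonquasianalytic_weight_def by blast
  have "\<omega> (2 * t) \<le> real (nat \<lceil>K\<rceil>) * (1 + \<omega> t)" if "0 \<le> t" for t
  proof -
    have "K * (1 + \<omega> t) \<le> real (nat \<lceil>K\<rceil>) * (1 + \<omega> t)"
      using omega_nonneg[OF that] by (intro mult_right_mono) linarith+
    with K(2)[OF that] show ?thesis by linarith
  qed
  moreover have "1 \<le> nat \<lceil>K\<rceil>" using K(1) by linarith
  ultimately have "\<exists>K::nat. 1 \<le> K \<and> (\<forall>t\<ge>0. \<omega> (2 * t) \<le> real K * (1 + \<omega> t))" by blast
  from someI_ex[OF this] show "1 \<le> \<kappa>" "0 \<le> t \<Longrightarrow> \<omega> (2 * t) \<le> real \<kappa> * (1 + \<omega> t)"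
    unfolding \<kappa>_def by auto
qed

text \<open>Beyond some a the little-o hypothesis applies, with constant 1 / (k + 1) so that k = 0
  is covered; below a, monotonicity of the logarithm bounds the left side.\<close>

lemma ln_bound:
  obtains C where "0 \<le> C" "\<And>t. 0 \<le> t \<Longrightarrow> real k * ln (1 + t) \<le> \<omega> t + C"
proof -
  have "\<forall>\<^sub>F t in at_top. norm (ln (1 + t)) \<le> inverse (real k + 1) * norm (\<omega> t)"
    by (rule landau_o.smallD[OF ln_smallo]) auto
  then obtain a where a: "\<And>t. a \<le> t \<Longrightarrow> \<bar>ln (1 + t)\<bar> \<le> inverse (real k + 1) * \<bar>\<omega> t\<bar>"
    unfolding eventually_at_top_linorder by auto
  show ?thesis
  proof
    show "0 \<le> real k * ln (1 + \<bar>a\<bar>)" by simp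
    fix t :: real assume t: "0 \<le> t"
    show "real k * ln (1 + t) \<le> \<omega> t + real k * ln (1 + \<bar>a\<bar>)"
    proof (cases "a \<le> t")
      case True
      have "(real k + 1) * ln (1 + t) \<le> \<omega> t"
        using a[OF True] t omega_nonneg[OF t] by (simp add: field_simps)
      then have "real k * ln (1 + t) \<le> \<omega> t"
        using t ln_ge_zero[of "1 + t"] unfolding distrib_right by linarith
      moreover have "0 \<le> real k * ln (1 + \<bar>a\<bar>)" by simp
      ultimately show ?thesis by linarith
    next
      case False
      then have "real k * ln (1 + t) \<le> real k * ln (1 + \<bar>a\<bar>)"
        using t by (intro mult_left_mono) auto
      then show ?thesis using omega_nonneg[OF t] by linarith
    qed
  qed
qed

lemma power_bound:
  obtains C where "0 < C" "\<And>t. 0 \<le> t \<Longrightarrow> (1 + t) ^ k \<le> C * exp (\<omega> t)"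
proof -
  obtain C where C: "0 \<le> C" "\<And>t. 0 \<le> t \<Longrightarrow> real k * ln (1 + t) \<le> \<omega> t + C"
    using ln_bound by blast
  show ?thesis
  proof
    show "0 < exp C" by simp
    fix t :: real assume t: "0 \<le> t"
    have "(1 + t) ^ k = exp (real k * ln (1 + t))"
      using t by (simp add: exp_of_nat_mult)
    also have "\<dots> \<le> exp (\<omega> t + C)" using C(2)[OF t] by simp
    finally show "(1 + t) ^ k \<le> exp C * exp (\<omega> t)" by (simp add: exp_add mult.commute)
  qed
qed

lemma integrable_exp_omega:
  "integrable lborel (\<lambda>x::'a::euclidean_space. exp (- \<omega> (norm x)))"
proof -
  obtain C where C: "0 < C" "\<And>t. 0 \<le> t \<Longrightarrow> (1 + t) ^ (DIM('a) + 2) \<le> C * exp (\<omega> t)"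
    using power_bound by blast
  have "integrable lborel (\<lambda>x::'a. C * inverse ((1 + norm x) ^ (DIM('a) + 2)))"
    by (intro integrable_mult_right integrable_inverse_power_norm)
  then show ?thesis
  proof (rule Bochner_Integration.integrable_bound)
    show "(\<lambda>x::'a. exp (- \<omega> (norm x))) \<in> borel_measurable lborel"
      by (intro continuous_borel continuous_intros continuous_omega_norm)
    show "AE x::'a in lborel. norm (exp (- \<omega> (norm x))) \<le> norm (C * inverse ((1 + norm x) ^ (DIM('a) + 2)))"
    proof (rule AE_I2)
      fix x :: 'a
      have "0 < (1 + norm x) ^ (DIM('a) + 2)"
        by (intro zero_less_power) (smt (verit) norm_ge_zero)
      then show "norm (exp (- \<omega> (norm x))) \<le> norm (C * inverse ((1 + norm x) ^ (DIM('a) + 2)))"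
        using C(2)[of "norm x"] C(1)
        by (simp add: exp_minus abs_mult field_simps del: power_add power_Suc)
    qed
  qed
qed

text \<open>By \<open>Y_upper\<close> and \<open>Y_least\<close> this is the supremum of k t - m
  \<omega> (exp t) over t \<ge> 0; in this form no division by m remains.\<close>

definition Y :: "nat \<Rightarrow> nat \<Rightarrow> real" where
  "Y m k = real m * real_of_ereal (young_conjugate \<omega> (real k / real m))"

text \<open>Since t \<le> ln (1 + exp t), the term s t is at most \<omega> (exp t) plus a constant
  by \<open>ln_bound\<close>. The value at t = 0 bounds the supremum from below.\<close>

lemma young_conjugate_finite: "\<bar>young_conjugate \<omega> s\<bar> \<noteq> \<infinity>"
proof -
  obtain C where C: "0 \<le> C" "\<And>t. 0 \<le> t \<Longrightarrow> real (nat \<lceil>s\<rceil>) * ln (1 + t) \<le> \<omega> t + C"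
    using ln_bound by blast
  have "young_conjugate \<omega> s \<le> ereal C"
    unfolding young_conjugate_def
  proof (rule SUP_least)
    fix t :: real assume t: "t \<in> {0..}"
    have "t \<le> ln (1 + exp t)" by (subst ln_exp[symmetric]) (subst ln_le_cancel_iff, auto simp: add_pos_pos)
    then have "s * t \<le> real (nat \<lceil>s\<rceil>) * ln (1 + exp t)"
      using t by (intro mult_mono) (auto simp: real_nat_ceiling_ge)
    with C(2)[of "exp t"] show "ereal (s * t - \<omega> (exp t)) \<le> ereal C" by simp
  qed
  moreover have "ereal (s * 0 - \<omega> (exp 0)) \<le> young_conjugate \<omega> s"
    unfolding young_conjugate_def by (rule SUP_upper) simp
  ultimately show ?thesis by (cases "young_conjugate \<omega> s") auto
qed

lemma Y_upper:
  assumes "1 \<le> m" "0 \<le> t"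
  shows "real k * t - real m * \<omega> (exp t) \<le> Y m k"
proof -
  have "ereal (real k / real m * t - \<omega> (exp t)) \<le> young_conjugate \<omega> (real k / real m)"
    unfolding young_conjugate_def using assms(2) by (intro SUP_upper) simp
  then have "real k / real m * t - \<omega> (exp t) \<le> real_of_ereal (young_conjugate \<omega> (real k / real m))"
    using young_conjugate_finite[of "real k / real m"]
    by (cases "young_conjugate \<omega> (real k / real m)") auto
  then have "real m * (real k / real m * t - \<omega> (exp t)) \<le> Y m k"
    unfolding Y_def by (intro mult_left_mono) auto
  then show ?thesis using assms(1) by (simp add: right_diff_distrib)
qed

lemma Y_least:
  assumes "1 \<le> m" "\<And>t. 0 \<le> t \<Longrightarrow> real k * t - real m * \<omega> (exp t) \<le> C"
  shows "Y m k \<le> C"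
proof -
  have "young_conjugate \<omega> (real k / real m) \<le> ereal (C / real m)"
    unfolding young_conjugate_def
  proof (rule SUP_least)
    fix t :: real assume "t \<in> {0..}"
    then have "(real k * t - real m * \<omega> (exp t)) / real m \<le> C / real m"
      using assms by (intro divide_right_mono) auto
    then show "ereal (real k / real m * t - \<omega> (exp t)) \<le> ereal (C / real m)"
      using assms(1) by (simp add: diff_divide_distrib)
  qed
  then have "real_of_ereal (young_conjugate \<omega> (real k / real m)) \<le> C / real m"
    using young_conjugate_finite[of "real k / real m"]
    by (cases "young_conjugate \<omega> (real k / real m)") auto
  then show ?thesis unfolding Y_def using assms(1) by (simp add: field_simps)
qed

lemma young_factor_eq: "1 \<le> m \<Longrightarrow> young_factor \<omega> m k = exp (- Y m k)"
  using young_conjugate_finite[of "real k / real m"]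
  unfolding young_factor_def exp_neg_def Y_def
  by (cases "young_conjugate \<omega> (real k / real m)") auto

lemma Y_nonneg: "1 \<le> m \<Longrightarrow> 0 \<le> Y m k"
  using Y_upper[of m 0 k] omega_eq_0[of 1] by simp

lemma Y_zero: "1 \<le> m \<Longrightarrow> Y m 0 = 0"
  using Y_nonneg[of m 0] Y_least[of m 0 0] omega_nonneg by (auto simp: antisym)

lemma Y_antimono:
  assumes "1 \<le> m" "m \<le> m'"
  shows "Y m' k \<le> Y m k"
proof (rule Y_least)
  fix t :: real assume t: "0 \<le> t"
  have "real m * \<omega> (exp t) \<le> real m' * \<omega> (exp t)"
    using assms by (intro mult_right_mono omega_nonneg) auto
  with Y_upper[OF assms(1) t, of k] show "real k * t - real m' * \<omega> (exp t) \<le> Y m k" by linarith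
qed (use assms in auto)

text \<open>For s, t \<ge> 0 let r be their maximum: j s + k t \<le> (j + k) r, while \<omega> (exp
  r) is one of \<omega> (exp s) and \<omega> (exp t), hence at most their sum. So r is a common
  competitor in the supremum for \<open>Y m (j + k)\<close>.\<close>

lemma Y_superadditive:
  assumes m: "1 \<le> m"
  shows "Y m j + Y m k \<le> Y m (j + k)"
proof -
  have "Y m j \<le> Y m (j + k) - (real k * t - real m * \<omega> (exp t))" if t: "0 \<le> t" for t
  proof (rule Y_least[OF m])
    fix s :: real assume s: "0 \<le> s"
    let ?r = "max s t"
    have "real j * s \<le> real j * ?r" "real k * t \<le> real k * ?r"
      by (auto intro!: mult_left_mono)
    moreover have "real m * \<omega> (exp ?r) \<le> real m * \<omega> (exp s) + real m * \<omega> (exp t)"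
      using mult_nonneg_nonneg[of "real m" "\<omega> (exp s)"] mult_nonneg_nonneg[of "real m" "\<omega> (exp t)"]
      by (auto simp: max_def omega_nonneg)
    moreover have "real (j + k) * ?r - real m * \<omega> (exp ?r) \<le> Y m (j + k)"
      using s by (intro Y_upper m) auto
    ultimately show "real j * s - real m * \<omega> (exp s) \<le>
        Y m (j + k) - (real k * t - real m * \<omega> (exp t))"
      by (simp add: algebra_simps)
  qed
  then have "Y m k \<le> Y m (j + k) - Y m j"
    by (intro Y_least m) (simp add: algebra_simps)
  then show ?thesis by linarith
qed

lemma Y_double: "1 \<le> m \<Longrightarrow> Y (2 * m) (2 * k) = 2 * Y m k"
  unfolding Y_def by simp

text \<open>Inserting t + ln 2 into the supremum for \<open>Y m k\<close> produces the summand k ln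
  2, and the doubling condition bounds \<omega> (2 exp t).\<close>

lemma Y_kappa:
  assumes m: "1 \<le> m"
  shows "real k * ln 2 + Y (\<kappa> * m) k \<le> Y m k + real (\<kappa> * m)"
proof -
  have "Y (\<kappa> * m) k \<le> Y m k + real (\<kappa> * m) - real k * ln 2"
  proof (rule Y_least)
    show "1 \<le> \<kappa> * m" using m kappa(1) by (metis mult_le_mono nat_mult_1)
    fix t :: real assume t: "0 \<le> t"
    have "real m * \<omega> (2 * exp t) \<le> real m * (real \<kappa> * (1 + \<omega> (exp t)))"
      by (intro mult_left_mono kappa) auto
    moreover have "real k * (t + ln 2) - real m * \<omega> (exp (t + ln 2)) \<le> Y m k"
      using t by (intro Y_upper m) auto
    moreover have "exp (t + ln 2) = 2 * exp t" by (simp add: exp_add)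
    ultimately show "real k * t - real (\<kappa> * m) * \<omega> (exp t) \<le> Y m k + real (\<kappa> * m) - real k * ln 2"
      by (simp add: algebra_simps)
  qed
  then show ?thesis by linarith
qed

text \<open>Iterates \<open>Y_kappa\<close> j times; the additive errors do not depend on k and are
  collected in \<open>C\<close>.\<close>

lemma power2_absorb:
  assumes m: "1 \<le> m"
  obtains C where "0 < C" "\<And>k. 2 ^ (j * k) * exp (Y (\<kappa> ^ j * m) k) \<le> C * exp (Y m k)"
proof -
  have "\<exists>C>0. \<forall>k. 2 ^ (j * k) * exp (Y (\<kappa> ^ j * m) k) \<le> C * exp (Y m k)"
  proof (induction j)
    case 0
    show ?case by (intro exI[of _ 1]) simp
  next
    case (Suc j)
    then obtain C where C: "C > 0" "\<And>k. 2 ^ (j * k) * exp (Y (\<kappa> ^ j * m) k) \<le> C * exp (Y m k)"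
      by blast
    let ?m = "\<kappa> ^ j * m"
    have "1 \<le> \<kappa> ^ j" using kappa(1) by (rule one_le_power)
    then have m': "1 \<le> ?m" using m by (metis mult_le_mono nat_mult_1)
    show ?case
    proof (intro exI[of _ "exp (real (\<kappa> * ?m)) * C"] conjI allI)
      fix k
      have "(2::real) ^ k * exp (Y (\<kappa> * ?m) k) = exp (real k * ln 2 + Y (\<kappa> * ?m) k)"
        by (simp add: exp_add exp_of_nat_mult)
      also have "\<dots> \<le> exp (Y ?m k + real (\<kappa> * ?m))"
        using Y_kappa[OF m'] by simp
      finally have *: "2 ^ k * exp (Y (\<kappa> * ?m) k) \<le> exp (real (\<kappa> * ?m)) * exp (Y ?m k)"
        by (simp add: exp_add mult.commute)
      have "2 ^ (Suc j * k) * exp (Y (\<kappa> ^ Suc j * m) k) = 2 ^ (j * k) * (2 ^ k * exp (Y (\<kappa> * ?m) k))"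
        by (simp add: power_add mult_ac)
      also have "\<dots> \<le> 2 ^ (j * k) * (exp (real (\<kappa> * ?m)) * exp (Y ?m k))"
        by (intro mult_left_mono *) simp
      also have "\<dots> \<le> exp (real (\<kappa> * ?m)) * (C * exp (Y m k))"
        using C(2)[of k] by (simp add: mult.left_commute)
      finally show "2 ^ (Suc j * k) * exp (Y (\<kappa> ^ Suc j * m) k) \<le> exp (real (\<kappa> * ?m)) * C * exp (Y m k)"
        by simp
    qed (use C in simp)
  qed
  with that show ?thesis by blast
qed

text \<open>Young's inequality at t = ln r. For r \<le> 1 that t may be negative and outside the
  range of the supremum, but there r ^ k \<le> 1.\<close>

lemma power_le_exp_Y:
  assumes "1 \<le> m" "0 \<le> r"
  shows "r ^ k \<le> exp (Y m k) * exp (real m * \<omega> r)"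
proof (cases "r \<le> 1")
  case True
  then have "r ^ k \<le> 1" using assms(2) by (rule power_le_one[rotated])
  also have "1 \<le> exp (Y m k) * exp (real m * \<omega> r)"
    unfolding exp_add[symmetric] using Y_nonneg[OF assms(1)] omega_nonneg[OF assms(2)] by simp
  finally show ?thesis .
next
  case False
  then have "r ^ k = exp (real k * ln r)" by (simp add: exp_of_nat_mult)
  also have "\<dots> \<le> exp (Y m k + real m * \<omega> r)"
    using Y_upper[OF assms(1), of "ln r" k] False by simp
  finally show ?thesis by (simp add: exp_add)
qed

text \<open>The supporting line of the convex function \<open>t \<mapsto> \<omega> (exp t)\<close> at \<open>ln r\<close> yields the optimal real
  exponent; rounding it down costs the additional factor \<open>r\<close>.\<close>
lemma exp_Y_le_power:
  assumes m: "1 \<le> m" and r: "1 \<le> r"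
  obtains k where "exp (Y m k) \<le> r ^ (k + 1) * exp (- real m * \<omega> r)"
proof -
  define s where "s = ln r"
  have s: "0 \<le> s" "r = exp s" using r unfolding s_def by auto
  obtain p where p: "\<And>t. \<omega> (exp s) + p * (t - s) \<le> \<omega> (exp t)"
     "\<And>t. t < s \<Longrightarrow> (\<omega> (exp s) - \<omega> (exp t)) / (s - t) \<le> p"
    using convex_on_supporting_slope[OF omega_convex, of s] by blast
  \<comment> \<open>A left slope of the increasing function is nonnegative, hence so is p; the
    rounding of m p to a natural number relies on this.\<close>
  have "0 \<le> (\<omega> (exp s) - \<omega> (exp (s - 1))) / (s - (s - 1))"
    by (simp add: omega_mono)
  also have "\<dots> \<le> p" by (rule p(2)) simp
  finally have p0: "0 \<le> real m * p" by simp
  define k where "k = nat \<lfloor>real m * p\<rfloor>"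
  have k: "real k \<le> real m * p" "real m * p \<le> real (k + 1)"
    unfolding k_def using p0 by (simp_all add: le_nat_floor) linarith
  have "Y m k \<le> real (k + 1) * s - real m * \<omega> (exp s)"
  proof (rule Y_least[OF m])
    fix t :: real assume t: "0 \<le> t"
    have "real m * (\<omega> (exp s) + p * (t - s)) \<le> real m * \<omega> (exp t)"
      by (intro mult_left_mono p) simp
    moreover have "real k * t \<le> real m * p * t" "real m * p * s \<le> real (k + 1) * s"
      by (intro mult_right_mono k t s)+
    ultimately show "real k * t - real m * \<omega> (exp t) \<le> real (k + 1) * s - real m * \<omega> (exp s)"
      by (simp add: algebra_simps)
  qed
  then have "exp (Y m k) \<le> exp (real (k + 1) * s - real m * \<omega> r)" using s by simp
  also have "\<dots> = r ^ (k + 1) * exp (- real m * \<omega> r)"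
    unfolding s(2) by (simp only: exp_of_nat_mult[symmetric] exp_add[symmetric]) simp
  finally show ?thesis by (rule that)
qed

section \<open>The Leibniz rule in the weighted norms\<close>

text \<open>One predicate for both scales of norms: r = n describes
  \<open>S_norm \<omega> m n\<close>, r = -n describes \<open>O_norm \<omega> m n\<close>, and r = 0
  is the unweighted bound. Lists of directions replace multi-indices.\<close>

definition dbound :: "nat \<Rightarrow> real \<Rightarrow> (real^'n::finite \<Rightarrow> complex) \<Rightarrow> real \<Rightarrow> bool" where
  "dbound m r f C \<longleftrightarrow>
    (\<forall>is x. norm (iter_partial is f x) \<le> C * exp (- r * \<omega> (norm x)) * exp (Y m (length is)))"

lemma dboundD:
  "dbound m r f C \<Longrightarrow> norm (iter_partial is f x) \<le> C * exp (- r * \<omega> (norm x)) * exp (Y m (length is))"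
  unfolding dbound_def by blast

lemma dbound_scaled_iff:
  "a \<le> C * exp (- r * w) * exp y \<longleftrightarrow> exp (r * w) * a * exp (- y) \<le> C"
  for a C r w y :: real
  by (simp add: exp_minus field_simps)

lemma dbound_iff_multi_partial:
  assumes "smooth f" "1 \<le> m"
  shows "dbound m r f C \<longleftrightarrow>
    (\<forall>\<alpha> x. exp (r * \<omega> (norm x)) * cmod (multi_partial \<alpha> f x) * young_factor \<omega> m (\<Sum>i\<in>UNIV. \<alpha> i) \<le> C)"
proof
  assume C: "dbound m r f C"
  show "\<forall>\<alpha> x. exp (r * \<omega> (norm x)) * cmod (multi_partial \<alpha> f x) * young_factor \<omega> m (\<Sum>i\<in>UNIV. \<alpha> i) \<le> C"
  proof (intro allI)
    fix \<alpha> x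
    obtain "is" where "multi_partial \<alpha> f = iter_partial is f" "(\<Sum>i\<in>UNIV. \<alpha> i) = length is"
      using multi_partial_list[OF assms(1)] by blast
    then show "exp (r * \<omega> (norm x)) * cmod (multi_partial \<alpha> f x) * young_factor \<omega> m (\<Sum>i\<in>UNIV. \<alpha> i) \<le> C"
      using dboundD[OF C, of "is" x] assms(2) by (simp only: young_factor_eq dbound_scaled_iff)
  qed
next
  assume *: "\<forall>\<alpha> x. exp (r * \<omega> (norm x)) * cmod (multi_partial \<alpha> f x) * young_factor \<omega> m (\<Sum>i\<in>UNIV. \<alpha> i) \<le> C"
  show "dbound m r f C"
    unfolding dbound_def
  proof (intro allI)
    fix "is" x
    show "norm (iter_partial is f x) \<le> C * exp (- r * \<omega> (norm x)) * exp (Y m (length is))"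
      using *[rule_format, where \<alpha> = "count_list is" and x = x] assms
      by (simp only: young_factor_eq dbound_scaled_iff multi_partial_count_list sum_count_list_UNIV)
  qed
qed

lemma S_norm_le_iff:
  assumes "smooth f" "1 \<le> m" "0 \<le> C"
  shows "S_norm \<omega> m n f \<le> ennreal C \<longleftrightarrow> dbound m (real n) f C"
  unfolding S_norm_def dbound_iff_multi_partial[OF assms(1,2)] SUP_le_iff
  using assms(3) by (simp add: ennreal_le_iff)

lemma O_norm_le_iff:
  assumes "smooth f" "1 \<le> m" "0 \<le> C"
  shows "O_norm \<omega> m n f \<le> ennreal C \<longleftrightarrow> dbound m (- real n) f C"
  unfolding O_norm_def dbound_iff_multi_partial[OF assms(1,2)] SUP_le_iff
  using assms(3) by (simp add: ennreal_le_iff mult_ac)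

lemma S_norm_finite_iff:
  assumes "smooth f" "1 \<le> m"
  shows "S_norm \<omega> m n f < \<infinity> \<longleftrightarrow> (\<exists>C\<ge>0. dbound m (real n) f C)"
proof
  assume "S_norm \<omega> m n f < \<infinity>"
  then have "S_norm \<omega> m n f \<le> ennreal (enn2real (S_norm \<omega> m n f))" by simp
  then have "dbound m (real n) f (enn2real (S_norm \<omega> m n f))"
    by (subst (asm) S_norm_le_iff[OF assms]) simp_all
  then show "\<exists>C\<ge>0. dbound m (real n) f C" using enn2real_nonneg by blast
next
  assume "\<exists>C\<ge>0. dbound m (real n) f C"
  then obtain C where "0 \<le> C" "dbound m (real n) f C" by blast
  then have "S_norm \<omega> m n f \<le> ennreal C" using S_norm_le_iff assms by blast
  then show "S_norm \<omega> m n f < \<infinity>" by (simp add: order_le_less_trans)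
qed

lemma O_norm_finite_iff:
  assumes "smooth f" "1 \<le> m"
  shows "O_norm \<omega> m n f < \<infinity> \<longleftrightarrow> (\<exists>C\<ge>0. dbound m (- real n) f C)"
proof
  assume "O_norm \<omega> m n f < \<infinity>"
  then have "O_norm \<omega> m n f \<le> ennreal (enn2real (O_norm \<omega> m n f))" by simp
  then have "dbound m (- real n) f (enn2real (O_norm \<omega> m n f))"
    by (subst (asm) O_norm_le_iff[OF assms]) simp_all
  then show "\<exists>C\<ge>0. dbound m (- real n) f C" using enn2real_nonneg by blast
next
  assume "\<exists>C\<ge>0. dbound m (- real n) f C"
  then obtain C where "0 \<le> C" "dbound m (- real n) f C" by blast
  then have "O_norm \<omega> m n f \<le> ennreal C" using O_norm_le_iff assms by blast
  then show "O_norm \<omega> m n f < \<infinity>" by (simp add: order_le_less_trans)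
qed

lemma dbound_nonneg: "dbound m r f C \<Longrightarrow> 0 \<le> C"
proof -
  assume "dbound m r f C"
  from dboundD[OF this, of "[]" 0] have "0 \<le> C * (exp (- r * \<omega> 0) * exp (Y m 0))"
    unfolding mult.assoc[symmetric] by (auto intro: order_trans[OF norm_ge_zero])
  moreover have "0 < exp (- r * \<omega> 0) * exp (Y m 0)" by simp
  ultimately show "0 \<le> C" by (meson mult_neg_pos not_le)
qed

lemma dbound_add:
  assumes "smooth f" "smooth g" "dbound m r f A" "dbound m r g B"
  shows "dbound m r (f + g) (A + B)"
  unfolding dbound_def
proof (intro allI)
  fix "is" x
  show "norm (iter_partial is (f + g) x) \<le> (A + B) * exp (- r * \<omega> (norm x)) * exp (Y m (length is))"
    using norm_triangle_ineq[of "iter_partial is f x" "iter_partial is g x"]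
      dboundD[OF assms(3), of "is" x] dboundD[OF assms(4), of "is" x]
    unfolding iter_partial_add[OF assms(1,2)] distrib_right plus_fun_apply by linarith
qed

lemma dbound_cmult:
  assumes "smooth f" "dbound m r f A"
  shows "dbound m r (\<lambda>x. c * f x) (norm c * A)"
  unfolding dbound_def iter_partial_cmult[OF assms(1)] norm_mult
  using dboundD[OF assms(2)] by (auto simp: mult.assoc intro!: mult_left_mono)

lemma dbound_mono:
  fixes f :: "real^'n::finite \<Rightarrow> complex"
  assumes "dbound m r f A" "1 \<le> m'" "m' \<le> m" "r' \<le> r" "A \<le> B"
  shows "dbound m' r' f B"
  unfolding dbound_def
proof (intro allI)
  fix "is" :: "'n list" and x :: "real^'n"
  have "A * exp (- r * \<omega> (norm x)) * exp (Y m (length is)) \<le> B * exp (- r' * \<omega> (norm x)) * exp (Y m' (length is))"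
    using dbound_nonneg[OF assms(1)] assms(2-5)
    by (intro mult_mono) (auto simp: Y_antimono mult_right_mono)
  with dboundD[OF assms(1), of "is" x]
  show "norm (iter_partial is f x) \<le> B * exp (- r' * \<omega> (norm x)) * exp (Y m' (length is))" by linarith
qed

text \<open>The Leibniz rule has \<open>2\<^sup>|\<^sup>i\<^sup>s\<^sup>|\<close> terms; the shifts \<open>p\<close> and \<open>q\<close> count the derivatives that have already
  been moved to \<open>u\<close> and \<open>v\<close>.\<close>
lemma leibniz_bound:
  fixes u v :: "real^'n::finite \<Rightarrow> complex"
  assumes M: "1 \<le> M" and "smooth u" "smooth v"
    and "\<And>is. norm (iter_partial is u x) \<le> A * exp (Y M (length is + p))"
    and "\<And>is. norm (iter_partial is v x) \<le> B * exp (Y M (length is + q))"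
  shows "norm (iter_partial is (u * v) x) \<le> 2 ^ length is * (A * B) * exp (Y M (length is + p + q))"
  using assms(2-)
\<comment> \<open>The innermost derivative is split off, so the product rule meets u * v itself and
  the induction hypothesis applies to each of the two products, with p or q raised by one.\<close>
proof (induction "is" arbitrary: u v p q rule: rev_induct)
  case Nil
  have A: "norm (u x) \<le> A * exp (Y M p)" and B: "norm (v x) \<le> B * exp (Y M q)"
    using Nil(3)[of "[]"] Nil(4)[of "[]"] by auto
  have A0: "0 \<le> A * exp (Y M p)" "0 \<le> B * exp (Y M q)"
    using A B by (auto intro: order_trans[OF norm_ge_zero])
  have "norm ((u * v) x) \<le> (A * exp (Y M p)) * (B * exp (Y M q))"
    using A B A0 by (simp add: norm_mult mult_mono)
  also have "\<dots> = (A * B) * exp (Y M p + Y M q)" by (simp add: exp_add)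
  also have "\<dots> \<le> (A * B) * exp (Y M (p + q))"
    using A0 Y_superadditive[OF M] by (intro mult_left_mono) (auto simp: zero_le_mult_iff)
  finally show ?case by simp
next
  case (snoc i "is")
  let ?E = "2 ^ length is * (A * B) * exp (Y M (length (is @ [i]) + p + q))"
  have shift: "norm (iter_partial js (partial i w) x) \<le> C * exp (Y M (length js + (a + 1)))"
    if "\<And>js. norm (iter_partial js w x) \<le> C * exp (Y M (length js + a))" for w C a js
    using that[of "js @ [i]"] by (simp add: iter_partial_append iter_partial_Cons)
  have "norm (iter_partial is (partial i u * v) x) \<le>
      2 ^ length is * (A * B) * exp (Y M (length is + (p + 1) + q))"
    by (rule snoc.IH[OF smooth_partial[OF snoc.prems(1)] snoc.prems(2) shift[OF snoc.prems(3)] snoc.prems(4)])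
  then have 1: "norm (iter_partial is (partial i u * v) x) \<le> ?E" by (simp add: add_ac)
  have "norm (iter_partial is (u * partial i v) x) \<le>
      2 ^ length is * (A * B) * exp (Y M (length is + p + (q + 1)))"
    by (rule snoc.IH[OF snoc.prems(1) smooth_partial[OF snoc.prems(2)] snoc.prems(3) shift[OF snoc.prems(4)]])
  then have 2: "norm (iter_partial is (u * partial i v) x) \<le> ?E" by (simp add: add_ac)
  have "iter_partial (is @ [i]) (u * v) = iter_partial is (partial i u * v) + iter_partial is (u * partial i v)"
    unfolding iter_partial_append iter_partial_Cons iter_partial_Nil
    by (simp only: partial_mult snoc.prems iter_partial_add smooth_mult smooth_partial)
  then have "norm (iter_partial (is @ [i]) (u * v) x) \<le> ?E + ?E"
    using 1 2 norm_triangle_ineq[of "iter_partial is (partial i u * v) x" "iter_partial is (u * partial i v) x"]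
    by (simp only: plus_fun_apply)
  also have "?E + ?E = 2 ^ length (is @ [i]) * (A * B) * exp (Y M (length (is @ [i]) + p + q))" by simp
  finally show ?case .
qed

text \<open>The factor 2 ^ |is| of \<open>leibniz_bound\<close> is absorbed by passing from
  \<open>\<kappa> * m\<close> to m. The constant depends on m alone, not on the functions or the
  exponents r and s; bounded sets of factors can therefore be treated uniformly.\<close>

lemma dbound_mult:
  assumes m: "1 \<le> m"
  shows "\<exists>C>0. \<forall>(u :: real^'n::finite \<Rightarrow> complex) v r s A B. smooth u \<and> smooth v \<and>
      dbound (\<kappa> * m) r u A \<and> dbound (\<kappa> * m) s v B \<longrightarrow> dbound m (r + s) (u * v) (C * (A * B))"
proof -
  let ?M = "\<kappa> * m"
  have M: "1 \<le> ?M" using mult_le_mono[OF kappa(1) m] by simp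
  obtain C where C: "0 < C" "\<And>k. 2 ^ (1 * k) * exp (Y (\<kappa> ^ 1 * m) k) \<le> C * exp (Y m k)"
    using power2_absorb[OF m] by blast
  have "dbound m (r + s) (u * v) (C * (A * B))"
    if uv: "smooth u" "smooth v" and u: "dbound ?M r u A" and v: "dbound ?M s v B"
    for u v :: "real^'n \<Rightarrow> complex" and r s A B
    unfolding dbound_def
  proof (intro allI)
    fix "is" :: "'n list" and x :: "real^'n"
    let ?r = "exp (- r * \<omega> (norm x))" and ?s = "exp (- s * \<omega> (norm x))"
    have "norm (iter_partial is (u * v) x) \<le>
        2 ^ length is * ((A * ?r) * (B * ?s)) * exp (Y ?M (length is + 0 + 0))"
      by (rule leibniz_bound[OF M uv]) (use dboundD[OF u] dboundD[OF v] in auto)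
    also have "\<dots> = (A * B) * (?r * ?s) * (2 ^ length is * exp (Y ?M (length is)))" by simp
    also have "\<dots> \<le> (A * B) * (?r * ?s) * (C * exp (Y m (length is)))"
      using C(2)[of "length is"] dbound_nonneg[OF u] dbound_nonneg[OF v]
      by (intro mult_left_mono) auto
    also have "?r * ?s = exp (- (r + s) * \<omega> (norm x))"
      by (simp add: exp_add[symmetric] algebra_simps)
    finally show "norm (iter_partial is (u * v) x) \<le>
        C * (A * B) * exp (- (r + s) * \<omega> (norm x)) * exp (Y m (length is))" by (simp only: mult_ac)
  qed
  with C(1) show ?thesis by blast
qed

text \<open>The functions with finite norms \<open>S_norm\<close>, described without the Fourier
  transform; \<open>S_set_eq_WS\<close> identifies them with \<open>S_set \<omega>\<close>.\<close>

definition WS :: "(real^'n::finite \<Rightarrow> complex) set" where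
  "WS = {f. smooth f \<and> (\<forall>m\<ge>1. \<forall>n::nat. \<exists>C. dbound m (real n) f C)}"

text \<open>Derivatives of order at least 2 vanish and the others are at most 1 + |x|, hence at most
  a multiple of exp \<omega>. Multiplication by coordinates arises when Fourier transforms are
  differentiated.\<close>

lemma dbound_coordinate:
  assumes m: "1 \<le> m"
  shows "\<exists>C. dbound m (-1) (\<lambda>x::real^'n::finite. complex_of_real (x $ j)) C"
proof -
  obtain C where C: "0 < C" "\<And>t. 0 \<le> t \<Longrightarrow> (1 + t) ^ 1 \<le> C * exp (\<omega> t)"
    using power_bound by blast
  have C': "1 + norm x \<le> C * exp (\<omega> (norm x))" for x :: "real^'n" using C(2)[of "norm x"] by simp
  have zero: "iter_partial (is @ [i, k]) (\<lambda>x::real^'n. complex_of_real (x $ j)) = (\<lambda>_. 0)" for "is" i k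
    by (induction "is") (simp_all add: iter_partial_Cons partial_coordinate)
  have "norm (iter_partial is (\<lambda>x. complex_of_real (x $ j)) x) \<le> C * exp (- (-1) * \<omega> (norm x)) * exp (Y m (length is))"
    for "is" and x :: "real^'n"
  proof -
    have "norm (iter_partial is (\<lambda>x. complex_of_real (x $ j)) x) \<le> 1 + norm x"
    proof (cases "is" rule: rev_cases)
      case Nil
      then show ?thesis using component_le_norm_cart[of x j] by simp
    next
      case (snoc ks k)
      then show ?thesis
      proof (cases ks rule: rev_cases)
        case Nil
        then show ?thesis using snoc by (simp add: iter_partial_Cons partial_coordinate)
      next
        case (snoc ls l)
        then have "is = ls @ [l, k]" using \<open>is = ks @ [k]\<close> by simp
        then show ?thesis by (simp only: zero) simp
      qed
    qed
    also have "\<dots> \<le> C * exp (\<omega> (norm x)) * 1" using C' by simp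
    also have "\<dots> \<le> C * exp (\<omega> (norm x)) * exp (Y m (length is))"
      using C(1) Y_nonneg[OF m] by (intro mult_left_mono) auto
    finally show ?thesis by simp
  qed
  then show ?thesis unfolding dbound_def by blast
qed

lemma WS_smooth: "f \<in> WS \<Longrightarrow> smooth f"
  by (simp add: WS_def)

lemma WS_cmult: "f \<in> WS \<Longrightarrow> (\<lambda>x. c * f x) \<in> WS"
  unfolding WS_def using dbound_cmult smooth_cmult by blast

lemma WS_add: "f \<in> WS \<Longrightarrow> g \<in> WS \<Longrightarrow> f + g \<in> WS"
  unfolding WS_def using dbound_add smooth_add by blast

lemma WS_mult:
  assumes g: "g \<in> WS" and f: "smooth f"
    and fb: "\<And>m. 1 \<le> m \<Longrightarrow> \<exists>(n::nat) C. dbound m (- real n) f C"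
  shows "f * g \<in> WS"
  unfolding WS_def
proof (intro CollectI conjI allI impI)
  show "smooth (f * g)" using f WS_smooth[OF g] by (rule smooth_mult)
  fix m n :: nat assume m: "1 \<le> m"
  obtain C where C: "\<forall>(u :: real^'a \<Rightarrow> complex) v r s A B. smooth u \<and> smooth v \<and>
      dbound (\<kappa> * m) r u A \<and> dbound (\<kappa> * m) s v B \<longrightarrow> dbound m (r + s) (u * v) (C * (A * B))"
    using dbound_mult[OF m] by blast
  have M: "1 \<le> \<kappa> * m" using mult_le_mono[OF kappa(1) m] by simp
  obtain k A where A: "dbound (\<kappa> * m) (- real k) f A" using fb[OF M] by blast
  \<comment> \<open>The growth exponent k of f depends on the index \<open>\<kappa> * m\<close>; g
    decays with every exponent, so n + k may be taken.\<close>
  obtain B where B: "dbound (\<kappa> * m) (real (n + k)) g B" using g M unfolding WS_def by blast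
  have "dbound m (- real k + real (n + k)) (f * g) (C * (A * B))"
    using C f WS_smooth[OF g] A B by blast
  moreover have "- real k + real (n + k) = real n" by simp
  ultimately show "\<exists>C. dbound m (real n) (f * g) C" by auto
qed

lemma WS_coordinate_mult:
  assumes "f \<in> WS"
  shows "(\<lambda>x. - \<i> * of_real (x $ j) * f x) \<in> WS"
proof -
  have "(\<lambda>x. complex_of_real (x $ j)) * f \<in> WS"
  proof (rule WS_mult[OF assms smooth_coordinate])
    show "\<exists>(n::nat) C. dbound m (- real n) (\<lambda>x::real^'a. complex_of_real (x $ j)) C" if "1 \<le> m" for m
      by (rule exI[of _ 1]) (simp only: of_nat_1 dbound_coordinate[OF that])
  qed
  from WS_cmult[OF this, of "- \<i>"] show ?thesis by (simp only: times_fun_apply mult.assoc)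
qed

lemma integrable_decay:
  fixes f :: "real^'n::finite \<Rightarrow> complex"
  assumes "continuous_on UNIV f" "\<And>x. norm (f x) \<le> C * exp (- \<omega> (norm x))"
  shows "integrable lborel f"
    "(\<integral>x. norm (f x) \<partial>lborel) \<le> C * (\<integral>(x::real^'n). exp (- \<omega> (norm x)) \<partial>lborel)"
proof -
  have i: "integrable lborel (\<lambda>x::real^'n. C * exp (- \<omega> (norm x)))"
    by (intro integrable_mult_right integrable_exp_omega)
  show f: "integrable lborel f"
  proof (rule Bochner_Integration.integrable_bound[OF i])
    show "AE x in lborel. norm (f x) \<le> norm (C * exp (- \<omega> (norm x)))"
    proof (rule AE_I2)
      fix x
      have "norm (f x) \<le> C * exp (- \<omega> (norm x))" by (rule assms(2))
      also have "\<dots> \<le> norm \<dots>" by simp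
      finally show "norm (f x) \<le> norm (C * exp (- \<omega> (norm x)))" .
    qed
  qed (rule continuous_borel[OF assms(1)])
  have "(\<integral>x. norm (f x) \<partial>lborel) \<le> (\<integral>(x::real^'n). C * exp (- \<omega> (norm x)) \<partial>lborel)"
    by (intro integral_mono integrable_norm f i assms(2))
  then show "(\<integral>x. norm (f x) \<partial>lborel) \<le> C * (\<integral>(x::real^'n). exp (- \<omega> (norm x)) \<partial>lborel)" by simp
qed

lemma fourier_iter_partial:
  fixes f :: "real^'n::finite \<Rightarrow> complex"
  assumes f: "smooth f" and int: "\<And>is. integrable lborel (iter_partial is f)"
  shows "fourier (iter_partial is f) \<xi> = (\<Prod>i\<leftarrow>is. \<i> * of_real (\<xi> $ i)) * fourier f \<xi>"
proof (induction "is")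
  case (Cons i "is")
  have "fourier (partial i (iter_partial is f)) \<xi> = \<i> * of_real (axis i 1 \<bullet> \<xi>) * fourier (iter_partial is f) \<xi>"
  proof (rule fourier_derivative)
    show "integrable lborel (iter_partial is f)" "integrable lborel (partial i (iter_partial is f))"
      using int[of "is"] int[of "i # is"] by (auto simp: iter_partial_Cons)
    have s: "smooth (iter_partial is f)" using f by (rule smooth_iter_partial)
    show "continuous_on UNIV (iter_partial is f)" using s by (rule smooth_continuous)
    show "continuous_on UNIV (partial i (iter_partial is f))" using smooth_partial[OF s] by (rule smooth_continuous)
    show "((\<lambda>t. iter_partial is f (x + t *\<^sub>R axis i 1)) has_vector_derivative
        partial i (iter_partial is f) (x + a *\<^sub>R axis i 1)) (at a)" for x a
      using s by (rule smooth_has_partial)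
  qed
  with Cons show ?case by (simp add: iter_partial_Cons inner_axis' mult.assoc)
qed simp

lemma norm_prod_list_coordinates: "norm (\<Prod>i\<leftarrow>is. \<i> * complex_of_real (\<xi> $ i)) \<le> norm \<xi> ^ length is"
  for \<xi> :: "real^'n::finite"
  by (induction "is") (auto simp: norm_mult intro!: mult_mono component_le_norm_cart)

section \<open>Fourier characterization of the space S\<close>

lemma S_setD:
  fixes f :: "real^'n::finite \<Rightarrow> complex"
  assumes "f \<in> S_set \<omega>"
  shows "smooth f" "integrable lborel f" "smooth (fourier f)"
    "0 < l \<Longrightarrow> \<exists>C. \<forall>x. norm (iter_partial is f x) \<le> C * exp (- l * \<omega> (norm x))"
    "0 < l \<Longrightarrow> \<exists>C. \<forall>x. norm (fourier f x) \<le> C * exp (- l * \<omega> (norm x))"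
proof -
  show f: "smooth f" "integrable lborel f" "smooth (fourier f)"
    using assms unfolding S_set_def by auto
  have *: "\<exists>C. \<forall>x. norm (iter_partial is g x) \<le> C * exp (- l * \<omega> (norm x))"
    if g: "smooth g"
      and bdd: "\<And>\<alpha>. bdd_above (range (\<lambda>x. exp (l * \<omega> (norm x)) * cmod (multi_partial \<alpha> g x)))"
    for g :: "real^'n \<Rightarrow> complex" and l "is"
  proof -
    obtain C where C: "\<And>x. exp (l * \<omega> (norm x)) * cmod (multi_partial (count_list is) g x) \<le> C"
      using bdd[of "count_list is"] unfolding bdd_above_def by auto
    have "norm (iter_partial is g x) \<le> C * exp (- l * \<omega> (norm x))" for x
      using C[of x] unfolding multi_partial_count_list[OF g]
      by (simp add: exp_minus field_simps)
    then show ?thesis by blast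
  qed
  show "0 < l \<Longrightarrow> \<exists>C. \<forall>x. norm (iter_partial is f x) \<le> C * exp (- l * \<omega> (norm x))"
    using assms by (intro * f) (simp add: S_set_def)
  show "0 < l \<Longrightarrow> \<exists>C. \<forall>x. norm (fourier f x) \<le> C * exp (- l * \<omega> (norm x))"
    using assms *[OF f(3), of l "[]"] by (simp add: S_set_def)
qed

text \<open>The transform of the derivative is the transform of f times a monomial, and |\<xi>| ^ k
  \<le> exp (Y m k) exp (m \<omega> |\<xi>|) for k = |is|. Decay of \<open>fourier f\<close> with
  exponent m + 1 absorbs the second factor and leaves the integrable exp (- \<omega>).\<close>

lemma S_set_unweighted_bound:
  fixes f :: "real^'n::finite \<Rightarrow> complex"
  assumes f: "f \<in> S_set \<omega>" and m: "1 \<le> m"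
  shows "\<exists>C. dbound m 0 f C"
proof -
  note fD = S_setD[OF f]
  let ?I = "\<integral>(x::real^'n). exp (- \<omega> (norm x)) \<partial>lborel"
  let ?c = "gauss_const TYPE('n)"
  obtain C where C: "\<And>x. norm (fourier f x) \<le> C * exp (- (real m + 1) * \<omega> (norm x))"
    using fD(5)[of "real m + 1"] by auto
  have C0: "0 \<le> C" using C[of 0] omega_eq_0[of 0] by (auto intro: order_trans[OF norm_ge_zero])
  have int: "integrable lborel (iter_partial is f)" for "is"
  proof -
    obtain B where "\<And>x. norm (iter_partial is f x) \<le> B * exp (- 1 * \<omega> (norm x))"
      using fD(4)[of 1 "is"] by auto
    then show ?thesis
      by (intro integrable_decay(1) smooth_continuous smooth_iter_partial fD(1)) simp
  qed
  have "norm (iter_partial is f x) \<le> C * ?I / ?c\<^sup>2 * exp (- 0 * \<omega> (norm x)) * exp (Y m (length is))" for "is" x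
  proof -
    let ?E = "exp (Y m (length is))"
    obtain B where B: "\<And>x. norm (iter_partial is f x) \<le> B * exp (- 1 * \<omega> (norm x))"
      using fD(4)[of 1 "is"] by auto
    have B0: "0 \<le> B" using B[of 0] omega_eq_0[of 0] by (auto intro: order_trans[OF norm_ge_zero])
    have Bx: "norm (iter_partial is f x) \<le> B" for x
      using B[of x] mult_left_mono[OF _ B0, of "exp (- 1 * \<omega> (norm x))" 1] by simp
    have F: "norm (fourier (iter_partial is f) \<xi>) \<le> (C * ?E) * exp (- \<omega> (norm \<xi>))" for \<xi>
    proof -
      have "norm (fourier (iter_partial is f) \<xi>) =
          norm (\<Prod>i\<leftarrow>is. \<i> * complex_of_real (\<xi> $ i)) * norm (fourier f \<xi>)"
        unfolding fourier_iter_partial[OF fD(1) int] norm_mult ..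
      also have "\<dots> \<le> norm \<xi> ^ length is * (C * exp (- (real m + 1) * \<omega> (norm \<xi>)))"
        using C C0 by (intro mult_mono norm_prod_list_coordinates) auto
      also have "\<dots> \<le> (?E * exp (real m * \<omega> (norm \<xi>))) * (C * exp (- (real m + 1) * \<omega> (norm \<xi>)))"
        using C0 by (intro mult_right_mono power_le_exp_Y m) auto
      also have "\<dots> = (C * ?E) * (exp (real m * \<omega> (norm \<xi>)) * exp (- (real m + 1) * \<omega> (norm \<xi>)))"
        by (simp only: mult_ac)
      also have "exp (real m * \<omega> (norm \<xi>)) * exp (- (real m + 1) * \<omega> (norm \<xi>)) = exp (- \<omega> (norm \<xi>))"
        unfolding exp_add[symmetric] by (simp add: algebra_simps)
      finally show ?thesis .
    qed
    have cF: "continuous_on UNIV (fourier (iter_partial is f))" by (rule continuous_fourier[OF int])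
    have "?c\<^sup>2 * norm (iter_partial is f x) \<le> (\<integral>\<xi>. norm (fourier (iter_partial is f) \<xi>) \<partial>lborel)"
      by (rule norm_le_integral_fourier[OF int _ Bx integrable_decay(1)[OF cF F]])
        (rule smooth_continuous[OF smooth_iter_partial[OF fD(1)]])
    also have "\<dots> \<le> (C * ?E) * ?I" by (rule integrable_decay(2)[OF cF F])
    finally have "norm (iter_partial is f x) \<le> (C * ?E) * ?I / ?c\<^sup>2"
      using gauss_const_pos[where 'n = 'n] by (simp add: pos_le_divide_eq mult.commute)
    then show ?thesis by (simp add: mult_ac)
  qed
  then show ?thesis unfolding dbound_def by blast
qed

lemma interpolated_derivative_bound:
  fixes g :: "real^'n::finite \<Rightarrow> complex"
  assumes g: "smooth g" and bdd: "\<And>is. \<exists>B. \<forall>x. norm (iter_partial is g x) \<le> B"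
    and M0: "0 < M0" "\<And>y. norm x \<le> norm y \<Longrightarrow> norm (g y) \<le> M0"
    and M2: "0 < M2" "\<And>y. norm (iter_partial (replicate (2 * k) v) g y) \<le> M2"
  shows "norm (iter_partial (replicate k v) g x) \<le> 2 * 16 ^ k * sqrt (M0 * M2)"
proof -
  \<comment> \<open>With this sign the modulus of the v-th coordinate grows along the half line,
    which thus stays outside the ball of radius |x|, where \<open>M0\<close> applies. The factor
    \<sigma> ^ j in \<open>F\<close> comes from differentiating in the direction \<sigma> times the
    v-th unit vector.\<close>
  define \<sigma> :: real where "\<sigma> = (if 0 \<le> x $ v then 1 else - 1)"
  have \<sigma>: "\<bar>\<sigma>\<bar> = 1" by (simp add: \<sigma>_def)
  define d where "d j = iter_partial (replicate j v) g" for j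
  have sd: "smooth (d j)" for j unfolding d_def by (rule smooth_iter_partial[OF g])
  define F where "F j t = of_real (\<sigma> ^ j) * d j (x + (\<sigma> * t) *\<^sub>R axis v 1)" for j t
  have nF: "norm (F j t) = norm (d j (x + (\<sigma> * t) *\<^sub>R axis v 1))" for j t
    unfolding F_def norm_mult norm_of_real power_abs \<sigma> by simp
  have away: "norm x \<le> norm (x + (\<sigma> * t) *\<^sub>R axis v 1)" if "0 \<le> t" for t
  proof (rule norm_le_componentwise_cart)
    fix i show "norm (x $ i) \<le> norm ((x + (\<sigma> * t) *\<^sub>R axis v 1) $ i)"
      using that by (auto simp: \<sigma>_def axis_def)
  qed
  have "norm (F k 0) \<le> 2 * 16 ^ k * sqrt (M0 * M2)"
  proof (rule intermediate_derivative)
    fix j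
    obtain B where B: "\<And>x. norm (d j x) \<le> B" using bdd unfolding d_def by blast
    have "continuous_on UNIV (F j)"
      unfolding F_def by (intro continuous_intros continuous_on_compose2[OF smooth_continuous[OF sd]]) auto
    then show "cont_bounded (F j)" unfolding cont_bounded_def nF using B by blast
    show "(F j has_vector_derivative F (Suc j) t) (at t)" for t
    proof -
      have 1: "((\<lambda>t. d j (x + t *\<^sub>R axis v 1)) has_vector_derivative
          partial v (d j) (x + (\<sigma> * t) *\<^sub>R axis v 1)) (at (\<sigma> * t))"
        by (rule smooth_has_partial[OF sd])
      have "((\<lambda>t. d j (x + t *\<^sub>R axis v 1)) \<circ> (\<lambda>t. \<sigma> * t) has_vector_derivative
          \<sigma> *\<^sub>R partial v (d j) (x + (\<sigma> * t) *\<^sub>R axis v 1)) (at t)"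
        by (rule vector_diff_chain_at[where f = "\<lambda>t. \<sigma> * t", OF _ 1]) (auto intro!: derivative_eq_intros)
      from has_vector_derivative_mult_right[OF this, of "of_real (\<sigma> ^ j)"]
      show ?thesis
        unfolding F_def o_def by (simp add: d_def iter_partial_Cons scaleR_conv_of_real mult_ac)
    qed
  next
    show "norm (F 0 t) \<le> M0" if "0 \<le> t" for t
      unfolding nF using M0(2)[OF away[OF that]] by (simp add: d_def)
    show "norm (F (2 * k) t) \<le> M2" for t
      unfolding nF d_def by (rule M2)
  qed (rule M0 M2)+
  then show ?thesis unfolding nF by (simp add: d_def)
qed

lemma mset_replicate_filter: "mset (replicate (count_list is v) v @ filter ((\<noteq>) v) is) = mset is"
  by (induction "is") auto

lemma weighted_bound_coordinates:
  fixes f :: "real^'n::finite \<Rightarrow> complex"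
  assumes f: "smooth f" and ub: "\<And>m. 1 \<le> m \<Longrightarrow> \<exists>C. dbound m 0 f C"
    and decay: "\<And>n::nat. \<exists>C. \<forall>x. norm (f x) \<le> C * exp (- real n * \<omega> (norm x))"
    and "finite V" and m: "1 \<le> m"
  shows "\<exists>C>0. \<forall>is x. set is \<subseteq> V \<longrightarrow>
    norm (iter_partial is f x) \<le> C * exp (- real n * \<omega> (norm x)) * exp (Y m (length is))"
  using assms(4) m
proof (induction V arbitrary: m n rule: finite_induct)
  case empty
  obtain C where "\<And>x. norm (f x) \<le> C * exp (- real n * \<omega> (norm x))" using decay by blast
  moreover have "C * exp (- real n * \<omega> (norm x)) \<le> (\<bar>C\<bar> + 1) * exp (- real n * \<omega> (norm x))" for x :: "real^'n"
    by (intro mult_right_mono) auto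
  ultimately have "norm (f x) \<le> (\<bar>C\<bar> + 1) * exp (- real n * \<omega> (norm x))" for x by (meson order_trans)
  then show ?case using empty by (intro exI[of _ "\<bar>C\<bar> + 1"]) (auto simp: Y_zero)
next
  case (insert v V)
  \<comment> \<open>The exponent 4 pays for the factor 16 ^ k = 2 ^ (4 * k) of the interpolation;
    the ingredients are then taken at index 2 * m' because of the square root.\<close>
  define m' where "m' = \<kappa> ^ 4 * m"
  have "1 \<le> \<kappa> ^ 4" using kappa(1) by (rule one_le_power)
  then have m': "1 \<le> m'" "1 \<le> 2 * m'"
    unfolding m'_def using mult_le_mono[OF \<open>1 \<le> \<kappa> ^ 4\<close> insert.prems] by auto
  obtain C where C: "0 < C" "\<And>k. 2 ^ (4 * k) * exp (Y m' k) \<le> C * exp (Y m k)"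
    unfolding m'_def using power2_absorb[OF insert.prems, of 4] by blast
  obtain C1 where C1: "0 < C1" "\<And>is x. set is \<subseteq> V \<Longrightarrow> norm (iter_partial is f x) \<le>
      C1 * exp (- real (2 * n) * \<omega> (norm x)) * exp (Y (2 * m') (length is))"
    using insert.IH[OF m'(2), of "2 * n"] by blast
  obtain C2' where C2': "dbound (2 * m') 0 f C2'" using ub[OF m'(2)] by blast
  \<comment> \<open>The interpolation inequality requires positive bounds, and \<open>C2'\<close>
    may be 0.\<close>
  define C2 where "C2 = C2' + 1"
  have C2: "0 < C2" "norm (iter_partial is f x) \<le> C2 * exp (Y (2 * m') (length is))" for "is" x
  proof -
    show "0 < C2" using dbound_nonneg[OF C2'] unfolding C2_def by simp
    have "C2' * exp (Y (2 * m') (length is)) \<le> C2 * exp (Y (2 * m') (length is))"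
      unfolding C2_def by (intro mult_right_mono) auto
    moreover have "norm (iter_partial is f x) \<le> C2' * exp (Y (2 * m') (length is))"
      using dboundD[OF C2', of "is" x] by simp
    ultimately show "norm (iter_partial is f x) \<le> C2 * exp (Y (2 * m') (length is))" by linarith
  qed
  show ?case
  proof (intro exI[of _ "2 * sqrt (C1 * C2) * C"] conjI allI impI)
    show "0 < 2 * sqrt (C1 * C2) * C" using C C1 C2 by simp
    fix "is" :: "'n list" and x :: "real^'n" assume "is": "set is \<subseteq> insert v V"
    define k where "k = count_list is v"
    define js where "js = filter ((\<noteq>) v) is"
    let ?l = "length js"
    have ms: "mset (replicate k v @ js) = mset is"
      unfolding k_def js_def by (rule mset_replicate_filter)
    then have len: "length is = k + ?l" by (metis length_append length_replicate mset_eq_length)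
    have js: "set js \<subseteq> V" using "is" unfolding js_def by auto
    define g where "g = iter_partial js f"
    have gk: "iter_partial (replicate j v) g = iter_partial (replicate j v @ js) f" for j
      unfolding g_def iter_partial_append ..
    have eq: "iter_partial is f = iter_partial (replicate k v) g"
      unfolding gk by (rule iter_partial_mset_cong[OF f ms[symmetric]])
    define M0 where "M0 = C1 * exp (- real (2 * n) * \<omega> (norm x)) * exp (Y (2 * m') ?l)"
    define M2 where "M2 = C2 * exp (Y (2 * m') (2 * k + ?l))"
    have "norm (iter_partial (replicate k v) g x) \<le> 2 * 16 ^ k * sqrt (M0 * M2)"
    proof (rule interpolated_derivative_bound)
      show "smooth g" unfolding g_def by (rule smooth_iter_partial[OF f])
      show "\<exists>B. \<forall>x. norm (iter_partial is g x) \<le> B" for "is"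
        unfolding g_def iter_partial_append[symmetric] using C2(2) by blast
      show "0 < M0" "0 < M2" unfolding M0_def M2_def using C1 C2 by auto
      show "norm (iter_partial (replicate (2 * k) v) g y) \<le> M2" for y
        unfolding gk M2_def using C2(2)[of "replicate (2 * k) v @ js" y] by simp
      fix y :: "real^'n" assume y: "norm x \<le> norm y"
      have "norm (g y) \<le> C1 * exp (- real (2 * n) * \<omega> (norm y)) * exp (Y (2 * m') ?l)"
        unfolding g_def by (rule C1(2)[OF js])
      also have "\<dots> \<le> M0"
        unfolding M0_def using C1(1) omega_mono[OF norm_ge_zero y]
        by (intro mult_right_mono mult_left_mono) (auto intro: mult_left_mono)
      finally show "norm (g y) \<le> M0" .
    qed
    also have "sqrt (M0 * M2) \<le> sqrt (C1 * C2) * (exp (- real n * \<omega> (norm x)) * exp (Y m' (length is)))"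
    proof (rule real_le_lsqrt)
      have "Y (2 * m') ?l + Y (2 * m') (2 * k + ?l) \<le> Y (2 * m') (2 * (k + ?l))"
        using Y_superadditive[OF m'(2), of ?l "2 * k + ?l"] by (simp add: algebra_simps)
      also have "\<dots> = 2 * Y m' (length is)" unfolding Y_double[OF m'(1)] len ..
      finally have *: "Y (2 * m') ?l + Y (2 * m') (2 * k + ?l) \<le> 2 * Y m' (length is)" .
      have "M0 * M2 = C1 * C2 * exp (- real (2 * n) * \<omega> (norm x) + (Y (2 * m') ?l + Y (2 * m') (2 * k + ?l)))"
        unfolding M0_def M2_def exp_add by (simp only: mult_ac)
      also have "\<dots> \<le> C1 * C2 * exp (- real (2 * n) * \<omega> (norm x) + 2 * Y m' (length is))"
        using C1 C2 * by (intro mult_left_mono) auto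
      also have "\<dots> = (sqrt (C1 * C2))\<^sup>2 * exp (2 * (- real n * \<omega> (norm x) + Y m' (length is)))"
        using C1 C2 by (simp add: algebra_simps)
      also have "\<dots> = (sqrt (C1 * C2) * (exp (- real n * \<omega> (norm x)) * exp (Y m' (length is))))\<^sup>2"
        unfolding exp_double exp_add power_mult_distrib ..
      finally show "M0 * M2 \<le> (sqrt (C1 * C2) * (exp (- real n * \<omega> (norm x)) * exp (Y m' (length is))))\<^sup>2" .
      show "0 \<le> sqrt (C1 * C2) * (exp (- real n * \<omega> (norm x)) * exp (Y m' (length is)))"
        using C1 C2 by simp
    qed
    finally have "norm (iter_partial is f x) \<le>
        2 * 16 ^ k * (sqrt (C1 * C2) * (exp (- real n * \<omega> (norm x)) * exp (Y m' (length is))))"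
      unfolding eq by simp
    also have "\<dots> = 2 * sqrt (C1 * C2) * exp (- real n * \<omega> (norm x)) * (16 ^ k * exp (Y m' (length is)))"
      by (simp only: mult_ac)
    also have "\<dots> \<le> 2 * sqrt (C1 * C2) * exp (- real n * \<omega> (norm x)) * (C * exp (Y m (length is)))"
    proof (rule mult_left_mono)
      have "(16::real) ^ k \<le> 16 ^ length is" unfolding len by (intro power_increasing) auto
      also have "\<dots> = 2 ^ (4 * length is)" unfolding power_mult by simp
      finally have "(16::real) ^ k * exp (Y m' (length is)) \<le> 2 ^ (4 * length is) * exp (Y m' (length is))"
        by (rule mult_right_mono) simp
      with C(2)[of "length is"] show "16 ^ k * exp (Y m' (length is)) \<le> C * exp (Y m (length is))" by linarith
      show "0 \<le> 2 * sqrt (C1 * C2) * exp (- real n * \<omega> (norm x))" using C1 C2 by simp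
    qed
    also have "\<dots> = 2 * sqrt (C1 * C2) * C * exp (- real n * \<omega> (norm x)) * exp (Y m (length is))"
      by (simp only: mult_ac)
    finally show "norm (iter_partial is f x) \<le>
        2 * sqrt (C1 * C2) * C * exp (- real n * \<omega> (norm x)) * exp (Y m (length is))" .
  qed
qed

lemma S_set_subset_WS: "S_set \<omega> \<subseteq> (WS :: (real^'n::finite \<Rightarrow> complex) set)"
proof
  fix f :: "real^'n \<Rightarrow> complex" assume f: "f \<in> S_set \<omega>"
  show "f \<in> WS"
    unfolding WS_def
  proof (intro CollectI conjI allI impI)
    show sf: "smooth f" by (rule S_setD(1)[OF f])
    fix m n :: nat assume m: "1 \<le> m"
    have decay: "\<exists>C. \<forall>x. norm (f x) \<le> C * exp (- real n * \<omega> (norm x))" for n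
    proof -
      obtain C where C: "\<And>x. norm (f x) \<le> C * exp (- (real n + 1) * \<omega> (norm x))"
        using S_setD(4)[OF f, of "real n + 1" "[]"] by auto
      have "0 \<le> C" using C[of 0] omega_eq_0[of 0] by (auto intro: order_trans[OF norm_ge_zero])
      then have "C * exp (- (real n + 1) * \<omega> (norm x)) \<le> C * exp (- real n * \<omega> (norm x))" for x :: "real^'n"
        by (intro mult_left_mono) (auto simp: algebra_simps)
      with C show ?thesis by (meson order_trans)
    qed
    show "\<exists>C. dbound m (real n) f C"
      using weighted_bound_coordinates[OF sf S_set_unweighted_bound[OF f] decay finite m, of UNIV n]
      unfolding dbound_def by auto
  qed
qed

section \<open>Decay of the Fourier transforms of functions in \<open>WS\<close>\<close>

lemma omega_scale:
  obtains A where "0 \<le> A" "\<And>t. 0 \<le> t \<Longrightarrow> \<omega> (real n * t) \<le> A * (1 + \<omega> t)"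
proof -
  have "\<exists>A\<ge>0. \<forall>t\<ge>0. \<omega> (2 ^ j * t) \<le> A * (1 + \<omega> t)" for j
  proof (induction j)
    case 0
    show ?case by (intro exI[of _ 1]) (auto simp: omega_nonneg)
  next
    case (Suc j)
    then obtain A where A: "0 \<le> A" "\<And>t. 0 \<le> t \<Longrightarrow> \<omega> (2 ^ j * t) \<le> A * (1 + \<omega> t)" by blast
    show ?case
    proof (intro exI[of _ "real \<kappa> * (1 + A)"] conjI allI impI)
      fix t :: real assume t: "0 \<le> t"
      have "\<omega> (2 * (2 ^ j * t)) \<le> real \<kappa> * (1 + \<omega> (2 ^ j * t))" using t by (intro kappa) auto
      also have "\<dots> \<le> real \<kappa> * ((1 + A) * (1 + \<omega> t))"
        using A(2)[OF t] omega_nonneg[OF t] by (intro mult_left_mono) (auto simp: algebra_simps)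
      finally show "\<omega> (2 ^ Suc j * t) \<le> real \<kappa> * (1 + A) * (1 + \<omega> t)" by (simp add: mult.assoc)
    qed (use A in simp)
  qed
  then obtain A where A: "0 \<le> A" "\<And>t. 0 \<le> t \<Longrightarrow> \<omega> (2 ^ n * t) \<le> A * (1 + \<omega> t)" by blast
  have "\<omega> (real n * t) \<le> A * (1 + \<omega> t)" if t: "0 \<le> t" for t
  proof -
    have "real n \<le> 2 ^ n" using of_nat_mono[OF less_imp_le[OF less_exp[of n]], where 'a = real] by simp
    then have "\<omega> (real n * t) \<le> \<omega> (2 ^ n * t)" using t by (intro omega_mono mult_right_mono) auto
    also have "\<dots> \<le> A * (1 + \<omega> t)" by (rule A(2)[OF t])
    finally show ?thesis .
  qed
  with A(1) that show ?thesis by blast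
qed

lemma WS_decay:
  fixes u :: "real^'n::finite \<Rightarrow> complex"
  assumes "u \<in> WS"
  obtains C where "0 \<le> C" "\<And>x. norm (iter_partial is u x) \<le> C * exp (- real n * \<omega> (norm x))"
proof -
  obtain C where C: "dbound 1 (real n) u C" using assms unfolding WS_def by blast
  show ?thesis
  proof
    show "0 \<le> C * exp (Y 1 (length is))" using dbound_nonneg[OF C] by simp
    show "norm (iter_partial is u x) \<le> C * exp (Y 1 (length is)) * exp (- real n * \<omega> (norm x))" for x
      using dboundD[OF C, of "is" x] by (simp add: mult_ac)
  qed
qed

lemma WS_integrable:
  fixes u :: "real^'n::finite \<Rightarrow> complex"
  assumes "u \<in> WS"
  shows "integrable lborel (iter_partial is u)" "integrable lborel (\<lambda>x. norm x * norm (u x))"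
proof -
  have c: "continuous_on UNIV (iter_partial is u)" for "is"
    by (intro smooth_continuous smooth_iter_partial WS_smooth assms)
  obtain C where C: "\<And>x. norm (iter_partial is u x) \<le> C * exp (- real 1 * \<omega> (norm x))"
    using WS_decay[OF assms] by metis
  show "integrable lborel (iter_partial is u)"
    using C by (intro integrable_decay(1)[OF c]) simp
  obtain D where D: "0 \<le> D" "\<And>x. norm (iter_partial [] u x) \<le> D * exp (- real 2 * \<omega> (norm x))"
    using WS_decay[OF assms] by metis
  obtain B where B: "0 < B" "\<And>t. 0 \<le> t \<Longrightarrow> (1 + t) ^ 1 \<le> B * exp (\<omega> t)"
    using power_bound by blast
  have cu: "continuous_on UNIV u" using c[of "[]"] by simp
  have "integrable lborel (\<lambda>x. of_real (norm x) * u x)"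
  proof (rule integrable_decay(1))
    show "continuous_on UNIV (\<lambda>x. of_real (norm x) * u x)"
      by (intro continuous_intros cu)
    fix x :: "real^'n"
    have "norm x \<le> B * exp (\<omega> (norm x))" using B(2)[of "norm x"] by simp
    then have "norm x * norm (u x) \<le> (B * exp (\<omega> (norm x))) * (D * exp (- real 2 * \<omega> (norm x)))"
      using D(2)[of x] B(1) by (intro mult_mono) auto
    also have "\<dots> = B * D * (exp (\<omega> (norm x)) * exp (- real 2 * \<omega> (norm x)))" by (simp only: mult_ac)
    also have "exp (\<omega> (norm x)) * exp (- real 2 * \<omega> (norm x)) = exp (- \<omega> (norm x))"
      unfolding exp_add[symmetric] by simp
    finally show "norm (of_real (norm x) * u x) \<le> B * D * exp (- \<omega> (norm x))"
      by (simp add: norm_mult)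
  qed
  from integrable_norm[OF this] show "integrable lborel (\<lambda>x. norm x * norm (u x))"
    by (simp add: norm_mult)
qed

lemma fourier_WS_has_partial:
  fixes u :: "real^'n::finite \<Rightarrow> complex"
  assumes "u \<in> WS"
  shows "((\<lambda>t. fourier u (x + t *\<^sub>R axis i 1)) has_vector_derivative
    fourier (\<lambda>x. - \<i> * of_real (x $ i) * u x) x) (at 0)"
  using fourier_has_vector_derivative[of u x "axis i 1" 0] WS_integrable[OF assms] WS_integrable(1)[OF assms, of "[]"]
  by (simp add: inner_axis)

lemma smooth_fourier_WS:
  fixes u :: "real^'n::finite \<Rightarrow> complex"
  assumes "u \<in> WS"
  shows "smooth (fourier u)"
proof (rule smooth_coinduct[where A = "fourier ` WS"])
  fix f :: "real^'n \<Rightarrow> complex" assume "f \<in> fourier ` WS"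
  then obtain u where u: "u \<in> WS" "f = fourier u" by blast
  show "continuous_on UNIV f"
    unfolding u(2) using WS_integrable(1)[OF u(1), of "[]"] by (intro continuous_fourier) simp
  show "\<exists>g\<in>fourier ` WS. \<forall>x. ((\<lambda>t. f (x + t *\<^sub>R axis i 1)) has_vector_derivative g x) (at 0)" for i
    unfolding u(2)
    by (intro bexI[of _ "fourier (\<lambda>x. - \<i> * of_real (x $ i) * u x)"] allI fourier_WS_has_partial u imageI WS_coordinate_mult)
qed (use assms in blast)

text \<open>Derivatives of the transform are transforms of functions in \<open>WS\<close> again, so
  decay has to be proved for undifferentiated transforms only.\<close>

lemma iter_partial_fourier_WS:
  fixes u :: "real^'n::finite \<Rightarrow> complex"
  assumes "u \<in> WS"
  shows "iter_partial is (fourier u) \<in> fourier ` WS"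
proof (induction "is")
  case Nil
  then show ?case using assms by simp
next
  case (Cons i "is")
  then obtain w where w: "w \<in> WS" "iter_partial is (fourier u) = fourier w" by blast
  have "partial i (fourier w) = fourier (\<lambda>x. - \<i> * of_real (x $ i) * w x)"
    by (rule ext, rule partial_eqI, rule fourier_WS_has_partial[OF w(1)])
  then show ?case
    unfolding iter_partial_Cons w(2) using WS_coordinate_mult[OF w(1)] by blast
qed

lemma norm_le_card_max_component:
  fixes x :: "real^'n::finite"
  obtains i where "norm x \<le> real CARD('n) * \<bar>x $ i\<bar>"
proof -
  obtain i where i: "\<And>j. \<bar>x $ j\<bar> \<le> \<bar>x $ i\<bar>"
    using Max_in[of "range (\<lambda>j. \<bar>x $ j\<bar>)"] Max_ge[of "range (\<lambda>j. \<bar>x $ j\<bar>)"] by fastforce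
  have "norm x \<le> (\<Sum>j\<in>UNIV. \<bar>x $ j\<bar>)" by (rule norm_le_l1_cart)
  also have "\<dots> \<le> (\<Sum>j\<in>(UNIV::'n set). \<bar>x $ i\<bar>)" by (intro sum_mono i)
  finally show ?thesis using that by simp
qed

lemma fourier_WS_decay:
  fixes u :: "real^'n::finite \<Rightarrow> complex"
  assumes u: "u \<in> WS" and l: "0 < l"
  shows "\<exists>C. \<forall>\<xi>. exp (l * \<omega> (norm \<xi>)) * norm (fourier u \<xi>) \<le> C"
proof -
  let ?I = "\<integral>(x::real^'n). exp (- \<omega> (norm x)) \<partial>lborel"
  let ?N = "CARD('n)"
  obtain A where A: "0 \<le> A" "\<And>t. 0 \<le> t \<Longrightarrow> \<omega> (real ?N * t) \<le> A * (1 + \<omega> t)"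
    using omega_scale by blast
  \<comment> \<open>The part l A pays for replacing |\<xi>| by its largest coordinate r in \<omega>;
    the part 1 pays for the extra factor r in \<open>exp_Y_le_power\<close>, since r \<le> B exp
    (\<omega> r).\<close>
  define m where "m = nat \<lceil>l * A + 1\<rceil>"
  have lA: "0 \<le> l * A" using l A(1) by simp
  have m: "1 \<le> m" "l * A + 1 \<le> real m" unfolding m_def using lA by linarith+
  obtain C where C: "dbound m (real 1) u C" using u m unfolding WS_def by blast
  have C0: "0 \<le> C" by (rule dbound_nonneg[OF C])
  have I0: "0 \<le> ?I" by simp
  obtain B where B: "0 < B" "\<And>t. 0 \<le> t \<Longrightarrow> (1 + t) ^ 1 \<le> B * exp (\<omega> t)"
    using power_bound by blast
  have su: "smooth u" by (rule WS_smooth[OF u])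
  have main: "\<bar>\<xi> $ i\<bar> ^ k * norm (fourier u \<xi>) \<le> C * ?I * exp (Y m k)" for \<xi> i k
  proof -
    have "\<bar>\<xi> $ i\<bar> ^ k * norm (fourier u \<xi>) = norm (fourier (iter_partial (replicate k i) u) \<xi>)"
      unfolding fourier_iter_partial[OF su WS_integrable(1)[OF u]] by (simp add: norm_mult norm_power)
    also have "\<dots> \<le> (\<integral>x. norm (iter_partial (replicate k i) u x) \<partial>lborel)"
      by (rule norm_fourier_le[OF WS_integrable(1)[OF u]])
    also have "\<dots> \<le> (C * exp (Y m k)) * ?I"
    proof (rule integrable_decay(2))
      show "norm (iter_partial (replicate k i) u x) \<le> C * exp (Y m k) * exp (- \<omega> (norm x))" for x
        using dboundD[OF C, of "replicate k i" x] by (simp add: mult_ac)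
    qed (intro smooth_continuous smooth_iter_partial su)
    finally show ?thesis by (simp only: mult_ac)
  qed
  have "exp (l * \<omega> (norm \<xi>)) * norm (fourier u \<xi>) \<le>
      exp (l * \<omega> (real ?N)) * (C * ?I * exp (Y m 0)) + C * ?I * B * exp (l * A)" for \<xi>
  proof -
    obtain i where i: "norm \<xi> \<le> real ?N * \<bar>\<xi> $ i\<bar>" using norm_le_card_max_component by blast
    define r where "r = \<bar>\<xi> $ i\<bar>"
    have r0: "0 \<le> r" unfolding r_def by simp
    have T0: "0 \<le> exp (l * \<omega> (real ?N)) * (C * ?I * exp (Y m 0))" "0 \<le> C * ?I * B * exp (l * A)"
      using C0 I0 B(1) by auto
    show ?thesis
    \<comment> \<open>For r \<le> 1 the point \<xi> lies in the ball of radius \<open>?N\<close>,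
      and the estimate with k = 0 suffices; \<open>exp_Y_le_power\<close> covers r \<ge> 1.\<close>
    proof (cases "r \<le> 1")
      case True
      have "real ?N * r \<le> real ?N * 1" by (intro mult_left_mono True) simp
      then have "norm \<xi> \<le> real ?N" using i unfolding r_def by linarith
      then have "exp (l * \<omega> (norm \<xi>)) \<le> exp (l * \<omega> (real ?N))"
        using l by (auto intro!: omega_mono)
      then have "exp (l * \<omega> (norm \<xi>)) * norm (fourier u \<xi>) \<le> exp (l * \<omega> (real ?N)) * (C * ?I * exp (Y m 0))"
        using main[of \<xi> i 0] by (intro mult_mono) auto
      then show ?thesis using T0(2) by linarith
    next
      case False
      then have r1: "1 \<le> r" by simp
      obtain k where k: "exp (Y m k) \<le> r ^ (k + 1) * exp (- real m * \<omega> r)"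
        using exp_Y_le_power[OF m(1) r1] by blast
      have rk: "0 < r ^ k" using r1 by simp
      have "r ^ k * norm (fourier u \<xi>) \<le> C * ?I * exp (Y m k)" using main unfolding r_def .
      also have "\<dots> \<le> C * ?I * (r ^ (k + 1) * exp (- real m * \<omega> r))"
        using C0 I0 by (intro mult_left_mono k) auto
      also have "\<dots> = r ^ k * (C * ?I * (r * exp (- real m * \<omega> r)))" by simp
      finally have 1: "norm (fourier u \<xi>) \<le> C * ?I * (r * exp (- real m * \<omega> r))"
        using rk by (simp only: mult_le_cancel_left_pos)
      have "r \<le> B * exp (\<omega> r)" using B(2)[OF r0] r0 by simp
      then have "C * ?I * (r * exp (- real m * \<omega> r)) \<le> C * ?I * (B * exp (\<omega> r) * exp (- real m * \<omega> r))"
        using C0 I0 by (intro mult_left_mono mult_right_mono) auto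
      with 1 have 2: "norm (fourier u \<xi>) \<le> C * ?I * (B * exp (\<omega> r) * exp (- real m * \<omega> r))" by linarith
      have "\<omega> (norm \<xi>) \<le> A * (1 + \<omega> r)"
        using omega_mono[OF norm_ge_zero i] A(2)[OF r0] unfolding r_def by linarith
      then have "l * \<omega> (norm \<xi>) \<le> l * A + l * A * \<omega> r"
        using mult_left_mono[of "\<omega> (norm \<xi>)" "A * (1 + \<omega> r)" l] l by (simp add: algebra_simps)
      then have 3: "exp (l * \<omega> (norm \<xi>)) \<le> exp (l * A + l * A * \<omega> r)" by simp
      have "exp (l * \<omega> (norm \<xi>)) * norm (fourier u \<xi>) \<le>
          exp (l * A + l * A * \<omega> r) * (C * ?I * (B * exp (\<omega> r) * exp (- real m * \<omega> r)))"
        by (intro mult_mono 2 3) auto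
      also have "\<dots> = C * ?I * B * exp (l * A) * exp ((l * A + 1 - real m) * \<omega> r)"
        by (simp add: exp_add[symmetric] algebra_simps flip: exp_minus)
      also have "\<dots> \<le> C * ?I * B * exp (l * A) * 1"
        using T0(2) m(2) omega_nonneg[OF r0]
        by (intro mult_left_mono) (auto simp: mult_nonpos_nonneg)
      finally show ?thesis using T0(1) by linarith
    qed
  qed
  then show ?thesis by blast
qed

lemma WS_subset_S_set: "WS \<subseteq> (S_set \<omega> :: (real^'n::finite \<Rightarrow> complex) set)"
proof
  fix f :: "real^'n \<Rightarrow> complex" assume f: "f \<in> WS"
  have sf: "smooth f" "smooth (fourier f)" using WS_smooth smooth_fourier_WS f by auto
  have 1: "bdd_above (range (\<lambda>x. exp (l * \<omega> (norm x)) * cmod (multi_partial \<alpha> f x)))" if "0 < l" for l \<alpha>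
  proof -
    obtain "is" where "is": "multi_partial \<alpha> f = iter_partial is f" using multi_partial_list[OF sf(1)] by metis
    obtain C where C: "0 \<le> C" "\<And>x. norm (iter_partial is f x) \<le> C * exp (- real (nat \<lceil>l\<rceil>) * \<omega> (norm x))"
      using WS_decay[OF f] by metis
    have "exp (l * \<omega> (norm x)) * norm (iter_partial is f x) \<le> C" for x
    proof -
      have "exp (l * \<omega> (norm x)) * norm (iter_partial is f x) \<le>
          exp (real (nat \<lceil>l\<rceil>) * \<omega> (norm x)) * (C * exp (- real (nat \<lceil>l\<rceil>) * \<omega> (norm x)))"
        using C by (intro mult_mono) (auto intro!: mult_right_mono real_nat_ceiling_ge)
      also have "\<dots> = C" by (simp add: exp_minus)
      finally show ?thesis .
    qed
    then show ?thesis unfolding "is" by (intro bdd_aboveI2)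
  qed
  have 2: "bdd_above (range (\<lambda>x. exp (l * \<omega> (norm x)) * cmod (multi_partial \<alpha> (fourier f) x)))" if l: "0 < l" for l \<alpha>
  proof -
    obtain "is" where "is": "multi_partial \<alpha> (fourier f) = iter_partial is (fourier f)"
      using multi_partial_list[OF sf(2)] by metis
    obtain u where u: "u \<in> WS" "iter_partial is (fourier f) = fourier u"
      using iter_partial_fourier_WS[OF f, of "is"] by blast
    obtain C where "\<And>\<xi>. exp (l * \<omega> (norm \<xi>)) * norm (fourier u \<xi>) \<le> C"
      using fourier_WS_decay[OF u(1) l] by blast
    then show ?thesis unfolding "is" u(2) by (intro bdd_aboveI2)
  qed
  show "f \<in> S_set \<omega>"
    unfolding S_set_def using sf 1 2 WS_integrable(1)[OF f, of "[]"] by simp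
qed

lemma S_set_eq_WS: "S_set \<omega> = WS"
  using S_set_subset_WS WS_subset_S_set by (rule subset_antisym)

section \<open>Continuity of the multiplication\<close>

lemma seminorm_on_O_norm:
  assumes m: "1 \<le> m"
  shows "seminorm_on {f. smooth f} (O_norm \<omega> m n)"
  unfolding seminorm_on_def
proof (intro conjI ballI allI)
  fix f g :: "real^'a \<Rightarrow> complex" assume "f \<in> {f. smooth f}" "g \<in> {f. smooth f}"
  then have fg: "smooth f" "smooth g" by auto
  show "O_norm \<omega> m n (f + g) \<le> O_norm \<omega> m n f + O_norm \<omega> m n g"
  proof (cases "O_norm \<omega> m n f < \<infinity> \<and> O_norm \<omega> m n g < \<infinity>")
    case True
    then obtain a b where a: "O_norm \<omega> m n f = ennreal a" "0 \<le> a" and b: "O_norm \<omega> m n g = ennreal b" "0 \<le> b"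
      by (cases "O_norm \<omega> m n f"; cases "O_norm \<omega> m n g") auto
    have "dbound m (- real n) f a" "dbound m (- real n) g b"
      using a b O_norm_le_iff[OF fg(1) m a(2), of n] O_norm_le_iff[OF fg(2) m b(2), of n] by auto
    then have "dbound m (- real n) (f + g) (a + b)" by (rule dbound_add[OF fg])
    then have "O_norm \<omega> m n (f + g) \<le> ennreal (a + b)"
      using a b by (subst O_norm_le_iff[OF smooth_add[OF fg] m]) auto
    then show ?thesis using a b by simp
  next
    case False
    then show ?thesis by (auto simp: less_top[symmetric])
  qed
next
  fix c and f :: "real^'a \<Rightarrow> complex" assume "f \<in> {f. smooth f}"
  then have f: "smooth f" by auto
  show "O_norm \<omega> m n (\<lambda>x. c * f x) \<le> ennreal (cmod c) * O_norm \<omega> m n f"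
  proof (cases "O_norm \<omega> m n f < \<infinity>")
    case True
    then obtain a where a: "O_norm \<omega> m n f = ennreal a" "0 \<le> a" by (cases "O_norm \<omega> m n f") auto
    have "dbound m (- real n) f a" using a O_norm_le_iff[OF f m a(2), of n] by auto
    then have "dbound m (- real n) (\<lambda>x. c * f x) (cmod c * a)" by (rule dbound_cmult[OF f])
    then have "O_norm \<omega> m n (\<lambda>x. c * f x) \<le> ennreal (cmod c * a)"
      using a by (subst O_norm_le_iff[OF smooth_cmult[OF f] m]) auto
    then show ?thesis using a by (simp add: ennreal_mult'')
  next
    case False
    then have inf: "O_norm \<omega> m n f = \<infinity>" by (simp add: less_top[symmetric])
    show ?thesis
    \<comment> \<open>In \<open>ennreal\<close> zero times infinity is 0, so for c = 0 the norm of
      the zero function has to be computed.\<close>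
    proof (cases "c = 0")
      case True
      have "dbound m (- real n) (\<lambda>_::real^'a. 0) 0"
        unfolding dbound_def using iter_partial_cmult[OF smooth_const, of _ 0 0, where ?'a = 'a] by simp
      then show ?thesis
        using True O_norm_le_iff[OF smooth_const m, of 0 n 0, where ?'a = 'a] by simp
    qed (simp add: inf ennreal_mult_top)
  qed
qed

lemma O_norm_mono:
  fixes f :: "real^'n::finite \<Rightarrow> complex"
  assumes "smooth f" "1 \<le> m" "m \<le> m'" "n' \<le> n"
  shows "O_norm \<omega> m n f \<le> O_norm \<omega> m' n' f"
proof (cases "O_norm \<omega> m' n' f")
  case (real a)
  then have "dbound m' (- real n') f a"
    using O_norm_le_iff[OF assms(1), of m' a n'] assms by auto
  then have "dbound m (- real n) f a" by (rule dbound_mono) (use assms in auto)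
  then show ?thesis using real O_norm_le_iff[OF assms(1,2), of a n] by auto
qed simp

section \<open>Underlying sets of the limits and bounded sets of \<open>OC_space\<close>\<close>

definition O_set :: "nat \<Rightarrow> nat \<Rightarrow> (real^'n::finite \<Rightarrow> complex) set" where
  "O_set m n = {f. smooth f \<and> O_norm \<omega> m n f < \<infinity>}"

lemma O_step_eq: "O_step \<omega> m n = seminorm_topology (O_set m n) {O_norm \<omega> m n}"
  unfolding O_step_def O_set_def ..

lemma topspace_O_step [simp]: "topspace (O_step \<omega> m n) = O_set m n"
  unfolding O_step_eq by simp

lemma csubspace_O_set: "1 \<le> m \<Longrightarrow> csubspace (O_set m n)"
  using csubspace_seminorm_finite[OF csubspace_smooth seminorm_on_O_norm, of m n] by (simp add: O_set_def)

lemma O_set_mono: "1 \<le> m \<Longrightarrow> m \<le> m' \<Longrightarrow> n' \<le> n \<Longrightarrow> O_set m' n' \<subseteq> O_set m n"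
proof
  fix f :: "real^'a \<Rightarrow> complex" assume m: "1 \<le> m" "m \<le> m'" "n' \<le> n" and "f \<in> O_set m' n'"
  then have f: "smooth f" "O_norm \<omega> m' n' f < \<infinity>" by (auto simp: O_set_def)
  from order_le_less_trans[OF O_norm_mono[OF f(1) m] f(2)] f(1) show "f \<in> O_set m n"
    by (simp add: O_set_def)
qed

text \<open>The sets \<open>E_set m\<close> and \<open>F_set n\<close> underlie the inner limits of
  \<open>OM_space\<close> and of \<open>OC_space\<close> respectively.\<close>

definition E_set :: "nat \<Rightarrow> (real^'n::finite \<Rightarrow> complex) set" where
  "E_set m = (\<Union>n\<in>{1..}. O_set m n)"

definition F_set :: "nat \<Rightarrow> (real^'n::finite \<Rightarrow> complex) set" where
  "F_set n = (\<Inter>m\<in>{1..}. O_set m n)"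

lemma csubspace_E_set: "1 \<le> m \<Longrightarrow> csubspace (E_set m)"
  unfolding E_set_def by (intro csubspace_increasing_UN csubspace_O_set O_set_mono) auto

lemma csubspace_F_set: "csubspace (F_set n)"
  unfolding F_set_def by (intro csubspace_INT csubspace_O_set) auto

lemma F_set_mono: "n \<le> n' \<Longrightarrow> F_set n \<subseteq> F_set n'"
  unfolding F_set_def by (rule INF_mono) (metis O_set_mono atLeast_iff order_refl)

lemma topspace_ind_O_step: "1 \<le> m \<Longrightarrow> topspace (ind_limit {1..} (\<lambda>n. O_step \<omega> m n)) = E_set m"
  using topspace_ind_limit[where I = "{1..}" and X = "\<lambda>n. O_step \<omega> m n"] csubspace_E_set[of m]
  unfolding topspace_O_step E_set_def by blast

lemma topspace_proj_O_step: "topspace (proj_limit {1..} (\<lambda>m. O_step \<omega> m n)) = F_set n"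
  by (subst topspace_proj_limit) (simp_all add: F_set_def)

lemma topspace_OM: "topspace (OM_space \<omega>) = (\<Inter>m\<in>{1..}. E_set m)"
  unfolding OM_space_def
proof (subst topspace_proj_limit)
  show "(\<Inter>m\<in>{1..}. topspace (ind_limit {1..} (\<lambda>n. O_step \<omega> m n))) = (\<Inter>m\<in>{1..}. E_set m)"
    by (rule INF_cong[OF refl], rule topspace_ind_O_step) simp
qed simp

lemma topspace_OC:
    "topspace (OC_space \<omega> :: (real^'n::finite \<Rightarrow> complex) topology) = (\<Union>n\<in>{1..}. F_set n)"
  and csubspace_OC: "csubspace (topspace (OC_space \<omega> :: (real^'n::finite \<Rightarrow> complex) topology))"
proof -
  have V: "csubspace (\<Union>n\<in>{1..}. F_set n :: (real^'n \<Rightarrow> complex) set)"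
    by (rule csubspace_increasing_UN[OF csubspace_F_set F_set_mono])
  show eq: "topspace (OC_space \<omega> :: (real^'n \<Rightarrow> complex) topology) = (\<Union>n\<in>{1..}. F_set n)"
    unfolding OC_space_def
    using topspace_ind_limit[where I = "{1..}" and X = "\<lambda>n. proj_limit {1..} (\<lambda>m. O_step \<omega> m n)"] V
    unfolding topspace_proj_O_step by blast
  show "csubspace (topspace (OC_space \<omega> :: (real^'n \<Rightarrow> complex) topology))" unfolding eq by (rule V)
qed

lemma F_set_subset_OC: "F_set 1 \<subseteq> topspace (OC_space \<omega>)"
  unfolding topspace_OC by auto

text \<open>The trace of a neighbourhood on the first step is open in a projective limit with
  increasing norms, so one norm describes it. The products f * g with g in \<open>WS\<close> all lie
  in this step.\<close>

lemma OC_nhd: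
  fixes W :: "(real^'n::finite \<Rightarrow> complex) set"
  assumes "zero_nhd (OC_space \<omega>) W"
  shows "\<exists>m\<ge>1. \<exists>e>0. {h \<in> F_set 1. O_norm \<omega> m 1 h < ennreal e} \<subseteq> W"
proof -
  let ?X = "proj_limit {1..} (\<lambda>m. O_step \<omega> m 1) :: (real^'n \<Rightarrow> complex) topology"
  obtain U where U: "openin (OC_space \<omega>) U" "0 \<in> U" "U \<subseteq> W" using assms unfolding zero_nhd_def by blast
  have "openin ?X (U \<inter> topspace ?X)"
    using openin_ind_limit_step[OF U(1)[unfolded OC_space_def], of 1] by simp
  then have o: "openin (proj_limit {1..} (\<lambda>m. seminorm_topology (O_set m 1) {O_norm \<omega> m 1})) (U \<inter> F_set 1)"
    unfolding topspace_proj_O_step unfolding O_step_eq .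
  have "\<exists>m\<in>{1..}. \<exists>e>0. {g \<in> F_set 1. O_norm \<omega> m 1 (g - 0) < ennreal e} \<subseteq> U \<inter> F_set 1"
  proof (rule openin_proj_limit_decreasing_seminorms[where E = "\<lambda>m. O_set m 1" and p = "\<lambda>m. O_norm \<omega> m 1"])
    show "O_norm \<omega> i 1 f \<le> O_norm \<omega> j 1 f" if "i \<in> {1..}" "i \<le> j" "f \<in> F_set 1" for i j f
      using that by (intro O_norm_mono) (auto simp: F_set_def O_set_def)
    show "F_set 1 = (\<Inter>i\<in>{1..}. O_set i 1)" by (simp add: F_set_def)
    show "0 \<in> U \<inter> F_set 1" using U(2) csubspaceD(1)[OF csubspace_F_set] by blast
  qed (use o in \<open>auto simp: csubspace_F_set\<close>)
  then show ?thesis using U(3) by auto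
qed

lemma OC_bounded:
  fixes H :: "(real^'n::finite \<Rightarrow> complex) set"
  assumes H: "H \<subseteq> F_set 1" and bound: "\<And>m. 1 \<le> m \<Longrightarrow> \<exists>C. \<forall>h\<in>H. O_norm \<omega> m 1 h \<le> ennreal C"
  shows "tvs_bounded (OC_space \<omega>) H"
  unfolding tvs_bounded_def
proof (intro conjI allI impI)
  show "H \<subseteq> topspace (OC_space \<omega>)" using H F_set_subset_OC by blast
  fix U :: "(real^'n \<Rightarrow> complex) set" assume "zero_nhd (OC_space \<omega>) U"
  then obtain m e where m: "1 \<le> m" "0 < e" "{h \<in> F_set 1. O_norm \<omega> m 1 h < ennreal e} \<subseteq> U"
    using OC_nhd by blast
  obtain C where C: "\<forall>h\<in>H. O_norm \<omega> m 1 h \<le> ennreal C" using bound[OF m(1)] by blast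
  show "\<exists>r>0. \<forall>c::complex. r \<le> cmod c \<longrightarrow> H \<subseteq> (\<lambda>f x. c * f x) ` U"
  \<comment> \<open>The summand 1 keeps the radius positive for C = 0 and makes |C| / |c| < e
    strict.\<close>
  proof (intro exI[of _ "(\<bar>C\<bar> + 1) / e"] conjI allI impI subsetI)
    show "0 < (\<bar>C\<bar> + 1) / e" using m(2) by simp
    fix c :: complex and h assume c: "(\<bar>C\<bar> + 1) / e \<le> cmod c" and h: "h \<in> H"
    have c0: "0 < cmod c" using c \<open>0 < (\<bar>C\<bar> + 1) / e\<close> by linarith
    have hF: "h \<in> F_set 1" using h H by blast
    then have sh: "smooth h" by (auto simp: F_set_def O_set_def)
    have "O_norm \<omega> m 1 (\<lambda>x. inverse c * h x) \<le> ennreal (cmod (inverse c)) * O_norm \<omega> m 1 h"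
      using sh by (intro seminorm_onD(2)[OF seminorm_on_O_norm[OF m(1)]]) simp
    also have "\<dots> \<le> ennreal (cmod (inverse c)) * ennreal \<bar>C\<bar>"
      using C h by (intro mult_left_mono) (auto intro: order_trans[OF _ ennreal_leI])
    also have "\<dots> = ennreal (\<bar>C\<bar> / cmod c)"
      by (simp add: norm_inverse divide_inverse mult.commute flip: ennreal_mult'')
    also have "\<dots> < ennreal e"
    proof (rule ennreal_lessI[OF m(2)])
      have "\<bar>C\<bar> + 1 \<le> cmod c * e" using c m(2) by (simp add: pos_divide_le_eq)
      then have "\<bar>C\<bar> < e * cmod c" unfolding mult.commute[of e] by linarith
      then show "\<bar>C\<bar> / cmod c < e" using c0 by (simp add: pos_divide_less_eq)
    qed
    finally have 1: "(\<lambda>x. inverse c * h x) \<in> U" using csubspaceD(3)[OF csubspace_F_set hF] m(3) by blast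
    have 2: "h = (\<lambda>x. c * (inverse c * h x))" using c0 by (auto simp: fun_eq_iff)
    show "h \<in> (\<lambda>f x. c * f x) ` U"
      by (rule image_eqI[where x = "\<lambda>x. inverse c * h x"]) (rule 2, rule 1)
  qed
qed

text \<open>If no estimate held, one could choose \<open>T\<^sub>j\<close> and \<open>k\<^sub>j\<close> with \<open>O_norm \<omega> j 1 k\<^sub>j \<le> 1\<close> and \<open>|T\<^sub>j k\<^sub>j| > j\<close>;
  but the sequence \<open>k\<^sub>j\<close> is bounded because the norms increase with \<open>j\<close>.\<close>
lemma equicontinuous_estimate:
  fixes D :: "((real^'n::finite \<Rightarrow> complex) \<Rightarrow> complex) set"
  assumes D: "D \<subseteq> dual_space (OC_space \<omega>)"
    and bdd: "\<And>H. tvs_bounded (OC_space \<omega>) H \<Longrightarrow> \<exists>r. \<forall>T\<in>D. \<forall>h\<in>H. cmod (T h) \<le> r"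
  shows "\<exists>m\<ge>1. \<exists>C>0. \<forall>T\<in>D. \<forall>h\<in>F_set 1. cmod (T h) \<le> C * enn2real (O_norm \<omega> m 1 h)"
proof (rule ccontr)
  assume neg: "\<not> ?thesis"
  \<comment> \<open>\<open>Suc j\<close> serves both as norm index, which must be at least 1, and as
    constant in the negated estimate. \<open>inverse_scaling\<close> normalises h even if its norm
    is 0.\<close>
  have "\<exists>T k. T \<in> D \<and> k \<in> F_set 1 \<and> O_norm \<omega> (Suc j) 1 k \<le> 1 \<and> real j < cmod (T k)" for j
  proof -
    have "\<not> (\<forall>T\<in>D. \<forall>h\<in>F_set 1. cmod (T h) \<le> real (Suc j) * enn2real (O_norm \<omega> (Suc j) 1 h))"
      using neg by (metis le_add1 plus_1_eq_Suc of_nat_0_less_iff zero_less_Suc)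
    then obtain T h where Th: "T \<in> D" "h \<in> F_set 1"
      "real (Suc j) * enn2real (O_norm \<omega> (Suc j) 1 h) < cmod (T h)" by force
    obtain c where c: "0 < c" "c * enn2real (O_norm \<omega> (Suc j) 1 h) \<le> 1" "real (Suc j) < c * cmod (T h)"
      using inverse_scaling[OF enn2real_nonneg Th(3)] by blast
    let ?k = "\<lambda>x. complex_of_real c * h x"
    have sh: "smooth h" and fin: "O_norm \<omega> (Suc j) 1 h < \<infinity>" using Th(2) by (auto simp: F_set_def O_set_def)
    have "O_norm \<omega> (Suc j) 1 ?k \<le> ennreal (cmod (complex_of_real c)) * O_norm \<omega> (Suc j) 1 h"
      using sh by (intro seminorm_onD(2)[OF seminorm_on_O_norm]) auto
    also have "\<dots> = ennreal c * ennreal (enn2real (O_norm \<omega> (Suc j) 1 h))"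
      using fin c(1) by simp
    also have "\<dots> = ennreal (c * enn2real (O_norm \<omega> (Suc j) 1 h))" by (simp flip: ennreal_mult'')
    also have "\<dots> \<le> ennreal 1" by (rule ennreal_leI[OF c(2)])
    finally have 1: "O_norm \<omega> (Suc j) 1 ?k \<le> 1" by simp
    have "h \<in> topspace (OC_space \<omega>)" using Th(2) F_set_subset_OC by blast
    then have "T ?k = of_real c * T h" using D Th(1) unfolding dual_space_def by blast
    then have "real j < cmod (T ?k)" using c(1,3) by (simp add: norm_mult)
    then show ?thesis using 1 Th csubspaceD(3)[OF csubspace_F_set Th(2)] by blast
  qed
  then obtain T k where Tk: "\<And>j. T j \<in> D" "\<And>j. k j \<in> F_set 1"
    "\<And>j. O_norm \<omega> (Suc j) 1 (k j) \<le> 1" "\<And>j. real j < cmod (T j (k j))" by metis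
  have "tvs_bounded (OC_space \<omega>) (range k)"
  proof (rule OC_bounded)
    show "range k \<subseteq> F_set 1" using Tk(2) by blast
    fix m :: nat assume m: "1 \<le> m"
    \<comment> \<open>The terms with j \<ge> m have norm at most 1; the finitely many others are
      covered by the sum of their norms.\<close>
    define C where "C = 1 + (\<Sum>j<m. enn2real (O_norm \<omega> m 1 (k j)))"
    have "O_norm \<omega> m 1 (k j) \<le> ennreal C" for j
    proof (cases "j < m")
      case True
      have "O_norm \<omega> m 1 (k j) < \<infinity>" using Tk(2)[of j] m by (auto simp: F_set_def O_set_def)
      then have "O_norm \<omega> m 1 (k j) = ennreal (enn2real (O_norm \<omega> m 1 (k j)))" by simp
      also have "\<dots> \<le> ennreal C"
      proof (rule ennreal_leI)
        have "enn2real (O_norm \<omega> m 1 (k j)) \<le> (\<Sum>j<m. enn2real (O_norm \<omega> m 1 (k j)))"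
          using True by (intro member_le_sum) auto
        then show "enn2real (O_norm \<omega> m 1 (k j)) \<le> C" unfolding C_def by simp
      qed
      finally show ?thesis .
    next
      case False
      have "O_norm \<omega> m 1 (k j) \<le> O_norm \<omega> (Suc j) 1 (k j)"
        using Tk(2)[of j] False m by (intro O_norm_mono) (auto simp: F_set_def O_set_def)
      also have "\<dots> \<le> ennreal 1" using Tk(3)[of j] by simp
      also have "\<dots> \<le> ennreal C" unfolding C_def by (intro ennreal_leI) (simp add: sum_nonneg)
      finally show ?thesis .
    qed
    then show "\<exists>C. \<forall>h\<in>range k. O_norm \<omega> m 1 h \<le> ennreal C" by blast
  qed
  then obtain r where r: "\<And>T h. T \<in> D \<Longrightarrow> h \<in> range k \<Longrightarrow> cmod (T h) \<le> r" using bdd by blast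
  obtain j where "r < real j" using reals_Archimedean2 by blast
  then show False using r[OF Tk(1)[of j], of "k j"] Tk(4)[of j] by simp
qed

section \<open>Elements of \<open>OM_space\<close> as multipliers\<close>

lemma OM_dbound:
  assumes "f \<in> topspace (OM_space \<omega>)" "1 \<le> m"
  shows "smooth f" "\<exists>(n::nat)\<ge>1. \<exists>A\<ge>0. dbound m (- real n) f A"
proof -
  have "f \<in> E_set m" using assms by (auto simp: topspace_OM)
  then obtain n where n: "1 \<le> n" "smooth f" "O_norm \<omega> m n f < \<infinity>" by (auto simp: E_set_def O_set_def)
  then show "smooth f" "\<exists>(n::nat)\<ge>1. \<exists>A\<ge>0. dbound m (- real n) f A"
    using O_norm_finite_iff[OF n(2) assms(2)] by auto
qed

lemma OM_mult_WS:
  assumes "f \<in> topspace (OM_space \<omega>)" "g \<in> WS"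
  shows "f * g \<in> WS"
  using OM_dbound(2)[OF assms(1)] by (intro WS_mult[OF assms(2) OM_dbound(1)[OF assms(1) order_refl]]) blast

lemma WS_subset_F_set: "WS \<subseteq> F_set 1"
proof
  fix f :: "real^'n::finite \<Rightarrow> complex" assume f: "f \<in> WS"
  have sf: "smooth f" by (rule WS_smooth[OF f])
  have "O_norm \<omega> m 1 f < \<infinity>" if m: "1 \<le> m" for m
  proof -
    obtain C where "dbound m (real 0) f C" using f m unfolding WS_def by blast
    then have "dbound m (- real 1) f C" by (rule dbound_mono) (use m in auto)
    then show ?thesis using O_norm_finite_iff[OF sf m] dbound_nonneg by blast
  qed
  then show "f \<in> F_set 1" using sf by (auto simp: F_set_def O_set_def)
qed

lemma WS_subset_OC: "WS \<subseteq> topspace (OC_space \<omega>)"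
  using WS_subset_F_set F_set_subset_OC by blast

lemma csubspace_WS: "csubspace WS"
  unfolding csubspace_def
proof (intro conjI ballI allI WS_add WS_cmult)
  have "dbound m (real n) (\<lambda>_::real^'a. 0) 0" for m n
    unfolding dbound_def using iter_partial_cmult[OF smooth_const, of _ 0 0, where ?'a = 'a] by simp
  then show "0 \<in> (WS :: (real^'a \<Rightarrow> complex) set)"
    unfolding WS_def zero_fun_def using smooth_const by blast
qed

lemma topspace_S: "topspace (S_space \<omega>) = WS"
  unfolding S_space_def by (simp add: S_set_eq_WS)

lemma seminorm_on_S_norm:
  assumes m: "1 \<le> m"
  shows "seminorm_on (WS :: (real^'n::finite \<Rightarrow> complex) set) (S_norm \<omega> m n)"
proof -
  have fin: "\<exists>a\<ge>0. S_norm \<omega> m n f = ennreal a \<and> dbound m (real n) f a"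
    if f: "f \<in> WS" for f :: "real^'n \<Rightarrow> complex"
  proof -
    have "S_norm \<omega> m n f < \<infinity>"
      using S_norm_finite_iff[OF WS_smooth[OF f] m] f m dbound_nonneg unfolding WS_def by blast
    then obtain a where a: "S_norm \<omega> m n f = ennreal a" "0 \<le> a" by (cases "S_norm \<omega> m n f") auto
    then have "dbound m (real n) f a" using S_norm_le_iff[OF WS_smooth[OF f] m a(2), of n] by auto
    with a show ?thesis by blast
  qed
  show ?thesis
    unfolding seminorm_on_def
  proof (intro conjI ballI allI)
    fix f g :: "real^'n \<Rightarrow> complex" assume fg: "f \<in> WS" "g \<in> WS"
    obtain a b where a: "0 \<le> a" "S_norm \<omega> m n f = ennreal a" "dbound m (real n) f a"
      and b: "0 \<le> b" "S_norm \<omega> m n g = ennreal b" "dbound m (real n) g b"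
      using fin[OF fg(1)] fin[OF fg(2)] by blast
    have "dbound m (real n) (f + g) (a + b)" using dbound_add WS_smooth fg a b by blast
    then have "S_norm \<omega> m n (f + g) \<le> ennreal (a + b)"
      using a b by (subst S_norm_le_iff[OF smooth_add[OF WS_smooth WS_smooth] m]) (auto simp: fg)
    then show "S_norm \<omega> m n (f + g) \<le> S_norm \<omega> m n f + S_norm \<omega> m n g" using a b by simp
  next
    fix c and f :: "real^'n \<Rightarrow> complex" assume f: "f \<in> WS"
    obtain a where a: "0 \<le> a" "S_norm \<omega> m n f = ennreal a" "dbound m (real n) f a" using fin[OF f] by blast
    have "dbound m (real n) (\<lambda>x. c * f x) (cmod c * a)" using dbound_cmult WS_smooth f a by blast
    then have "S_norm \<omega> m n (\<lambda>x. c * f x) \<le> ennreal (cmod c * a)"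
      using a by (subst S_norm_le_iff[OF smooth_cmult[OF WS_smooth] m]) (auto simp: f)
    then show "S_norm \<omega> m n (\<lambda>x. c * f x) \<le> ennreal (cmod c) * S_norm \<omega> m n f"
      using a by (simp add: ennreal_mult'')
  qed
qed

section \<open>Seminorms on multipliers from bounded subsets of \<open>S_space\<close>\<close>

lemma S_bounded_dbound:
  fixes B :: "(real^'n::finite \<Rightarrow> complex) set"
  assumes B: "tvs_bounded (S_space \<omega>) B" and mn: "1 \<le> m" "1 \<le> n"
  shows "\<exists>C\<ge>0. \<forall>g\<in>B. dbound m (real n) g C"
proof -
  have "zero_nhd (S_space \<omega>) {g \<in> WS. S_norm \<omega> m n g < ennreal 1}"
    unfolding S_space_def S_set_eq_WS
    by (rule zero_nhd_seminorm_ball[OF csubspace_WS _ seminorm_on_S_norm]) (use mn in auto)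
  then have U: "zero_nhd (S_space \<omega>) {g \<in> topspace (S_space \<omega>). S_norm \<omega> m n g < ennreal 1}"
    unfolding topspace_S .
  obtain r where r: "\<forall>g\<in>B. S_norm \<omega> m n g \<le> ennreal r"
    using tvs_bounded_seminorm[OF B U] seminorm_on_S_norm[OF mn(1)] unfolding topspace_S by blast
  have "dbound m (real n) g (max r 0)" if g: "g \<in> B" for g
  proof -
    have "g \<in> WS" using B g unfolding tvs_bounded_def topspace_S by blast
    moreover have "S_norm \<omega> m n g \<le> ennreal (max r 0)"
      using r g by (auto intro: order_trans[OF _ ennreal_leI])
    ultimately show ?thesis using S_norm_le_iff[OF WS_smooth mn(1), of g "max r 0" n] by auto
  qed
  then show ?thesis by (intro exI[of _ "max r 0"]) auto
qed

lemma S_bounded_subset: "tvs_bounded (S_space \<omega>) B \<Longrightarrow> B \<subseteq> WS"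
  unfolding tvs_bounded_def topspace_S by blast

text \<open>Measures a multiplier by its action on \<open>B\<close>, in the norm with weight index 1
  that belongs to the first step of \<open>OC_space\<close>.\<close>

definition prod_norm ::
  "nat \<Rightarrow> (real^'n::finite \<Rightarrow> complex) set \<Rightarrow> (real^'n \<Rightarrow> complex) \<Rightarrow> ennreal" where
  "prod_norm m B f = (SUP g\<in>B. O_norm \<omega> m 1 (f * g))"

lemma seminorm_on_prod_norm:
  assumes "B \<subseteq> WS" "1 \<le> m"
  shows "seminorm_on {f. smooth f} (prod_norm m B)"
  unfolding seminorm_on_def prod_norm_def
proof (intro conjI ballI allI SUP_least)
  fix f g h :: "real^'a \<Rightarrow> complex" assume fg: "f \<in> {f. smooth f}" "g \<in> {f. smooth f}" and h: "h \<in> B"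
  have sh: "smooth h" using h assms(1) WS_smooth by blast
  have "O_norm \<omega> m 1 ((f + g) * h) = O_norm \<omega> m 1 (f * h + g * h)" by (simp only: distrib_right)
  also have "\<dots> \<le> O_norm \<omega> m 1 (f * h) + O_norm \<omega> m 1 (g * h)"
    using fg sh smooth_mult by (intro seminorm_onD(1)[OF seminorm_on_O_norm[OF assms(2)]]) blast+
  also have "\<dots> \<le> (SUP g\<in>B. O_norm \<omega> m 1 (f * g)) + (SUP h\<in>B. O_norm \<omega> m 1 (g * h))"
    using h by (intro add_mono SUP_upper)
  finally show "O_norm \<omega> m 1 ((f + g) * h) \<le> \<dots>" .
next
  fix c and f h :: "real^'a \<Rightarrow> complex" assume f: "f \<in> {f. smooth f}" and h: "h \<in> B"
  have sh: "smooth h" using h assms(1) WS_smooth by blast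
  have "O_norm \<omega> m 1 ((\<lambda>x. c * f x) * h) = O_norm \<omega> m 1 (\<lambda>x. c * (f * h) x)"
    by (simp add: times_fun_def mult.assoc)
  also have "\<dots> \<le> ennreal (cmod c) * O_norm \<omega> m 1 (f * h)"
    using f sh smooth_mult by (intro seminorm_onD(2)[OF seminorm_on_O_norm[OF assms(2)]]) blast
  also have "\<dots> \<le> ennreal (cmod c) * (SUP g\<in>B. O_norm \<omega> m 1 (f * g))"
    using h by (intro mult_left_mono SUP_upper) auto
  finally show "O_norm \<omega> m 1 ((\<lambda>x. c * f x) * h) \<le> \<dots>" .
qed

text \<open>The exponents -n of f and n of g cancel. The index \<open>\<kappa> * m\<close> is the
  same for every n and only the constant depends on n, so the seminorm is controlled on all steps of
  one inductive limit.\<close>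

lemma prod_norm_bound:
  fixes B :: "(real^'n::finite \<Rightarrow> complex) set"
  assumes B: "tvs_bounded (S_space \<omega>) B" and mn: "1 \<le> m" "1 \<le> n"
  shows "\<exists>C\<ge>0. \<forall>f A. smooth f \<and> dbound (\<kappa> * m) (- real n) f A \<longrightarrow> prod_norm m B f \<le> ennreal (C * A)"
proof -
  have M: "1 \<le> \<kappa> * m" using mult_le_mono[OF kappa(1) mn(1)] by simp
  obtain C where C: "0 < C" "\<forall>(u :: real^'n \<Rightarrow> complex) v r s A B. smooth u \<and> smooth v \<and>
      dbound (\<kappa> * m) r u A \<and> dbound (\<kappa> * m) s v B \<longrightarrow> dbound m (r + s) (u * v) (C * (A * B))"
    using dbound_mult[OF mn(1)] by blast
  obtain b where b: "0 \<le> b" "\<forall>g\<in>B. dbound (\<kappa> * m) (real n) g b" using S_bounded_dbound[OF B M mn(2)] by blast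
  have "prod_norm m B f \<le> ennreal (C * b * A)" if f: "smooth f" "dbound (\<kappa> * m) (- real n) f A" for f A
    unfolding prod_norm_def
  proof (rule SUP_least)
    fix g assume g: "g \<in> B"
    have sg: "smooth g" using S_bounded_subset[OF B] g WS_smooth by blast
    have "dbound m (- real n + real n) (f * g) (C * (A * b))" using C(2) f sg b(2) g by blast
    \<comment> \<open>The product satisfies the bound with exponent 0, weakened to -1 because the
      steps start at n = 1.\<close>
    then have "dbound m (- real 1) (f * g) (C * b * A)"
      by (rule dbound_mono) (use mn in \<open>auto simp: mult_ac\<close>)
    moreover have "0 \<le> C * b * A" using C(1) b(1) dbound_nonneg[OF f(2)] by simp
    ultimately show "O_norm \<omega> m 1 (f * g) \<le> ennreal (C * b * A)"
      using O_norm_le_iff[OF smooth_mult[OF f(1) sg] mn(1)] by blast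
  qed
  moreover have "0 \<le> C * b" using C(1) b(1) by simp
  ultimately show ?thesis by (intro exI[of _ "C * b"]) blast
qed

text \<open>\<open>prod_norm m B\<close> is finite and continuous on every step of the inductive limit with index \<open>\<kappa> * m\<close>.\<close>
lemma openin_OM_prod_norm:
  fixes B :: "(real^'n::finite \<Rightarrow> complex) set"
  assumes B: "tvs_bounded (S_space \<omega>) B" and m: "1 \<le> m" and f: "f \<in> topspace (OM_space \<omega>)"
  shows "openin (OM_space \<omega>) {g \<in> topspace (OM_space \<omega>). prod_norm m B (g - f) < ennreal e}"
proof -
  let ?M = "\<kappa> * m"
  have M: "1 \<le> ?M" using mult_le_mono[OF kappa(1) m] by simp
  let ?E = "E_set ?M :: (real^'n \<Rightarrow> complex) set" and ?p = "prod_norm m B"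
  have Es: "?E \<subseteq> {f. smooth f}" by (auto simp: E_set_def O_set_def)
  have p: "seminorm_on ?E ?p"
    using seminorm_on_subset[OF seminorm_on_prod_norm[OF S_bounded_subset[OF B] m] Es] .
  have V: "csubspace ?E" by (rule csubspace_E_set[OF M])
  have bnd: "\<exists>C\<ge>0. \<forall>f\<in>O_set ?M n. ?p f \<le> ennreal C * O_norm \<omega> ?M n f" if n: "1 \<le> n" for n
  proof -
    obtain C where C: "0 \<le> C" "\<forall>f A. smooth f \<and> dbound ?M (- real n) f A \<longrightarrow> ?p f \<le> ennreal (C * A)"
      using prod_norm_bound[OF B m n] by blast
    have "?p f \<le> ennreal C * O_norm \<omega> ?M n f" if f: "f \<in> O_set ?M n" for f
    proof -
      have sf: "smooth f" and "O_norm \<omega> ?M n f < \<infinity>" using f by (auto simp: O_set_def)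
      then obtain a where a: "O_norm \<omega> ?M n f = ennreal a" "0 \<le> a" by (cases "O_norm \<omega> ?M n f") auto
      then have "dbound ?M (- real n) f a" using O_norm_le_iff[OF sf M a(2), of n] by auto
      then have "?p f \<le> ennreal (C * a)" using C(2) sf by blast
      then show ?thesis using a C(1) by (simp add: ennreal_mult'')
    qed
    then show ?thesis using C(1) by blast
  qed
  have fin: "?p f < \<infinity>" if "f \<in> ?E" for f
  proof -
    have "\<exists>n\<in>{1..}. f \<in> O_set ?M n" using that unfolding E_set_def UN_iff .
    then obtain n where n': "n \<in> {1..}" and n2: "f \<in> O_set ?M n" by (elim bexE)
    from n' have n1: "1 \<le> n" by simp
    note n = n1 n2
    obtain C where C: "\<forall>f\<in>O_set ?M n. ?p f \<le> ennreal C * O_norm \<omega> ?M n f"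
      using bnd[OF n(1)] by blast
    have "?p f \<le> ennreal C * O_norm \<omega> ?M n f" using C n(2) by (rule bspec)
    also have "\<dots> < \<infinity>"
    proof -
      have "O_norm \<omega> ?M n f < top" using n(2) unfolding O_set_def by simp
      then show ?thesis unfolding infinity_ennreal_def ennreal_mult_less_top by simp
    qed
    finally show ?thesis .
  qed
  let ?Y = "seminorm_topology ?E {?p}"
  have OME: "topspace (OM_space \<omega>) \<subseteq> ?E"
    unfolding topspace_OM by (rule INF_lower) (use M in simp)
  then have fE: "f \<in> ?E" using f by (rule subsetD)
  have ball: "openin ?Y {g \<in> ?E. ?p (g - f) < ennreal e}"
    by (rule openin_seminorm_ball[OF V _ p fE]) simp
  have "openin (ind_limit {1..} (\<lambda>n. O_step \<omega> ?M n)) {g \<in> ?E. ?p (g - f) < ennreal e}"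
  \<comment> \<open>The topology given by the single seminorm \<open>?p\<close> is one of the
    locally convex topologies whose join is the inductive limit.\<close>
  proof (rule openin_ind_limit[OF locally_convex_tvs_seminorm[OF V p fin] _ _ ball])
    show "topspace ?Y = (\<Union>i\<in>{1..}. topspace (O_step \<omega> ?M i))" by (simp add: E_set_def)
    fix n :: nat assume "n \<in> {1..}"
    then have n: "1 \<le> n" by simp
    obtain C where C: "0 \<le> C" "\<forall>f\<in>O_set ?M n. ?p f \<le> ennreal C * O_norm \<omega> ?M n f" using bnd[OF n] by blast
    show "continuous_map (O_step \<omega> ?M n) ?Y (\<lambda>f. f)"
    proof (rule continuous_map_seminorm_topology)
      show "g \<in> ?E" if "g \<in> topspace (O_step \<omega> ?M n)" for g
        using that n unfolding E_set_def topspace_O_step by (intro UN_I[of n]) simp_all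
      fix g :: "real^'n \<Rightarrow> complex" and q and d :: real
      assume g: "g \<in> topspace (O_step \<omega> ?M n)" and q: "q \<in> {?p}" and d: "0 < d"
      then have g: "g \<in> O_set ?M n" by simp
      have O: "seminorm_on (O_set ?M n :: (real^'n \<Rightarrow> complex) set) (O_norm \<omega> ?M n)"
        by (rule seminorm_on_subset[OF seminorm_on_O_norm[OF M]]) (auto simp: O_set_def)
      \<comment> \<open>Dividing by C + 1 covers C = 0.\<close>
      let ?U = "{h \<in> O_set ?M n. O_norm \<omega> ?M n (h - g) < ennreal (d / (C + 1))}"
      have "openin (O_step \<omega> ?M n) ?U"
        unfolding O_step_eq by (rule openin_seminorm_ball[OF csubspace_O_set[OF M] _ O g]) simp
      moreover have "g \<in> ?U"
        using d C(1) by (intro seminorm_ball_centre[OF csubspace_O_set[OF M] O g]) simp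
      moreover have "?p (h - g) < ennreal d" if h: "h \<in> ?U" for h
      proof -
        have hg: "h - g \<in> O_set ?M n" using h g csubspaceD(4)[OF csubspace_O_set[OF M]] by blast
        from h have "O_norm \<omega> ?M n (h - g) < ennreal (d / (C + 1))" by simp
        then obtain s where s: "O_norm \<omega> ?M n (h - g) = ennreal s" "0 \<le> s" "s < d / (C + 1)"
          by (rule ennreal_less_realE)
        have "?p (h - g) \<le> ennreal C * O_norm \<omega> ?M n (h - g)" using C(2) hg by blast
        also have "\<dots> = ennreal C * ennreal s" by (simp only: s(1))
        also have "\<dots> = ennreal (C * s)" using C(1) s(2) by (simp add: ennreal_mult'')
        also have "\<dots> < ennreal d"
        proof (rule ennreal_lessI[OF d])
          have "s * (C + 1) < d" using s(3) C(1) by (simp add: pos_less_divide_eq)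
          then show "C * s < d" using s(2) by (simp add: algebra_simps)
        qed
        finally show ?thesis .
      qed
      ultimately show "\<exists>U. openin (O_step \<omega> ?M n) U \<and> g \<in> U \<and> (\<forall>y\<in>U. q (y - g) < ennreal d)"
        using q by (intro exI[of _ ?U] conjI ballI) (simp_all only: singleton_iff)
    qed
  qed
  then have "openin (OM_space \<omega>)
      ((\<Inter>j\<in>{1..}. topspace (ind_limit {1..} (\<lambda>n. O_step \<omega> j n))) \<inter> {g \<in> ?E. ?p (g - f) < ennreal e})"
    unfolding OM_space_def by (rule openin_proj_limit[where i = ?M, rotated]) (use M in simp)
  also have "(\<Inter>j\<in>{1..}. topspace (ind_limit {1..} (\<lambda>n. O_step \<omega> j n))) = topspace (OM_space \<omega> :: (real^'n \<Rightarrow> complex) topology)"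
    unfolding topspace_OM by (rule INF_cong[OF refl], rule topspace_ind_O_step) simp
  also have "topspace (OM_space \<omega>) \<inter> {g \<in> ?E. ?p (g - f) < ennreal e} =
      {g \<in> topspace (OM_space \<omega>). ?p (g - f) < ennreal e}"
    using OME by blast
  finally show ?thesis .
qed

lemma csubspace_OM: "csubspace (topspace (OM_space \<omega>))"
  unfolding topspace_OM by (intro csubspace_INT csubspace_E_set) auto

lemma seminorm_on_OM_prod_norm:
  assumes "tvs_bounded (S_space \<omega>) B" "1 \<le> m"
  shows "seminorm_on (topspace (OM_space \<omega>)) (prod_norm m B)"
proof (rule seminorm_on_subset[OF seminorm_on_prod_norm[OF S_bounded_subset[OF assms(1)] assms(2)]])
  show "topspace (OM_space \<omega>) \<subseteq> {f. smooth f}" using OM_dbound(1)[of _ 1] by auto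
qed

lemma OM_bounded_prod_norm:
  assumes A: "tvs_bounded (OM_space \<omega>) A" and B: "tvs_bounded (S_space \<omega>) B" and m: "1 \<le> m"
  shows "\<exists>r. \<forall>f\<in>A. prod_norm m B f \<le> ennreal r"
proof (rule tvs_bounded_seminorm[OF A _ seminorm_on_OM_prod_norm[OF B m]])
  have z: "0 \<in> topspace (OM_space \<omega>)" by (rule csubspaceD(1)[OF csubspace_OM])
  show "zero_nhd (OM_space \<omega>) {f \<in> topspace (OM_space \<omega>). prod_norm m B f < ennreal 1}"
    unfolding zero_nhd_def
    using openin_OM_prod_norm[OF B m z, of 1] z seminorm_on_zero[OF seminorm_on_OM_prod_norm[OF B m] z]
    by (intro conjI exI[of _ "{f \<in> topspace (OM_space \<omega>). prod_norm m B f < ennreal 1}"]) auto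
qed

lemma OM_prod_norm_finite:
  assumes f: "f \<in> topspace (OM_space \<omega>)" and B: "tvs_bounded (S_space \<omega>) B" and m: "1 \<le> m"
  shows "\<exists>r. prod_norm m B f \<le> ennreal r"
proof -
  have M: "1 \<le> \<kappa> * m" using mult_le_mono[OF kappa(1) m] by simp
  obtain n :: nat and A where nA: "1 \<le> n" "dbound (\<kappa> * m) (- real n) f A" using OM_dbound(2)[OF f M] by blast
  then show ?thesis using prod_norm_bound[OF B m nA(1)] OM_dbound(1)[OF f M] by blast
qed

text \<open>The restriction of T to \<open>S_set \<omega>\<close> inside \<open>mult_op\<close> has
  no effect on f * g, which stays in \<open>WS\<close>.\<close>

lemma mult_op_apply:
  assumes "f \<in> topspace (OM_space \<omega>)"
  shows "mult_op \<omega> f T g = (if g \<in> WS then T (f * g) else 0)"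
  unfolding mult_op_def mult_S'_def restrict_S_def S_set_eq_WS using OM_mult_WS[OF assms] by simp

lemma dual_OC_linear:
  assumes "T \<in> dual_space (OC_space \<omega>)" "u \<in> WS" "v \<in> WS"
  shows "T (u + v) = T u + T v" "T (\<lambda>x. c * u x) = c * T u" "T (u - v) = T u - T v"
proof -
  have uv: "u \<in> topspace (OC_space \<omega>)" "v \<in> topspace (OC_space \<omega>)" using assms WS_subset_OC by blast+
  have add: "\<And>u v. u \<in> topspace (OC_space \<omega>) \<Longrightarrow> v \<in> topspace (OC_space \<omega>) \<Longrightarrow> T (u + v) = T u + T v"
    and scale: "\<And>c u. u \<in> topspace (OC_space \<omega>) \<Longrightarrow> T (\<lambda>x. c * u x) = c * T u"
    using assms(1) unfolding dual_space_def by blast+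
  show "T (u + v) = T u + T v" "T (\<lambda>x. c * u x) = c * T u" by (rule add[OF uv], rule scale[OF uv(1)])
  have "u - v \<in> topspace (OC_space \<omega>)" by (rule csubspaceD(4)[OF csubspace_OC uv])
  from add[OF this uv(2)] show "T (u - v) = T u - T v" by simp
qed

lemma dual_OC_estimate:
  assumes T: "T \<in> dual_space (OC_space \<omega>)"
  shows "\<exists>m\<ge>1. \<exists>C>0. \<forall>h\<in>F_set 1. cmod (T h) \<le> C * enn2real (O_norm \<omega> m 1 h)"
proof -
  have "\<exists>m\<ge>1. \<exists>C>0. \<forall>S\<in>{T}. \<forall>h\<in>F_set 1. cmod (S h) \<le> C * enn2real (O_norm \<omega> m 1 h)"
    by (rule equicontinuous_estimate) (use T dual_bounded_on_bounded[OF csubspace_OC T] in auto)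
  then show ?thesis by simp
qed

text \<open>The estimate of T on the first step and the Leibniz bound give |T (f * g)| \<le> const
  \<open>S_norm \<omega> (\<kappa> * m) n g\<close>, where n is the growth exponent of f at index
  \<open>\<kappa> * m\<close>.\<close>

lemma mult_op_in_dual:
  fixes f :: "real^'n::finite \<Rightarrow> complex"
  assumes f: "f \<in> topspace (OM_space \<omega>)" and T: "T \<in> dual_space (OC_space \<omega>)"
  shows "mult_op \<omega> f T \<in> dual_space (S_space \<omega>)"
proof -
  let ?S = "mult_op \<omega> f T"
  have S: "?S g = T (f * g)" if "g \<in> WS" for g using that by (simp add: mult_op_apply[OF f])
  note fW = OM_mult_WS[OF f]
  have lin: "?S (g + h) = ?S g + ?S h" "?S (g - h) = ?S g - ?S h" "?S (\<lambda>x. c * g x) = c * ?S g"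
    if gh: "g \<in> WS" "h \<in> WS" for g h c
  proof -
    have d: "g - h \<in> WS" by (rule csubspaceD(4)[OF csubspace_WS gh])
    note T' = dual_OC_linear[OF T fW[OF gh(1)] fW[OF gh(2)]]
    have "f * (g + h) = f * g + f * h" by (rule distrib_left)
    then show "?S (g + h) = ?S g + ?S h" using T'(1) S[OF gh(1)] S[OF gh(2)] S[OF WS_add[OF gh]] by metis
    have "f * (g - h) = f * g - f * h" by (rule right_diff_distrib)
    then show "?S (g - h) = ?S g - ?S h" using T'(3) S[OF gh(1)] S[OF gh(2)] S[OF d] by metis
    have "f * (\<lambda>x. c * g x) = (\<lambda>x. c * (f * g) x)" by (simp add: fun_eq_iff)
    then show "?S (\<lambda>x. c * g x) = c * ?S g" using T'(2)[of c] S[OF gh(1)] S[OF WS_cmult[OF gh(1)], of c] by metis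
  qed
  obtain m C where mC: "1 \<le> m" "0 < C" "\<forall>h\<in>F_set 1. cmod (T h) \<le> C * enn2real (O_norm \<omega> m 1 h)"
    using dual_OC_estimate[OF T] by blast
  let ?M = "\<kappa> * m"
  have M: "1 \<le> ?M" using mult_le_mono[OF kappa(1) mC(1)] by simp
  obtain n :: nat and A where nA: "1 \<le> n" "0 \<le> A" "dbound ?M (- real n) f A" using OM_dbound(2)[OF f M] by blast
  have sf: "smooth f" by (rule OM_dbound(1)[OF f M])
  obtain K where K: "0 < K" "\<forall>(u :: real^'n \<Rightarrow> complex) v r s A B. smooth u \<and> smooth v \<and>
      dbound ?M r u A \<and> dbound ?M s v B \<longrightarrow> dbound m (r + s) (u * v) (K * (A * B))"
    using dbound_mult[OF mC(1)] by blast
  have est: "cmod (?S g) \<le> C * (K * A) * b" if g: "g \<in> WS" "S_norm \<omega> ?M n g \<le> ennreal b" "0 \<le> b" for g b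
  proof -
    have sg: "smooth g" by (rule WS_smooth[OF g(1)])
    have "dbound ?M (real n) g b" using g S_norm_le_iff[OF sg M] by blast
    then have "dbound m (- real n + real n) (f * g) (K * (A * b))" using K(2) sf sg nA(3) by blast
    then have "dbound m (- real 1) (f * g) (K * (A * b))" by (rule dbound_mono) (use mC(1) in auto)
    moreover have nn: "0 \<le> K * (A * b)" using K(1) nA(2) g(3) by simp
    ultimately have "O_norm \<omega> m 1 (f * g) \<le> ennreal (K * (A * b))"
      using O_norm_le_iff[OF smooth_mult[OF sf sg] mC(1)] by blast
    then have "enn2real (O_norm \<omega> m 1 (f * g)) \<le> K * (A * b)"
      using nn by (rule enn2real_leI[rotated])
    then have "C * enn2real (O_norm \<omega> m 1 (f * g)) \<le> C * (K * (A * b))" using mC(2) by simp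
    moreover have "cmod (T (f * g)) \<le> C * enn2real (O_norm \<omega> m 1 (f * g))"
      using mC(3) fW[OF g(1)] WS_subset_F_set by blast
    ultimately show ?thesis unfolding S[OF g(1)] by (simp add: mult.assoc)
  qed
  have "continuous_map (S_space \<omega>) euclidean ?S"
    unfolding continuous_map_def
  proof (intro conjI allI impI)
    fix W :: "complex set" assume W: "openin euclidean W"
    show "openin (S_space \<omega>) {g \<in> topspace (S_space \<omega>). ?S g \<in> W}"
      unfolding openin_subopen[of _ "{g \<in> topspace (S_space \<omega>). ?S g \<in> W}"]
    proof
      fix g assume "g \<in> {g \<in> topspace (S_space \<omega>). ?S g \<in> W}"
      then have g: "g \<in> WS" "?S g \<in> W" unfolding topspace_S by (simp_all only: mem_Collect_eq)
      obtain d where d: "0 < d" "ball (?S g) d \<subseteq> W"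
        using W g(2) unfolding open_openin[symmetric] by (rule openE)
      \<comment> \<open>The summand 1 avoids division by zero, since \<open>A\<close> may
        vanish.\<close>
      define b where "b = d / (C * (K * A) + 1)"
      have CKA: "0 \<le> C * (K * A)" using mC(2) K(1) nA(2) by simp
      have b: "0 < b" "C * (K * A) * b < d"
        unfolding b_def using d(1) CKA by (auto simp: field_simps)
      let ?U = "{h \<in> WS. S_norm \<omega> ?M n (h - g) < ennreal b}"
      have sn: "seminorm_on (WS :: (real^'n \<Rightarrow> complex) set) (S_norm \<omega> ?M n)" by (rule seminorm_on_S_norm[OF M])
      have "openin (S_space \<omega>) ?U"
        unfolding S_space_def S_set_eq_WS
        by (rule openin_seminorm_ball[OF csubspace_WS _ sn g(1)], rule CollectI, rule exI[of _ ?M], rule exI[of _ n])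
          (intro conjI refl M nA(1))
      moreover have "g \<in> ?U"
        by (rule seminorm_ball_centre[OF csubspace_WS sn g(1) b(1)])
      moreover have "?U \<subseteq> {g \<in> topspace (S_space \<omega>). ?S g \<in> W}"
      proof
        fix h assume h: "h \<in> ?U"
        then have hW: "h \<in> WS" by blast
        have "cmod (?S (h - g)) \<le> C * (K * A) * b"
          using h b(1) by (intro est csubspaceD(4)[OF csubspace_WS hW g(1)]) auto
        then have "dist (?S g) (?S h) < d"
          using b(2) lin(2)[OF hW g(1)] by (simp add: dist_norm norm_minus_commute)
        then have "?S h \<in> W" using d(2) by (simp add: subset_iff)
        then show "h \<in> {g \<in> topspace (S_space \<omega>). ?S g \<in> W}" using hW by (simp only: topspace_S mem_Collect_eq)
      qed
      ultimately show "\<exists>U. openin (S_space \<omega>) U \<and> g \<in> U \<and> U \<subseteq> {g \<in> topspace (S_space \<omega>). ?S g \<in> W}"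
        by (intro exI[of _ ?U] conjI)
    qed
  qed simp
  moreover have "?S g = 0" if "g \<notin> WS" for g using that by (simp only: mult_op_apply[OF f] if_False)
  moreover have "?S (g + h) = ?S g + ?S h" if "g \<in> WS" "h \<in> WS" for g h by (rule lin(1)[OF that])
  moreover have "?S (\<lambda>x. c * g x) = c * ?S g" if "g \<in> WS" for g c by (rule lin(3)[OF that that])
  ultimately show ?thesis
    unfolding dual_space_def topspace_S mem_Collect_eq by (intro conjI allI impI ballI)
qed

lemma topspace_strong_dual: "topspace (strong_dual X) = dual_space X"
  unfolding strong_dual_def by simp

lemma bilinear_mult_op:
  "bilinear_between (OM_space \<omega> :: (real^'n::finite \<Rightarrow> complex) topology)
     (strong_dual (OC_space \<omega>)) (strong_dual (S_space \<omega>)) (mult_op \<omega>)"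
  unfolding bilinear_between_def linear_between_def topspace_strong_dual
proof (intro conjI ballI allI mult_op_in_dual)
  fix f :: "real^'n \<Rightarrow> complex" assume f: "f \<in> topspace (OM_space \<omega>)"
  show "mult_op \<omega> f (S + T) = mult_op \<omega> f S + mult_op \<omega> f T" for S T
    by (simp add: fun_eq_iff mult_op_apply[OF f])
  show "mult_op \<omega> f (\<lambda>x. c * T x) = (\<lambda>y. c * mult_op \<omega> f T y)" for c T
    by (simp add: fun_eq_iff mult_op_apply[OF f])
next
  fix T :: "(real^'n \<Rightarrow> complex) \<Rightarrow> complex" and f g :: "real^'n \<Rightarrow> complex"
  assume T: "T \<in> dual_space (OC_space \<omega>)" and fg: "f \<in> topspace (OM_space \<omega>)" "g \<in> topspace (OM_space \<omega>)"
  show "mult_op \<omega> (f + g) T = mult_op \<omega> f T + mult_op \<omega> g T"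
  proof
    fix u
    have "(f + g) * u = f * u + g * u" by (simp only: distrib_right)
    then have "T ((f + g) * u) = T (f * u) + T (g * u)" if "u \<in> WS"
      using dual_OC_linear(1)[OF T OM_mult_WS[OF fg(1) that] OM_mult_WS[OF fg(2) that]] by metis
    then show "mult_op \<omega> (f + g) T u = (mult_op \<omega> f T + mult_op \<omega> g T) u"
      unfolding plus_fun_apply[of "mult_op \<omega> f T"] mult_op_apply[OF fg(1)] mult_op_apply[OF fg(2)]
        mult_op_apply[OF csubspaceD(2)[OF csubspace_OM fg]]
      by (cases "u \<in> WS") (simp_all only: if_True if_False add_0_right)
  qed
next
  fix T :: "(real^'n \<Rightarrow> complex) \<Rightarrow> complex" and c and f :: "real^'n \<Rightarrow> complex"
  assume T: "T \<in> dual_space (OC_space \<omega>)" and f: "f \<in> topspace (OM_space \<omega>)"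
  show "mult_op \<omega> (\<lambda>x. c * f x) T = (\<lambda>y. c * mult_op \<omega> f T y)"
  proof
    fix u
    have "(\<lambda>x. c * f x) * u = (\<lambda>x. c * (f * u) x)" by (simp add: fun_eq_iff mult.assoc)
    then have "T ((\<lambda>x. c * f x) * u) = c * T (f * u)" if "u \<in> WS"
      using dual_OC_linear(2)[OF T OM_mult_WS[OF f that] OM_mult_WS[OF f that], of c] by metis
    then show "mult_op \<omega> (\<lambda>x. c * f x) T u = c * mult_op \<omega> f T u"
      unfolding mult_op_apply[OF f] mult_op_apply[OF csubspaceD(3)[OF csubspace_OM f]]
      by (cases "u \<in> WS") (simp_all only: if_True if_False mult_zero_right)
  qed
qed

section \<open>Equicontinuity in each variable\<close>

lemma linear_mult_op_right:
  fixes f :: "real^'n::finite \<Rightarrow> complex"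
  assumes "f \<in> topspace (OM_space \<omega>)"
  shows "linear_between (strong_dual (OC_space \<omega>)) (strong_dual (S_space \<omega>)) (mult_op \<omega> f)"
  by (rule bspec[OF conjunct1[OF bilinear_mult_op[unfolded bilinear_between_def]] assms])

lemma linear_mult_op_left:
  fixes T :: "(real^'n::finite \<Rightarrow> complex) \<Rightarrow> complex"
  assumes "T \<in> dual_space (OC_space \<omega>)"
  shows "linear_between (OM_space \<omega>) (strong_dual (S_space \<omega>)) (\<lambda>f. mult_op \<omega> f T)"
  by (rule bspec[OF conjunct2[OF bilinear_mult_op[unfolded bilinear_between_def topspace_strong_dual]] assms])

lemma csubspace_dual_S: "csubspace (dual_space (S_space \<omega>))"
  by (rule csubspace_dual_space) (simp only: topspace_S csubspace_WS)

text \<open>The supremum over \<open>B\<close> of f S - f T is at most the supremum of S - T over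
  all products of \<open>A\<close> and \<open>B\<close>. By \<open>bdd\<close> every norm
  \<open>O_norm \<omega> m 1\<close> is bounded on these products, so they form a bounded set of
  \<open>OC_space\<close>, and its seminorm is one of the strong dual.\<close>

lemma equicontinuous_left:
  fixes A :: "(real^'n::finite \<Rightarrow> complex) set"
  assumes A: "A \<subseteq> topspace (OM_space \<omega>)"
    and bdd: "\<And>m B. 1 \<le> m \<Longrightarrow> tvs_bounded (S_space \<omega>) B \<Longrightarrow> \<exists>r. \<forall>f\<in>A. prod_norm m B f \<le> ennreal r"
  shows "equicontinuous_between (strong_dual (OC_space \<omega>)) (strong_dual (S_space \<omega>)) (mult_op \<omega> ` A)"
  unfolding strong_dual_def[of "S_space \<omega>"]
proof (rule equicontinuous_between_seminorm_topology[OF csubspace_dual_S])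
  show "linear_between (strong_dual (OC_space \<omega>))
      (seminorm_topology (dual_space (S_space \<omega>)) {\<lambda>T. SUP f\<in>B. ennreal (cmod (T f)) |B. tvs_bounded (S_space \<omega>) B}) h"
    if "h \<in> mult_op \<omega> ` A" for h
  proof -
    obtain f where f: "f \<in> A" "h = mult_op \<omega> f" using \<open>h \<in> mult_op \<omega> ` A\<close> by (elim imageE)
    show ?thesis
      using linear_mult_op_right[OF subsetD[OF A f(1)]] unfolding f(2) strong_dual_def[of "S_space \<omega>"] .
  qed
next
  fix T :: "(real^'n \<Rightarrow> complex) \<Rightarrow> complex" and e :: real
    and p :: "((real^'n \<Rightarrow> complex) \<Rightarrow> complex) \<Rightarrow> ennreal"
  assume T: "T \<in> topspace (strong_dual (OC_space \<omega>))" and e: "0 < e"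
    and "p \<in> {\<lambda>T. SUP f\<in>B. ennreal (cmod (T f)) |B. tvs_bounded (S_space \<omega>) B}" (is "_ \<in> ?P")
  from \<open>p \<in> ?P\<close> obtain B where p: "p = (\<lambda>T. SUP g\<in>B. ennreal (cmod (T g)))" and B: "tvs_bounded (S_space \<omega>) B"
    unfolding mem_Collect_eq by (elim exE conjE)
  note BW = S_bounded_subset[OF B]
  let ?D = "(\<lambda>(f, g). f * g) ` (A \<times> B)"
  have D: "tvs_bounded (OC_space \<omega>) ?D"
  proof (rule OC_bounded)
    have "f * g \<in> F_set 1" if "f \<in> A" "g \<in> B" for f g
      by (rule subsetD[OF WS_subset_F_set OM_mult_WS[OF subsetD[OF A that(1)] subsetD[OF BW that(2)]]])
    then show "?D \<subseteq> F_set 1" by auto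
    fix m :: nat assume "1 \<le> m"
    from bdd[OF this B] obtain r where r: "\<forall>f\<in>A. prod_norm m B f \<le> ennreal r" by (elim exE)
    have "O_norm \<omega> m 1 (f * g) \<le> ennreal r" if f: "f \<in> A" and g: "g \<in> B" for f g
    proof -
      have "O_norm \<omega> m 1 (f * g) \<le> prod_norm m B f"
        unfolding prod_norm_def using g by (rule SUP_upper)
      also have "\<dots> \<le> ennreal r" using r f by (rule bspec)
      finally show ?thesis .
    qed
    then show "\<exists>C. \<forall>h\<in>?D. O_norm \<omega> m 1 h \<le> ennreal C" by auto
  qed
  let ?q = "\<lambda>T. SUP h\<in>?D. ennreal (cmod (T h))"
  let ?U = "{S \<in> dual_space (OC_space \<omega>). ?q (S - T) < ennreal e}"
  have V: "csubspace (dual_space (OC_space \<omega> :: (real^'n \<Rightarrow> complex) topology))"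
    by (rule csubspace_dual_space[OF csubspace_OC])
  have T': "T \<in> dual_space (OC_space \<omega>)" using T by (simp add: topspace_strong_dual)
  have "openin (strong_dual (OC_space \<omega>)) ?U"
    unfolding strong_dual_def
    by (rule openin_seminorm_ball[OF V _ seminorm_on_sup_norm T'], rule CollectI, rule exI[of _ ?D]) (intro conjI refl D)
  moreover have "T \<in> ?U"
    by (rule seminorm_ball_centre[OF V seminorm_on_sup_norm T' e])
  moreover have "p (mult_op \<omega> f S - mult_op \<omega> f T) < ennreal e" if f: "f \<in> A" and S: "S \<in> ?U" for f S
  proof -
    have fM: "f \<in> topspace (OM_space \<omega>)" using f A by blast
    have "p (mult_op \<omega> f S - mult_op \<omega> f T) \<le> ?q (S - T)"
      unfolding p
    proof (rule SUP_least)
      fix g assume g: "g \<in> B"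
      have eq: "(mult_op \<omega> f S - mult_op \<omega> f T) g = (S - T) (f * g)"
        using subsetD[OF BW g] by (simp only: fun_diff_def mult_op_apply[OF fM] if_True)
      have "f * g \<in> ?D" by (rule image_eqI[of _ _ "(f, g)"]) (use f g in simp_all)
      then show "ennreal (cmod ((mult_op \<omega> f S - mult_op \<omega> f T) g)) \<le> ?q (S - T)"
        unfolding eq by (rule SUP_upper)
    qed
    also have "\<dots> < ennreal e" using S by blast
    finally show ?thesis .
  qed
  ultimately show "\<exists>U. openin (strong_dual (OC_space \<omega>)) U \<and> T \<in> U \<and>
      (\<forall>h\<in>mult_op \<omega> ` A. \<forall>S\<in>U. p (h S - h T) < ennreal e)"
    by (intro exI[of _ ?U] conjI ballI) (auto simp only: image_iff)
qed

text \<open>The uniform estimate for the functionals in \<open>D\<close> bounds the supremum over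
  \<open>B\<close> of T ((g - f) * u) by C times \<open>prod_norm m B (g - f)\<close>, which is
  continuous in g.\<close>

lemma equicontinuous_right:
  fixes D :: "((real^'n::finite \<Rightarrow> complex) \<Rightarrow> complex) set"
  assumes D: "D \<subseteq> dual_space (OC_space \<omega>)"
    and bdd: "\<And>H. tvs_bounded (OC_space \<omega>) H \<Longrightarrow> \<exists>r. \<forall>T\<in>D. \<forall>h\<in>H. cmod (T h) \<le> r"
  shows "equicontinuous_between (OM_space \<omega>) (strong_dual (S_space \<omega>)) ((\<lambda>T f. mult_op \<omega> f T) ` D)"
  unfolding strong_dual_def[of "S_space \<omega>"]
proof (rule equicontinuous_between_seminorm_topology[OF csubspace_dual_S])
  show "linear_between (OM_space \<omega>)
      (seminorm_topology (dual_space (S_space \<omega>)) {\<lambda>T. SUP f\<in>B. ennreal (cmod (T f)) |B. tvs_bounded (S_space \<omega>) B}) h"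
    if "h \<in> (\<lambda>T f. mult_op \<omega> f T) ` D" for h :: "(real^'n \<Rightarrow> complex) \<Rightarrow> _"
  proof -
    obtain T where T: "T \<in> D" "h = (\<lambda>f. mult_op \<omega> f T)"
      using \<open>h \<in> (\<lambda>T f. mult_op \<omega> f T) ` D\<close> by (elim imageE)
    show ?thesis
      using linear_mult_op_left[OF subsetD[OF D T(1)]] unfolding T(2) strong_dual_def[of "S_space \<omega>"] .
  qed
next
  fix f :: "real^'n \<Rightarrow> complex" and e :: real
    and p :: "((real^'n \<Rightarrow> complex) \<Rightarrow> complex) \<Rightarrow> ennreal"
  assume f: "f \<in> topspace (OM_space \<omega>)" and e: "0 < e"
    and "p \<in> {\<lambda>T. SUP f\<in>B. ennreal (cmod (T f)) |B. tvs_bounded (S_space \<omega>) B}" (is "_ \<in> ?P")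
  from \<open>p \<in> ?P\<close> obtain B where p: "p = (\<lambda>T. SUP g\<in>B. ennreal (cmod (T g)))" and B: "tvs_bounded (S_space \<omega>) B"
    unfolding mem_Collect_eq by (elim exE conjE)
  note BW = S_bounded_subset[OF B]
  have "\<exists>m\<ge>1. \<exists>C>0. \<forall>T\<in>D. \<forall>h\<in>F_set 1. cmod (T h) \<le> C * enn2real (O_norm \<omega> m 1 h)"
    by (rule equicontinuous_estimate[OF D]) (rule bdd)
  then obtain m C where mC: "1 \<le> m" "0 < C"
    "\<forall>T\<in>D. \<forall>h\<in>F_set 1. cmod (T h) \<le> C * enn2real (O_norm \<omega> m 1 h)"
    by (elim exE conjE)
  \<comment> \<open>The factor 2 restores strictness: the supremum over \<open>B\<close> only yields
    \<le> e / 2.\<close>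
  let ?U = "{g \<in> topspace (OM_space \<omega>). prod_norm m B (g - f) < ennreal (e / (2 * C))}"
  have "openin (OM_space \<omega>) ?U" by (rule openin_OM_prod_norm[OF B mC(1) f])
  moreover have "f \<in> ?U"
    using e mC(2) by (intro seminorm_ball_centre[OF csubspace_OM seminorm_on_OM_prod_norm[OF B mC(1)] f]) simp
  moreover have "p (mult_op \<omega> g T - mult_op \<omega> f T) < ennreal e" if T: "T \<in> D" and g: "g \<in> ?U" for g T
  proof -
    have gM: "g \<in> topspace (OM_space \<omega>)" using g by blast
    have gf: "g - f \<in> topspace (OM_space \<omega>)" by (rule csubspaceD(4)[OF csubspace_OM gM f])
    have "p (mult_op \<omega> g T - mult_op \<omega> f T) \<le> ennreal (e / 2)"
      unfolding p
    proof (rule SUP_least)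
      fix u assume u: "u \<in> B"
      then have uW: "u \<in> WS" using BW by blast
      have "(mult_op \<omega> g T - mult_op \<omega> f T) u = T (g * u) - T (f * u)"
        using uW by (simp only: fun_diff_def mult_op_apply[OF gM] mult_op_apply[OF f] if_True)
      also have "\<dots> = T (g * u - f * u)"
        by (rule dual_OC_linear(3)[OF subsetD[OF D T] OM_mult_WS[OF gM uW] OM_mult_WS[OF f uW], symmetric])
      also have "g * u - f * u = (g - f) * u" by (simp only: left_diff_distrib)
      finally have eq: "(mult_op \<omega> g T - mult_op \<omega> f T) u = T ((g - f) * u)" .
      have "O_norm \<omega> m 1 ((g - f) * u) \<le> prod_norm m B (g - f)"
        unfolding prod_norm_def using u by (rule SUP_upper)
      also have "\<dots> \<le> ennreal (e / (2 * C))" using g by (simp add: less_imp_le)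
      finally have "enn2real (O_norm \<omega> m 1 ((g - f) * u)) \<le> e / (2 * C)"
        using e mC(2) by (intro enn2real_leI) auto
      then have "C * enn2real (O_norm \<omega> m 1 ((g - f) * u)) \<le> C * (e / (2 * C))"
        using mC(2) by (intro mult_left_mono) auto
      also have "\<dots> = e / 2" using mC(2) by simp
      finally have "cmod (T ((g - f) * u)) \<le> e / 2"
        using mC(3)[rule_format, OF T subsetD[OF WS_subset_F_set OM_mult_WS[OF gf uW]]] by linarith
      then show "ennreal (cmod ((mult_op \<omega> g T - mult_op \<omega> f T) u)) \<le> ennreal (e / 2)"
        unfolding eq by (rule ennreal_leI)
    qed
    also have "\<dots> < ennreal e" using e by (intro ennreal_lessI) auto
    finally show ?thesis .
  qed
  ultimately show "\<exists>U. openin (OM_space \<omega>) U \<and> f \<in> U \<and>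
      (\<forall>h\<in>(\<lambda>T f. mult_op \<omega> f T) ` D. \<forall>g\<in>U. p (h g - h f) < ennreal e)"
    by (intro exI[of _ ?U] conjI ballI) (auto simp only: image_iff)
qed

end

theorem corollary4p4:
  fixes \<omega> :: "real \<Rightarrow> real"
  assumes "nonquasianalytic_weight \<omega>"
    and "(\<lambda>t. ln (1 + t)) \<in> o[at_top](\<omega>)"
  shows "bilinear_between (OM_space \<omega> :: (real^'n::finite \<Rightarrow> complex) topology)
           (strong_dual (OC_space \<omega>)) (strong_dual (S_space \<omega>)) (mult_op \<omega>) \<and>
    separately_continuous (OM_space \<omega> :: (real^'n \<Rightarrow> complex) topology)
           (strong_dual (OC_space \<omega>)) (strong_dual (S_space \<omega>)) (mult_op \<omega>) \<and>
    hypocontinuous (OM_space \<omega> :: (real^'n \<Rightarrow> complex) topology)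
           (strong_dual (OC_space \<omega>)) (strong_dual (S_space \<omega>)) (mult_op \<omega>)"
proof (intro conjI)
  interpret weight \<omega> by standard (fact assms)+
  show "bilinear_between (OM_space \<omega> :: (real^'n \<Rightarrow> complex) topology)
      (strong_dual (OC_space \<omega>)) (strong_dual (S_space \<omega>)) (mult_op \<omega>)"
    by (rule bilinear_mult_op)
  show "separately_continuous (OM_space \<omega> :: (real^'n \<Rightarrow> complex) topology)
      (strong_dual (OC_space \<omega>)) (strong_dual (S_space \<omega>)) (mult_op \<omega>)"
    unfolding separately_continuous_def
  proof (intro conjI ballI)
    fix f :: "real^'n \<Rightarrow> complex" assume f: "f \<in> topspace (OM_space \<omega>)"
    \<comment> \<open>Separate continuity is the case of one-element sets; the bound comes directly
      from finiteness of \<open>prod_norm\<close> at f.\<close>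
    have "equicontinuous_between (strong_dual (OC_space \<omega>)) (strong_dual (S_space \<omega>)) (mult_op \<omega> ` {f})"
      by (rule equicontinuous_left) (use f OM_prod_norm_finite[OF f] in auto)
    then show "continuous_map (strong_dual (OC_space \<omega>)) (strong_dual (S_space \<omega>)) (mult_op \<omega> f)"
      unfolding equicontinuous_between_def by simp
  next
    fix T :: "(real^'n \<Rightarrow> complex) \<Rightarrow> complex" assume "T \<in> topspace (strong_dual (OC_space \<omega>))"
    then have T: "T \<in> dual_space (OC_space \<omega>)" by (simp add: topspace_strong_dual)
    have "equicontinuous_between (OM_space \<omega>) (strong_dual (S_space \<omega>)) ((\<lambda>T f. mult_op \<omega> f T) ` {T})"
      by (rule equicontinuous_right) (use T dual_bounded_on_bounded[OF csubspace_OC T] in auto)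
    then show "continuous_map (OM_space \<omega>) (strong_dual (S_space \<omega>)) (\<lambda>f. mult_op \<omega> f T)"
      unfolding equicontinuous_between_def by simp
  qed
  show "hypocontinuous (OM_space \<omega> :: (real^'n \<Rightarrow> complex) topology)
      (strong_dual (OC_space \<omega>)) (strong_dual (S_space \<omega>)) (mult_op \<omega>)"
    unfolding hypocontinuous_def
  proof (intro conjI allI impI)
    fix A :: "(real^'n \<Rightarrow> complex) set" assume A: "tvs_bounded (OM_space \<omega>) A"
    show "equicontinuous_between (strong_dual (OC_space \<omega>)) (strong_dual (S_space \<omega>)) (mult_op \<omega> ` A)"
    proof (rule equicontinuous_left)
      show "A \<subseteq> topspace (OM_space \<omega>)" using A unfolding tvs_bounded_def by blast
    qed (rule OM_bounded_prod_norm[OF A])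
  next
    fix D :: "((real^'n \<Rightarrow> complex) \<Rightarrow> complex) set" assume D: "tvs_bounded (strong_dual (OC_space \<omega>)) D"
    show "equicontinuous_between (OM_space \<omega>) (strong_dual (S_space \<omega>)) ((\<lambda>T f. mult_op \<omega> f T) ` D)"
    proof (rule equicontinuous_right)
      show "D \<subseteq> dual_space (OC_space \<omega>)" using D unfolding tvs_bounded_def topspace_strong_dual by blast
    qed (rule strong_dual_bounded_on_bounded[OF csubspace_OC D])
  qed
qed

end
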